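(* Let $X$ be a compact metric space and let $T\colon X\to X$ be a continuous transformation. Let $A=(t_i)_{i\ge1}$ be a sequence of natural numbers, and define $$S_A(n,m)=\{t_i+j: i=1,\dots,n,\ j=0,\dots,m-1\},\quad n,m\in\mathbb{N},\qquad K(A)=\lim_{m\to\infty}\limsup_{n\to\infty}\frac1n|S_A(n,m)|\in[0,\infty].$$ Let $M_T(X)$ be the set of $T$-invariant Borel probability measures on $X$. Then: (1) $\displaystyle\sup_{\mu\in M_T(X)}h^A_\mu(T)\le h^A_{top}(T)$. (2) Unless ($K(A)=\infty$ and $h_{top}(T)=0$), $\displaystyle\sup_{\mu\in M_T(X)}h^A_\mu(T)=h^A_{top}(T)$. (3) Unless ($K(A)=\infty$ and $h_{top}(T)=0$), $$h^A_{top}(T)=\begin{cases}K(A)\,h_{top}(T)& K(A)<\infty,\ h_{top}(T)<\infty\\ \infty& K(A)=\infty,\ h_{top}(T)>0\\ \infty& K(A)>0,\ h_{top}(T)=\infty\\ 0& K(A)=0,\ h_{top}(T)=\infty.\end{cases}$$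
   Context: $X$ is nonempty; $T$ need not be invertible, and the sequence $A$ is arbitrary (repetitions allowed). $\mathbb{N}$ contains $0$. Topological sequence entropy: for a finite open cover $\mathcal{U}$ of $X$ and finite $F\subset\mathbb{N}$, let $\mathcal{U}^F=\bigvee_{i\in F}T^{-i}\mathcal{U}$ be the common refinement and let $N(\cdot)$ be the minimal cardinality of a subcover. Put $h^A_{top}(T,\mathcal{U})=\limsup_{n}\frac1n\log N(\mathcal{U}^{\{t_1,\dots,t_n\}})$ and $h^A_{top}(T)=\sup_{\mathcal{U}}h^A_{top}(T,\mathcal{U})$, the supremum over finite open covers. $h_{top}(T)$ is the case $t_n=n-1$, i.e. the usual topological entropy. Measure-theoretic sequence entropy: for $\mu\in M_T(X)$ and a finite Borel partition $\xi$, let $H(\xi)=-\sum_{P\in\xi}\mu(P)\log\mu(P)$ and $\xi^F=\bigvee_{i\in F}T^{-i}\xi$. Put $h^A_\mu(T,\xi)=\limsup_n\frac1nH(\xi^{\{t_1,\dots,t_n\}})$ and $h^A_\mu(T)=\sup_\xi h^A_\mu(T,\xi)$, the supremum over finite Borel partitions. *)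

theory Defs
  imports "HOL-Probability.Probability" "HOL-Library.Disjoint_Sets"
begin

(* The compact metric space X is a type of class metric_space whose universe is compact;
   X is then automatically nonempty.  Sequences (t_i), i >= 1, are functions A :: nat => nat
   of which the value A 0 is never used. *)

definition sumset_SA :: "(nat \<Rightarrow> nat) \<Rightarrow> nat \<Rightarrow> nat \<Rightarrow> nat set" where
  "sumset_SA A n m = {A i + j | i j. i \<in> {1..n} \<and> j \<in> {..<m}}"

definition K_const :: "(nat \<Rightarrow> nat) \<Rightarrow> ereal" where
  "K_const A = lim (\<lambda>m. limsup (\<lambda>n. ereal (real (card (sumset_SA A n m)) / real n)))"

(* The join over i in F of the families T^{-i} C; used both for covers and for partitions.
   For F = {} it is {UNIV}.  For a partition C, distinct choices u (on F) yield disjoint sets,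
   so only the empty set can arise from several choices. *)
definition dyn_join :: "('a \<Rightarrow> 'a) \<Rightarrow> 'a set set \<Rightarrow> nat set \<Rightarrow> 'a set set" where
  "dyn_join T C F = {(\<Inter>i\<in>F. (T ^^ i) -` u i) | u. \<forall>i\<in>F. u i \<in> C}"

definition finite_open_covers :: "'a::topological_space set set set" where
  "finite_open_covers = {U. finite U \<and> (\<forall>V\<in>U. open V) \<and> \<Union>U = UNIV}"

definition min_subcover_card :: "'a set set \<Rightarrow> nat" where
  "min_subcover_card U = Inf {card W | W. W \<subseteq> U \<and> finite W \<and> \<Union>W = UNIV}"

definition top_seq_entropy_cover :: "(nat \<Rightarrow> nat) \<Rightarrow> ('a \<Rightarrow> 'a) \<Rightarrow> 'a set set \<Rightarrow> ereal" where
  "top_seq_entropy_cover A T U =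
     limsup (\<lambda>n. ereal (ln (real (min_subcover_card (dyn_join T U (A ` {1..n})))) / real n))"

definition top_seq_entropy :: "(nat \<Rightarrow> nat) \<Rightarrow> ('a::topological_space \<Rightarrow> 'a) \<Rightarrow> ereal" where
  "top_seq_entropy A T = (SUP U\<in>finite_open_covers. top_seq_entropy_cover A T U)"

definition top_entropy :: "('a::topological_space \<Rightarrow> 'a) \<Rightarrow> ereal" where
  "top_entropy T = top_seq_entropy (\<lambda>n. n - 1) T"

definition invariant_prob_measures :: "('a::topological_space \<Rightarrow> 'a) \<Rightarrow> 'a measure set" where
  "invariant_prob_measures T =
     {\<mu>. prob_space \<mu> \<and> sets \<mu> = sets borel \<and> distr \<mu> borel T = \<mu>}"

definition finite_borel_partitions :: "'a::topological_space set set set" where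
  "finite_borel_partitions = {\<xi>. finite \<xi> \<and> \<xi> \<subseteq> sets borel \<and> partition_on UNIV \<xi>}"

(* The convention 0 log 0 = 0 holds since ln 0 = 0 (and 0 * x = 0). *)
definition partition_entropy :: "'a measure \<Rightarrow> 'a set set \<Rightarrow> real" where
  "partition_entropy \<mu> \<xi> = - (\<Sum>P\<in>\<xi>. measure \<mu> P * ln (measure \<mu> P))"

definition meas_seq_entropy_partition ::
    "'a measure \<Rightarrow> (nat \<Rightarrow> nat) \<Rightarrow> ('a \<Rightarrow> 'a) \<Rightarrow> 'a set set \<Rightarrow> ereal" where
  "meas_seq_entropy_partition \<mu> A T \<xi> =
     limsup (\<lambda>n. ereal (partition_entropy \<mu> (dyn_join T \<xi> (A ` {1..n})) / real n))"

definition meas_seq_entropy ::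
    "'a::topological_space measure \<Rightarrow> (nat \<Rightarrow> nat) \<Rightarrow> ('a \<Rightarrow> 'a) \<Rightarrow> ereal" where
  "meas_seq_entropy \<mu> A T = (SUP \<xi>\<in>finite_borel_partitions. meas_seq_entropy_partition \<mu> A T \<xi>)"

end

theory Submission
  imports Defs
begin

text \<open>All statements follow from one chain of inequalities,

  K(A) h_top(T) \<le> sup_\<mu> h_\<mu>^A(T) \<le> h_top^A(T) \<le> K(A) h_top(T),

in which the products are extended reals with 0 \<infinity> = 0 and the last step may break down only for
K(A) = \<infinity>, h_top(T) = 0.

The last inequality is combinatorial. Enlarge the times t_1, ..., t_n to S_A(n, m). This set is a
disjoint union of runs of consecutive integers, each of length at least m. The logarithm of the
covering number is subadditive in the set of times and does not increase under translation, and for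
large m a run costs at most its length times a number close to the entropy of the cover
(lnN_runs). Dividing by n gives the factor K(A). A finite cover has finite entropy, so the case
K(A) = 0, h_top(T) = \<infinity> is included.

For the middle inequality, shrink the atoms of a partition to closed sets that miss only a small part
of the mass, and take as open cover the complements of the unions of all but one of these closed
cores. An element of the cover knows the atom of a point that lies in some core. Hence the itinerary
of a point is determined by an element of the joined cover and by an auxiliary itinerary that
registers the rare visits outside the cores; the latter costs arbitrarily little entropy per time
(ent_le_option_partition, H_le_cov_num). The estimate holds for every finite set of times, so that no
passage to powers of T, which a sequence A would not permit, has to be made.

The first inequality rests on two facts. If a partition f satisfies H(f, {0, ..., q-1}) \<ge> c q for
all q, then H(f, S) \<ge> c |S| for every finite set S of times: each time, conditioned on the later ones,
contributes at least c, by strong subadditivity (H_ge_card). Applied to S_A(n, m) this yields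
h_\<mu>^A(T) \<ge> c K(A). And for every c < h_top(T) there are an invariant measure and a partition with this
property (ex_invariant_measure_entropy_ge). This half of the variational principle is proved with
Misiurewicz's argument: \<mu> is a weak limit of averages of uniform measures on orbit segments that
start in separated sets. The weak limit exists because X can be coded by a Borel map into the line
whose inverse is uniformly continuous; Helly's selection theorem is applied to the codes, and the
limit law is carried back to X (compact_prob_weakly_convergent_subsequence). Convergence of the
entropies requires partitions with boundaries of measure zero, which appear as sets squeezed between
continuous functions of almost the same integral (jordan_set).\<close>

section \<open>Entropy of finite-valued functions\<close>

text \<open>Functions with finitely many values stand in for finite partitions, namely the partitions into their
level sets. A join of partitions is then a pair of functions, and a refinement is a functional
dependence.\<close>

definition ent :: "'a measure \<Rightarrow> ('a \<Rightarrow> 'b) \<Rightarrow> real" where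
  "ent M X = - (\<Sum>v\<in>X ` space M. measure M (X -` {v} \<inter> space M) * ln (measure M (X -` {v} \<inter> space M)))"

context prob_space
begin

lemma information_space_exp: "information_space M (exp 1)"
  by unfold_locales simp

lemma ent_eq_entropy:
  assumes "simple_function M X"
  shows "entropy (exp 1) (count_space (X ` space M)) X = ent M X"
  using information_space.entropy_simple_distributed[OF information_space_exp
      simple_distributedI[OF assms measure_nonneg refl]]
  by (simp add: ent_def log_def)

lemma neg_prob_ln_prob_nonneg: "0 \<le> - (prob S * ln (prob S))"
proof (cases "prob S = 0")
  case False
  then have "0 < prob S" by (simp add: less_le)
  then have "ln (prob S) \<le> 0" by simp
  then show ?thesis by (simp add: mult_nonneg_nonpos)
qed simp

lemma ent_nonneg: "0 \<le> ent M X"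
  unfolding ent_def sum_negf[symmetric] by (rule sum_nonneg) (rule neg_prob_ln_prob_nonneg)

text \<open>Data processing. The dependence of Y on X is stated through level sets, which is how it arises below:
no function that produces Y from X has to be named.\<close>

lemma ent_mono:
  assumes X: "simple_function M X"
    and det: "\<And>x y. x \<in> space M \<Longrightarrow> y \<in> space M \<Longrightarrow> X x = X y \<Longrightarrow> Y x = Y y"
  shows "ent M Y \<le> ent M X"
proof -
  define f where "f v = Y (SOME x. x \<in> space M \<and> X x = v)" for v
  have f: "f (X x) = Y x" if "x \<in> space M" for x
    unfolding f_def using that det someI[of "\<lambda>y. y \<in> space M \<and> X y = X x" x] by metis
  then have "ent M Y = ent M (f \<circ> X)"
    unfolding ent_def by (intro arg_cong[where f=uminus] sum.cong arg_cong2[where f="(*)"] refl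
      arg_cong[where f=ln] arg_cong[where f="measure M"]) (auto simp: image_iff)
  also have "\<dots> \<le> ent M X"
    using information_space.entropy_data_processing[OF information_space_exp X, of f]
      ent_eq_entropy[OF X] ent_eq_entropy[OF simple_function_compose[OF X, of f]] by simp
  finally show ?thesis .
qed

lemma ent_cong:
  assumes "simple_function M X" "simple_function M Y"
    and "\<And>x y. x \<in> space M \<Longrightarrow> y \<in> space M \<Longrightarrow> X x = X y \<longleftrightarrow> Y x = Y y"
  shows "ent M X = ent M Y"
  using assms by (intro antisym ent_mono) auto

lemma ent_le_ln_card:
  assumes X: "simple_function M X"
  shows "ent M X \<le> ln (card (X ` space M))"
  using information_space.entropy_le_card[OF information_space_exp
      simple_distributedI[OF X measure_nonneg refl]] ent_eq_entropy[OF X]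
  by (simp add: log_def)

lemma ent_Pair_le:
  assumes X: "simple_function M X" and Y: "simple_function M Y"
  shows "ent M (\<lambda>x. (X x, Y x)) \<le> ent M X + ent M Y"
  using information_space.entropy_chain_rule[OF information_space_exp X Y]
    information_space.conditional_entropy_less_eq_entropy[OF information_space_exp Y X]
    ent_eq_entropy[OF X] ent_eq_entropy[OF Y] ent_eq_entropy[OF simple_function_Pair[OF X Y]]
  by simp

text \<open>The expectation of g(h(X)), once as a sum over the values of X and once over the values of h(X). This
turns sums over triples of values into entropies of marginals.\<close>

lemma sum_prob_level_sets:
  fixes g :: "'c \<Rightarrow> real"
  assumes X: "simple_function M X"
  shows "(\<Sum>v\<in>X ` space M. prob (X -` {v} \<inter> space M) * g (h v)) =
    (\<Sum>w\<in>(\<lambda>x. h (X x)) ` space M. prob ((\<lambda>x. h (X x)) -` {w} \<inter> space M) * g w)"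
proof -
  have fin: "finite (X ` space M)" using X by (simp add: simple_function_def)
  have "prob ((\<lambda>x. h (X x)) -` {w} \<inter> space M) =
      (\<Sum>v\<in>{v \<in> X ` space M. h v = w}. prob (X -` {v} \<inter> space M))" for w
  proof -
    have "(\<lambda>x. h (X x)) -` {w} \<inter> space M = (\<Union>v\<in>{v \<in> X ` space M. h v = w}. X -` {v} \<inter> space M)"
      by auto
    then show ?thesis
      using fin X by (simp only:, intro finite_measure_finite_Union)
        (auto simp: simple_function_def disjoint_family_on_def)
  qed
  then have "(\<Sum>w\<in>(\<lambda>x. h (X x)) ` space M. prob ((\<lambda>x. h (X x)) -` {w} \<inter> space M) * g w)
     = (\<Sum>w\<in>h ` X ` space M. \<Sum>v\<in>{v \<in> X ` space M. h v = w}. prob (X -` {v} \<inter> space M) * g (h v))"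
    by (intro sum.cong) (auto simp: sum_distrib_right)
  also have "\<dots> = (\<Sum>v\<in>X ` space M. prob (X -` {v} \<inter> space M) * g (h v))"
    using fin by (intro sum.group) auto
  finally show ?thesis by simp
qed

text \<open>The conditional mutual information I(X; Y | Z) is nonnegative; written out, it is this combination of
four entropies.\<close>

lemma ent_strong_subadditive:
  assumes X: "simple_function M X" and Y: "simple_function M Y" and Z: "simple_function M Z"
  shows "ent M (\<lambda>x. (X x, Y x, Z x)) + ent M Z \<le> ent M (\<lambda>x. (X x, Z x)) + ent M (\<lambda>x. (Y x, Z x))"
proof -
  interpret information_space M "exp 1" by (rule information_space_exp)
  let ?pz = "\<lambda>v. prob (Z -` {v} \<inter> space M)"
  let ?pyz = "\<lambda>v. prob ((\<lambda>x. (Y x, Z x)) -` {v} \<inter> space M)"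
  let ?pxz = "\<lambda>v. prob ((\<lambda>x. (X x, Z x)) -` {v} \<inter> space M)"
  let ?W = "\<lambda>x. (X x, Y x, Z x)"
  let ?pw = "\<lambda>v. prob (?W -` {v} \<inter> space M)"
  note sp = simple_function_Pair
  note sd = simple_distributedI[OF _ measure_nonneg refl]
  have W: "simple_function M ?W" by (intro sp X Y Z)
  have sets: "?W -` {v} \<inter> space M \<in> sets M" "(\<lambda>x. (X x, Z x)) -` {u} \<inter> space M \<in> sets M"
    "(\<lambda>x. (Y x, Z x)) -` {t} \<inter> space M \<in> sets M" "Z -` {z} \<inter> space M \<in> sets M" for v u t z
    using simple_functionD(2)[OF W] simple_functionD(2)[OF sp[OF X Z]]
      simple_functionD(2)[OF sp[OF Y Z]] simple_functionD(2)[OF Z] by auto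
  have "0 \<le> (\<Sum>(x, y, z)\<in>?W ` space M. ?pw (x, y, z) *
      log (exp 1) (?pw (x, y, z) / (?pxz (x, z) * (?pyz (y, z) / ?pz z))))"
    using conditional_mutual_information_nonneg[OF X Y Z]
      conditional_mutual_information_eq[OF sd[OF Z] sd[OF sp[OF Y Z]] sd[OF sp[OF X Z]] sd[OF W]]
    by simp
  also have "\<dots> = (\<Sum>v\<in>?W ` space M. ?pw v * ln (?pw v) + ?pw v * ln (?pz (snd (snd v)))
      - ?pw v * ln (?pxz (fst v, snd (snd v))) - ?pw v * ln (?pyz (snd v)))"
  proof (intro sum.cong refl, clarify)
    fix \<omega> assume "\<omega> \<in> space M"
    let ?x = "X \<omega>" let ?y = "Y \<omega>" let ?z = "Z \<omega>"
    \<comment> \<open>Marginal weights dominate the joint weight, so all logarithms can be split where the latter is positive.\<close>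
    show "?pw (?x, ?y, ?z) * log (exp 1) (?pw (?x, ?y, ?z) / (?pxz (?x, ?z) * (?pyz (?y, ?z) / ?pz ?z)))
      = ?pw (?x, ?y, ?z) * ln (?pw (?x, ?y, ?z)) + ?pw (?x, ?y, ?z) * ln (?pz (snd (snd (?x, ?y, ?z))))
      - ?pw (?x, ?y, ?z) * ln (?pxz (fst (?x, ?y, ?z), snd (snd (?x, ?y, ?z))))
      - ?pw (?x, ?y, ?z) * ln (?pyz (snd (?x, ?y, ?z)))"
    proof (cases "?pw (?x, ?y, ?z) = 0")
      case False
      then have pos: "?pw (?x, ?y, ?z) > 0" by (simp add: less_le)
      have "?pw (?x, ?y, ?z) \<le> ?pxz (?x, ?z)" "?pw (?x, ?y, ?z) \<le> ?pyz (?y, ?z)"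
        "?pw (?x, ?y, ?z) \<le> ?pz ?z"
        by (intro finite_measure_mono sets; auto)+
      with pos have "?pxz (?x, ?z) > 0" "?pyz (?y, ?z) > 0" "?pz ?z > 0" by linarith+
      with pos show ?thesis
        by (simp add: log_def ln_div ln_mult right_diff_distrib distrib_left)
    qed simp
  qed
  also have "\<dots> = (\<Sum>v\<in>?W ` space M. ?pw v * ln (?pw v))
      + (\<Sum>v\<in>?W ` space M. ?pw v * ln (?pz (snd (snd v))))
      - (\<Sum>v\<in>?W ` space M. ?pw v * ln (?pxz (fst v, snd (snd v))))
      - (\<Sum>v\<in>?W ` space M. ?pw v * ln (?pyz (snd v)))"
    by (simp add: sum.distrib sum_subtractf)
  also have "(\<Sum>v\<in>?W ` space M. ?pw v * ln (?pz (snd (snd v)))) = - ent M Z"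
    using sum_prob_level_sets[OF W, of "\<lambda>u. ln (?pz u)" "\<lambda>v. snd (snd v)"] by (simp add: ent_def)
  also have "(\<Sum>v\<in>?W ` space M. ?pw v * ln (?pxz (fst v, snd (snd v)))) = - ent M (\<lambda>x. (X x, Z x))"
    using sum_prob_level_sets[OF W, of "\<lambda>u. ln (?pxz u)" "\<lambda>v. (fst v, snd (snd v))"] by (simp add: ent_def)
  also have "(\<Sum>v\<in>?W ` space M. ?pw v * ln (?pyz (snd v))) = - ent M (\<lambda>x. (Y x, Z x))"
    using sum_prob_level_sets[OF W, of "\<lambda>u. ln (?pyz u)" "snd"] by (simp add: ent_def)
  finally show ?thesis by (simp add: ent_def)
qed

end

lemma ent_distr:
  assumes T: "T \<in> measurable M N" and X: "simple_function N X" and sur: "X ` T ` space M \<subseteq> X ` space N"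
  shows "ent (distr M N T) X = ent M (\<lambda>x. X (T x))"
proof -
  have eq: "measure (distr M N T) (X -` {v} \<inter> space (distr M N T))
     = measure M ((\<lambda>x. X (T x)) -` {v} \<inter> space M)" for v
    using measurable_space[OF T] simple_functionD(2)[OF X]
    by (subst measure_distr[OF T]) (auto intro!: arg_cong[where f="measure M"])
  have "(\<Sum>v\<in>X ` space N. measure M ((\<lambda>x. X (T x)) -` {v} \<inter> space M) * ln (measure M ((\<lambda>x. X (T x)) -` {v} \<inter> space M)))
    = (\<Sum>v\<in>(\<lambda>x. X (T x)) ` space M. measure M ((\<lambda>x. X (T x)) -` {v} \<inter> space M) * ln (measure M ((\<lambda>x. X (T x)) -` {v} \<inter> space M)))"
  proof (rule sum.mono_neutral_right)
    show "finite (X ` space N)" using X by (simp add: simple_function_def)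
    show "(\<lambda>x. X (T x)) ` space M \<subseteq> X ` space N" using sur by auto
    show "\<forall>v\<in>X ` space N - (\<lambda>x. X (T x)) ` space M.
       measure M ((\<lambda>x. X (T x)) -` {v} \<inter> space M) * ln (measure M ((\<lambda>x. X (T x)) -` {v} \<inter> space M)) = 0"
    proof
      fix v assume "v \<in> X ` space N - (\<lambda>x. X (T x)) ` space M"
      then have "(\<lambda>x. X (T x)) -` {v} \<inter> space M = {}" by (auto simp: image_iff)
      then show "measure M ((\<lambda>x. X (T x)) -` {v} \<inter> space M) * ln (measure M ((\<lambda>x. X (T x)) -` {v} \<inter> space M)) = 0"
        by simp
    qed
  qed
  then show ?thesis unfolding ent_def using eq by simp
qed

section \<open>Entropy along a set of times\<close>

text \<open>The join of the preimages of a partition under the iterates T^i, i in F. Fixing the value outside of F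
makes two itineraries equal exactly if they agree at the times in F.\<close>

definition itinerary :: "('a \<Rightarrow> 'a) \<Rightarrow> ('a \<Rightarrow> 'b) \<Rightarrow> nat set \<Rightarrow> 'a \<Rightarrow> nat \<Rightarrow> 'b" where
  "itinerary T f F x = restrict (\<lambda>i. f ((T ^^ i) x)) F"

lemma itinerary_eq_iff: "itinerary T f F x = itinerary T f F y \<longleftrightarrow> (\<forall>i\<in>F. f ((T ^^ i) x) = f ((T ^^ i) y))"
  by (simp add: itinerary_def restrict_def fun_eq_iff) blast

lemma itinerary_eq_Un_iff:
  "itinerary T f (F \<union> G) x = itinerary T f (F \<union> G) y \<longleftrightarrow>
    itinerary T f F x = itinerary T f F y \<and> itinerary T f G x = itinerary T f G y"
  by (simp only: itinerary_eq_iff ball_Un)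

lemma itinerary_eq_subset:
  "F \<subseteq> G \<Longrightarrow> itinerary T f G x = itinerary T f G y \<Longrightarrow> itinerary T f F x = itinerary T f F y"
  by (simp only: itinerary_eq_iff) blast

lemma range_itinerary_subset: "range (itinerary T f F) \<subseteq> PiE F (\<lambda>_. range f)"
  by (auto simp: itinerary_def)

lemma simple_function_itinerary:
  assumes T: "T \<in> measurable M M" and f: "simple_function M f" and "finite F" "space M = UNIV"
  shows "simple_function M (itinerary T f F)"
proof -
  have Ti: "T ^^ i \<in> measurable M M" for i
    using T by (rule measurable_compose_n)
  have sub: "itinerary T f F ` space M \<subseteq> PiE F (\<lambda>_. range f)"
    unfolding assms(4) by (rule range_itinerary_subset)
  have "finite (PiE F (\<lambda>_. range f))"
    using f assms(3,4) by (intro finite_PiE) (auto simp: simple_function_def)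
  then have fin: "finite (itinerary T f F ` space M)"
    using sub finite_subset by blast
  have "itinerary T f F -` {itinerary T f F y} \<in> sets M" for y
  proof -
    have eq: "itinerary T f F -` {itinerary T f F y} = {x\<in>space M. \<forall>i\<in>F. f ((T ^^ i) x) = f ((T ^^ i) y)}"
      using assms(4) by (auto simp: itinerary_eq_iff)
    show ?thesis
      unfolding eq
    proof (rule sets.sets_Collect_finite_All)
      fix i assume "i \<in> F"
      have "(T ^^ i) -` (f -` {f ((T ^^ i) y)}) \<inter> space M \<in> sets M"
        using f assms(4) by (intro measurable_sets[OF Ti]) (auto simp: simple_function_def)
      moreover have "(T ^^ i) -` (f -` {f ((T ^^ i) y)}) \<inter> space M = {x \<in> space M. f ((T ^^ i) x) = f ((T ^^ i) y)}"
        by auto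
      ultimately show "{x \<in> space M. f ((T ^^ i) x) = f ((T ^^ i) y)} \<in> sets M" by simp
    qed fact
  qed
  then show ?thesis
    using fin assms(4) by (auto simp: simple_function_def)
qed

text \<open>Once an increment of a sequence with decreasing increments is below c, the sequence grows from there
on with a slope smaller than c, and a lower bound with slope c fails in the end.\<close>

lemma diff_increments_ge:
  fixes h :: "nat \<Rightarrow> real"
  assumes dec: "\<And>m. h (Suc (Suc m)) - h (Suc m) \<le> h (Suc m) - h m"
    and lower: "\<And>q. c * real q \<le> h q"
  shows "c \<le> h (Suc m) - h m"
proof (rule ccontr)
  define d where "d = h (Suc m) - h m"
  assume "\<not> c \<le> h (Suc m) - h m"
  then have "d < c" by (simp add: d_def)
  have step: "h (Suc (m + k)) - h (m + k) \<le> d" for k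
  proof (induction k)
    case (Suc k)
    then show ?case using dec[of "m + k"] by simp
  qed (simp add: d_def)
  have "h (m + k) \<le> h m + real k * d" for k
  proof (induction k)
    case (Suc k)
    then show ?case using step[of k] by (simp add: algebra_simps)
  qed simp
  then have "c * real (m + k) \<le> h m + real k * d" for k
    using lower order_trans by blast
  then have *: "real k * (c - d) \<le> h m - c * real m" for k
    by (simp add: algebra_simps)
  obtain k where "h m - c * real m < real k * (c - d)"
    using reals_Archimedean3[of "c - d"] \<open>d < c\<close> by auto
  with * show False by (meson not_less)
qed

lemma (in prob_space) ent_itinerary_Un_le:
  assumes T: "T \<in> measurable M M" and space: "space M = UNIV" and f: "simple_function M f"
    and "finite F" "finite G"
  shows "ent M (itinerary T f (F \<union> G)) \<le> ent M (itinerary T f F) + ent M (itinerary T f G)"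
proof -
  have sf: "simple_function M (itinerary T f F)" "simple_function M (itinerary T f G)"
    using assms by (auto intro: simple_function_itinerary)
  have "ent M (itinerary T f (F \<union> G)) \<le> ent M (\<lambda>x. (itinerary T f F x, itinerary T f G x))"
    by (rule ent_mono[OF simple_function_Pair[OF sf]]) (simp add: itinerary_eq_Un_iff)
  also have "\<dots> \<le> ent M (itinerary T f F) + ent M (itinerary T f G)"
    by (rule ent_Pair_le[OF sf])
  finally show ?thesis .
qed

lemma (in prob_space) ent_itinerary_UN_le:
  assumes T: "T \<in> measurable M M" and space: "space M = UNIV" and f: "simple_function M f"
    and P: "finite P" and G: "\<And>p. finite (G p)" and F: "finite F"
  shows "ent M (itinerary T f (F \<union> (\<Union>p\<in>P. G p))) \<le> ent M (itinerary T f F) + (\<Sum>p\<in>P. ent M (itinerary T f (G p)))"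
  using P
proof (induction P)
  case (insert p P)
  have "F \<union> (\<Union>p\<in>insert p P. G p) = (F \<union> (\<Union>p\<in>P. G p)) \<union> G p" by auto
  then have "ent M (itinerary T f (F \<union> (\<Union>p\<in>insert p P. G p))) \<le>
      ent M (itinerary T f (F \<union> (\<Union>p\<in>P. G p))) + ent M (itinerary T f (G p))"
    using insert.hyps(1) F G by (simp only:) (intro ent_itinerary_Un_le[OF T space f] finite_UnI finite_UN_I)
  then show ?case using insert by simp
qed simp

locale measure_system = prob_space M for M :: "'a measure" +
  fixes T :: "'a \<Rightarrow> 'a"
  assumes T_meas: "T \<in> measurable M M" and T_inv: "distr M M T = M" and space_UNIV: "space M = UNIV"
begin

definition H :: "('a \<Rightarrow> 'b) \<Rightarrow> nat set \<Rightarrow> real" where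
  "H f F = ent M (itinerary T f F)"

lemmas sf_itinerary = simple_function_itinerary[OF T_meas _ _ space_UNIV]

lemma H_union_le:
  assumes "simple_function M f" "finite F" "finite G"
  shows "H f (F \<union> G) \<le> H f F + H f G"
  unfolding H_def by (rule ent_itinerary_Un_le[OF T_meas space_UNIV assms])

text \<open>Invariance of the measure in the form that is used: the join may be observed one step later.\<close>

lemma H_Suc_image:
  assumes f: "simple_function M f" and F: "finite F"
  shows "H f (Suc ` F) = H f F"
proof -
  have "H f F = ent (distr M M T) (itinerary T f F)"
    by (simp add: H_def T_inv)
  also have "\<dots> = ent M (\<lambda>x. itinerary T f F (T x))"
    using T_meas assms by (intro ent_distr sf_itinerary) (auto simp: space_UNIV)
  also have "\<dots> = H f (Suc ` F)"
    unfolding H_def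
  proof (rule ent_cong)
    show "simple_function M (\<lambda>x. itinerary T f F (T x))"
      using simple_function_comp[OF T_meas sf_itinerary[OF f F]] by (simp add: o_def)
    show "simple_function M (itinerary T f (Suc ` F))"
      using F by (intro sf_itinerary[OF f]) simp
  qed (simp add: itinerary_eq_iff funpow_swap1)
  finally show ?thesis by simp
qed

lemma H_shift:
  assumes f: "simple_function M f" and F: "finite F"
  shows "H f ((+) k ` F) = H f F"
proof (induction k)
  case (Suc k)
  have "(+) (Suc k) ` F = Suc ` (+) k ` F" by (auto simp: image_image)
  then show ?case using H_Suc_image[OF f, of "(+) k ` F"] F Suc by simp
qed simp

lemma H_empty: "H f {} = 0"
proof (rule antisym)
  have "itinerary T f {} = (\<lambda>x i. undefined)"
    by (simp add: itinerary_def fun_eq_iff)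
  then have "simple_function M (itinerary T f {})" by simp
  from ent_le_ln_card[OF this] show "H f {} \<le> 0"
    by (simp add: H_def space_UNIV \<open>itinerary T f {} = (\<lambda>x i. undefined)\<close>)
qed (simp add: H_def ent_nonneg)

text \<open>The more times are known already, the less information a further time adds.\<close>

lemma H_insert_diff_antimono:
  assumes f: "simple_function M f" and "finite G" "F \<subseteq> G"
  shows "H f (insert s G) - H f G \<le> H f (insert s F) - H f F"
proof -
  have F: "finite F" using assms finite_subset by blast
  let ?I = "itinerary T f"
  have sf: "simple_function M (?I {s})" "simple_function M (?I G)" "simple_function M (?I F)"
    "simple_function M (?I (insert s G))" "simple_function M (?I (insert s F))"
    using F assms(2) by (intro sf_itinerary[OF f]; simp)+
  have insert_iff: "?I (insert s S) x = ?I (insert s S) y \<longleftrightarrow> ?I {s} x = ?I {s} y \<and> ?I S x = ?I S y" for S x y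
    using itinerary_eq_Un_iff[of T f "{s}" S x y] by simp
  have G_iff: "?I F x = ?I F y" if "?I G x = ?I G y" for x y
    using itinerary_eq_subset[OF assms(3) that] .
  have "ent M (\<lambda>x. (?I {s} x, ?I G x, ?I F x)) + ent M (?I F)
     \<le> ent M (\<lambda>x. (?I {s} x, ?I F x)) + ent M (\<lambda>x. (?I G x, ?I F x))"
    using sf by (intro ent_strong_subadditive)
  moreover have "ent M (\<lambda>x. (?I {s} x, ?I G x, ?I F x)) = H f (insert s G)"
    unfolding H_def
    by (intro ent_cong simple_function_Pair sf; simp only: prod.inject insert_iff[of G]) (use G_iff in blast)
  moreover have "ent M (\<lambda>x. (?I {s} x, ?I F x)) = H f (insert s F)"
    unfolding H_def by (intro ent_cong simple_function_Pair sf; simp only: prod.inject insert_iff[of F])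
  moreover have "ent M (\<lambda>x. (?I G x, ?I F x)) = H f G"
    unfolding H_def by (intro ent_cong simple_function_Pair sf; simp only: prod.inject) (use G_iff in blast)
  ultimately show ?thesis by (simp add: H_def)
qed

text \<open>What the time s adds to the m times that follow it does not depend on s, and is an increment of the
entropies of initial segments.\<close>

lemma H_lessThan_Suc:
  assumes f: "simple_function M f"
  shows "H f (insert s {s<..s+m}) - H f {s<..s+m} = H f {..<Suc m} - H f {..<m}"
proof -
  have "insert s {s<..s+m} = (+) s ` {..<Suc m}"
    unfolding lessThan_atLeast0 image_add_atLeastLessThan by auto
  moreover have "{s<..s+m} = (+) (Suc s) ` {..<m}"
    unfolding lessThan_atLeast0 image_add_atLeastLessThan by auto
  ultimately show ?thesis
    using H_shift[OF f, of "{..<Suc m}" s] H_shift[OF f, of "{..<m}" "Suc s"] by simp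
qed

text \<open>Build up S from its largest element downwards. A new time s precedes all times present, so it adds at
least what it would add to the full interval from s + 1 to s + m for large m. This amount is an
increment of H f {..<m}; these increments decrease in m, and the linear lower bound forces them to
be at least c.\<close>

lemma H_ge_card:
  assumes f: "simple_function M f" and lower: "\<And>q. c * real q \<le> H f {..<q}" and S: "finite S"
  shows "c * real (card S) \<le> H f S"
proof -
  have *: "c \<le> H f {..<Suc m} - H f {..<m}" for m
  proof (rule diff_increments_ge[where h="\<lambda>m. H f {..<m}", OF _ lower])
    fix m :: nat
    have "{0<..0+m} \<subseteq> {0<..0+Suc m}" by auto
    from H_insert_diff_antimono[OF f finite_greaterThanAtMost this, of 0]
    show "H f {..<Suc (Suc m)} - H f {..<Suc m} \<le> H f {..<Suc m} - H f {..<m}"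
      unfolding H_lessThan_Suc[OF f] .
  qed
  show ?thesis using S
  proof (induction S rule: finite_linorder_min_induct)
    case empty
    then show ?case by (simp add: H_empty)
  next
    case (insert s S)
    \<comment> \<open>The element 0 only gives the maximum a value when S is empty.\<close>
    define m where "m = Max (insert 0 S)"
    have "S \<subseteq> {s<..s+m}"
    proof
      fix x assume "x \<in> S"
      then have "x \<le> m" "s < x" using insert.hyps by (auto simp: m_def)
      then show "x \<in> {s<..s+m}" by simp
    qed
    from H_insert_diff_antimono[OF f finite_greaterThanAtMost this, of s] *[of m]
    have "c \<le> H f (insert s S) - H f S" unfolding H_lessThan_Suc[OF f] by linarith
    moreover have "s \<notin> S" using insert.hyps by auto
    ultimately have "c * real (card (insert s S)) = c * real (card S) + c"
      using insert.hyps(1) by (simp add: distrib_left)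
    with insert.IH \<open>c \<le> H f (insert s S) - H f S\<close> show ?case by linarith
  qed
qed

lemma H_le_card:
  assumes f: "simple_function M f" and F: "finite F"
  shows "H f F \<le> real (card F) * ent M f"
  using F
proof (induction F)
  case empty
  then show ?case by (simp add: H_empty)
next
  case (insert i F)
  have "(+) i ` {0} = {i}" by simp
  with H_shift[OF f, of "{0}" i] have "H f {i} = H f {0}" by (metis finite.emptyI finite_insert)
  also have "\<dots> = ent M f"
    unfolding H_def by (rule ent_cong[OF sf_itinerary[OF f] f]) (simp_all add: itinerary_eq_iff)
  finally have "H f {i} = ent M f" .
  moreover have "H f (insert i F) \<le> H f {i} + H f F"
    using H_union_le[OF f, of "{i}" F] insert.hyps(1) by simp
  moreover have "real (card (insert i F)) * ent M f = ent M f + real (card F) * ent M f"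
    using insert.hyps by (simp add: distrib_right)
  ultimately show ?case using insert.IH by linarith
qed

end

definition level_sets :: "('a \<Rightarrow> 'b) \<Rightarrow> 'a set set" where
  "level_sets f = (\<lambda>v. f -` {v}) ` range f"

lemma partition_on_level_sets: "partition_on UNIV (level_sets f)"
  unfolding partition_on_def disjoint_def level_sets_def by auto

text \<open>The function sends each point to the atom that contains it.\<close>

lemma partition_eq_level_sets:
  assumes "partition_on UNIV \<xi>"
  obtains f :: "'a \<Rightarrow> 'a set" where "\<xi> = level_sets f" "range f = \<xi>"
proof
  define f where "f x = (THE P. P \<in> \<xi> \<and> x \<in> P)" for x
  have f: "f x = P" if "P \<in> \<xi>" "x \<in> P" for x P
    unfolding f_def
  proof (rule the_equality)
    fix Q assume Q: "Q \<in> \<xi> \<and> x \<in> Q"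
    then have "P \<inter> Q \<noteq> {}" using that by blast
    then show "Q = P"
      using disjointD[OF partition_onD2[OF assms] that(1), of Q] Q by blast
  qed (use that in simp)
  have ex: "\<exists>P\<in>\<xi>. x \<in> P" for x
    using assms by (auto simp: partition_on_def)
  have ne: "\<exists>x. x \<in> P" if "P \<in> \<xi>" for P
  proof -
    have "P \<noteq> {}" using assms that by (auto simp: partition_on_def)
    then show ?thesis by blast
  qed
  show r: "range f = \<xi>"
  proof
    show "range f \<subseteq> \<xi>"
    proof clarify
      fix x
      obtain P where P: "P \<in> \<xi>" "x \<in> P" using ex by blast
      show "f x \<in> \<xi>" using f[OF P] P(1) by simp
    qed
    show "\<xi> \<subseteq> range f"
    proof
      fix P assume P: "P \<in> \<xi>"
      then obtain x where "x \<in> P" using ne by blast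
      from f[OF P this] show "P \<in> range f" by blast
    qed
  qed
  have "f -` {P} = P" if "P \<in> \<xi>" for P
  proof
    show "f -` {P} \<subseteq> P"
    proof
      fix x assume "x \<in> f -` {P}"
      moreover obtain Q where Q: "Q \<in> \<xi>" "x \<in> Q" using ex by blast
      ultimately show "x \<in> P" using f[OF Q] Q(2) by simp
    qed
    show "P \<subseteq> f -` {P}"
      using f[OF that] by blast
  qed
  then show "\<xi> = level_sets f"
    unfolding level_sets_def r by simp
qed

text \<open>The nonempty members of the join are the level sets of the itinerary; the empty set may be a member as
well, but has no weight.\<close>

lemma partition_entropy_dyn_join:
  assumes fin: "finite (range f)" and F: "finite F" and space: "space M = UNIV"
  shows "partition_entropy M (dyn_join T (level_sets f) F) = ent M (itinerary T f F)"
proof -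
  let ?I = "itinerary T f F"
  have rng: "range ?I \<subseteq> PiE F (\<lambda>_. range f)"
    by (rule range_itinerary_subset)
  have "finite (PiE F (\<lambda>_. range f))"
    using fin F by (intro finite_PiE) auto
  then have finI: "finite (range ?I)"
    using rng finite_subset by blast
  have eq: "(\<Inter>i\<in>F. (T ^^ i) -` u i) = ?I -` {?I x}"
    if u: "\<forall>i\<in>F. u i \<in> level_sets f" and x: "x \<in> (\<Inter>i\<in>F. (T ^^ i) -` u i)" for u x
  proof -
    have "u i = f -` {f ((T ^^ i) x)}" if "i \<in> F" for i
    proof -
      from u that obtain v where "u i = f -` {v}" by (auto simp: level_sets_def)
      with x that show ?thesis by auto
    qed
    then show ?thesis by (auto simp: itinerary_eq_iff)
  qed
  have sub: "dyn_join T (level_sets f) F \<subseteq> insert {} ((\<lambda>w. ?I -` {w}) ` range ?I)"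
  proof
    fix P assume "P \<in> dyn_join T (level_sets f) F"
    then obtain u where P: "P = (\<Inter>i\<in>F. (T ^^ i) -` u i)" and u: "\<forall>i\<in>F. u i \<in> level_sets f"
      by (auto simp: dyn_join_def)
    show "P \<in> insert {} ((\<lambda>w. ?I -` {w}) ` range ?I)"
    proof (cases "P = {}")
      case False
      then obtain x where "x \<in> P" by auto
      with eq[OF u, of x] P show ?thesis by auto
    qed simp
  qed
  have sup: "(\<lambda>w. ?I -` {w}) ` range ?I \<subseteq> dyn_join T (level_sets f) F"
  proof clarify
    fix x
    have "?I -` {?I x} = (\<Inter>i\<in>F. (T ^^ i) -` (f -` {f ((T ^^ i) x)}))"
      by (auto simp: itinerary_eq_iff)
    then show "?I -` {?I x} \<in> dyn_join T (level_sets f) F"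
      unfolding dyn_join_def by (auto simp: level_sets_def intro!: exI[of _ "\<lambda>i. f -` {f ((T ^^ i) x)}"])
  qed
  have inj: "inj_on (\<lambda>w. ?I -` {w}) (range ?I)"
    by (auto simp: inj_on_def)
  have "(\<Sum>P\<in>dyn_join T (level_sets f) F. measure M P * ln (measure M P))
      = (\<Sum>P\<in>(\<lambda>w. ?I -` {w}) ` range ?I. measure M P * ln (measure M P))"
    using sub sup finI by (intro sum.mono_neutral_right) (auto intro: finite_subset)
  also have "\<dots> = (\<Sum>w\<in>range ?I. measure M (?I -` {w}) * ln (measure M (?I -` {w})))"
    using inj by (simp add: sum.reindex)
  finally show ?thesis
    by (simp add: partition_entropy_def ent_def space)
qed

section \<open>Covering numbers along a set of times\<close>

definition cov_num :: "('a \<Rightarrow> 'a) \<Rightarrow> 'a set set \<Rightarrow> nat set \<Rightarrow> nat" where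
  "cov_num T U F = min_subcover_card (dyn_join T U F)"

text \<open>It suffices to cover the space by sets that need not be intersections themselves: each of them is
contained in the member of the join given by the elements of U that it follows.\<close>

lemma cov_num_le:
  assumes "finite W" "\<Union>W = UNIV"
    and "\<And>w. w \<in> W \<Longrightarrow> \<exists>u. \<forall>i\<in>F. u i \<in> U \<and> (\<forall>x\<in>w. (T ^^ i) x \<in> u i)"
  shows "cov_num T U F \<le> card W"
proof -
  obtain u where u: "\<And>w. w \<in> W \<Longrightarrow> \<forall>i\<in>F. u w i \<in> U \<and> (\<forall>x\<in>w. (T ^^ i) x \<in> u w i)"
    using assms(3) by metis
  define V where "V w = (\<Inter>i\<in>F. (T ^^ i) -` u w i)" for w
  have "V ` W \<subseteq> dyn_join T U F"
    using u by (auto simp: V_def dyn_join_def)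
  moreover have "w \<subseteq> V w" if "w \<in> W" for w
    using u[OF that] by (auto simp: V_def)
  then have "\<Union>(V ` W) = UNIV" using assms(2) by blast
  ultimately have "card (V ` W) \<in> {card W | W. W \<subseteq> dyn_join T U F \<and> finite W \<and> \<Union>W = UNIV}"
    using assms(1) by blast
  then have "cov_num T U F \<le> card (V ` W)"
    unfolding cov_num_def min_subcover_card_def by (rule cInf_lower) simp
  also have "\<dots> \<le> card W" by (rule card_image_le[OF assms(1)])
  finally show ?thesis .
qed

text \<open>An optimal subcover together with the elements of U that its members follow at the times in F.\<close>

lemma ex_cov_num:
  assumes "finite U" "\<Union>U = UNIV" "finite F"
  shows "\<exists>W u. finite W \<and> card W = cov_num T U F \<and> \<Union>W = UNIV \<and>
    (\<forall>w\<in>W. \<forall>i\<in>F. u w i \<in> U \<and> (\<forall>x\<in>w. (T ^^ i) x \<in> u w i))"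
proof -
  let ?D = "dyn_join T U F"
  have "?D \<subseteq> (\<lambda>u. \<Inter>i\<in>F. (T ^^ i) -` u i) ` PiE F (\<lambda>_. U)"
  proof
    fix P assume "P \<in> ?D"
    then obtain u where "P = (\<Inter>i\<in>F. (T ^^ i) -` u i)" "\<forall>i\<in>F. u i \<in> U"
      by (auto simp: dyn_join_def)
    then show "P \<in> (\<lambda>u. \<Inter>i\<in>F. (T ^^ i) -` u i) ` PiE F (\<lambda>_. U)"
      by (intro image_eqI[of _ _ "restrict u F"]) auto
  qed
  then have fin: "finite ?D"
    by (rule finite_subset) (intro finite_imageI finite_PiE assms)
  have cov: "\<Union>?D = UNIV"
  proof -
    obtain g where g: "\<And>x. g x \<in> U \<and> x \<in> g x"
    proof -
      have "\<forall>x. \<exists>V. V \<in> U \<and> x \<in> V" using assms(2) by blast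
      then show ?thesis using that by metis
    qed
    have "\<exists>P\<in>?D. x \<in> P" for x
      using g by (intro bexI[of _ "\<Inter>i\<in>F. (T ^^ i) -` (g ((T ^^ i) x))"]) (auto simp: dyn_join_def)
    then show ?thesis by blast
  qed
  have "Inf {card W | W. W \<subseteq> ?D \<and> finite W \<and> \<Union>W = UNIV} \<in> {card W | W. W \<subseteq> ?D \<and> finite W \<and> \<Union>W = UNIV}"
    by (rule Inf_nat_def1) (use fin cov in blast)
  then obtain W where W: "card W = cov_num T U F" "W \<subseteq> ?D" "finite W" "\<Union>W = UNIV"
    unfolding cov_num_def min_subcover_card_def by auto
  have "\<exists>u. \<forall>i\<in>F. u i \<in> U \<and> (\<forall>x\<in>w. (T ^^ i) x \<in> u i)" if "w \<in> W" for w
  proof -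
    from that W(2) obtain u where "w = (\<Inter>i\<in>F. (T ^^ i) -` u i)" "\<forall>i\<in>F. u i \<in> U"
      by (auto simp: dyn_join_def)
    then show ?thesis by (intro exI[of _ u]) auto
  qed
  then obtain u where "\<And>w. w \<in> W \<Longrightarrow> \<forall>i\<in>F. u w i \<in> U \<and> (\<forall>x\<in>w. (T ^^ i) x \<in> u w i)" by metis
  then show ?thesis using W(1,3,4) by blast
qed

lemma cov_num_empty: "cov_num (T :: 'a \<Rightarrow> 'a) U {} \<le> 1"
proof -
  have "cov_num T U {} \<le> card {UNIV :: 'a set}"
    by (rule cov_num_le) (blast intro: exI)+
  then show ?thesis by simp
qed

locale cover_system =
  fixes T :: "'a \<Rightarrow> 'a" and U :: "'a set set"
  assumes fin: "finite U" and cover: "\<Union>U = UNIV"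
begin

lemma cov_num_pos: "finite F \<Longrightarrow> 0 < cov_num T U F"
proof -
  assume F: "finite F"
  obtain W u where W: "finite W" "card W = cov_num T U F" "\<Union>W = UNIV"
    "\<forall>w\<in>W. \<forall>i\<in>F. u w i \<in> U \<and> (\<forall>x\<in>w. (T ^^ i) x \<in> u w i)"
    using ex_cov_num[where T=T, OF fin cover F] by blast
  then have "W \<noteq> {}" by auto
  then show ?thesis using W(1,2) by (metis card_gt_0_iff)
qed

lemma cov_num_mono:
  assumes "finite G" "F \<subseteq> G"
  shows "cov_num T U F \<le> cov_num T U G"
proof -
  obtain W u where W: "finite W" "card W = cov_num T U G" "\<Union>W = UNIV"
    "\<forall>w\<in>W. \<forall>i\<in>G. u w i \<in> U \<and> (\<forall>x\<in>w. (T ^^ i) x \<in> u w i)"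
    using ex_cov_num[where T=T, OF fin cover assms(1)] by blast
  have "cov_num T U F \<le> card W"
  proof (rule cov_num_le[OF W(1,3)])
    fix w assume "w \<in> W"
    then show "\<exists>u. \<forall>i\<in>F. u i \<in> U \<and> (\<forall>x\<in>w. (T ^^ i) x \<in> u i)"
      using W(4) assms(2) by (intro exI[of _ "u w"]) blast
  qed
  then show ?thesis using W(2) by simp
qed

lemma cov_num_Un:
  assumes "finite F" "finite G"
  shows "cov_num T U (F \<union> G) \<le> cov_num T U F * cov_num T U G"
proof -
  obtain W u where W: "finite W" "card W = cov_num T U F" "\<Union>W = UNIV"
    "\<forall>w\<in>W. \<forall>i\<in>F. u w i \<in> U \<and> (\<forall>x\<in>w. (T ^^ i) x \<in> u w i)"
    using ex_cov_num[where T=T, OF fin cover assms(1)] by blast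
  obtain V v where V: "finite V" "card V = cov_num T U G" "\<Union>V = UNIV"
    "\<forall>w\<in>V. \<forall>i\<in>G. v w i \<in> U \<and> (\<forall>x\<in>w. (T ^^ i) x \<in> v w i)"
    using ex_cov_num[where T=T, OF fin cover assms(2)] by blast
  have "cov_num T U (F \<union> G) \<le> card ((\<lambda>(a, b). a \<inter> b) ` (W \<times> V))"
  proof (rule cov_num_le)
    show "finite ((\<lambda>(a, b). a \<inter> b) ` (W \<times> V))" using W V by simp
    show "\<Union>((\<lambda>(a, b). a \<inter> b) ` (W \<times> V)) = UNIV"
    proof (intro equalityI subsetI)
      fix x :: 'a
      have "x \<in> \<Union>W" "x \<in> \<Union>V" using W(3) V(3) by simp_all
      then obtain a b where "a \<in> W" "x \<in> a" "b \<in> V" "x \<in> b" by blast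
      then show "x \<in> \<Union>((\<lambda>(a, b). a \<inter> b) ` (W \<times> V))" by blast
    qed simp
    fix w assume "w \<in> (\<lambda>(a, b). a \<inter> b) ` (W \<times> V)"
    then obtain a b where ab: "a \<in> W" "b \<in> V" "w = a \<inter> b" by blast
    show "\<exists>u. \<forall>i\<in>F \<union> G. u i \<in> U \<and> (\<forall>x\<in>w. (T ^^ i) x \<in> u i)"
      using ab(3) bspec[OF W(4) ab(1)] bspec[OF V(4) ab(2)]
      by (intro exI[of _ "\<lambda>i. if i \<in> F then u a i else v b i"]) (simp, blast)
  qed
  also have "\<dots> \<le> card (W \<times> V)" using W V by (intro card_image_le) simp
  finally show ?thesis using W V by (simp add: card_cartesian_product)
qed

lemma cov_num_shift:
  assumes "finite F"
  shows "cov_num T U ((+) k ` F) \<le> cov_num T U F"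
proof -
  obtain W u where W: "finite W" "card W = cov_num T U F" "\<Union>W = UNIV"
    "\<forall>w\<in>W. \<forall>i\<in>F. u w i \<in> U \<and> (\<forall>x\<in>w. (T ^^ i) x \<in> u w i)"
    using ex_cov_num[where T=T, OF fin cover assms(1)] by blast
  have "cov_num T U ((+) k ` F) \<le> card ((\<lambda>w. (T ^^ k) -` w) ` W)"
  proof (rule cov_num_le)
    show "\<Union>((\<lambda>w. (T ^^ k) -` w) ` W) = UNIV" using W(3) by blast
    fix w' assume "w' \<in> (\<lambda>w. (T ^^ k) -` w) ` W"
    then obtain w where w: "w \<in> W" "w' = (T ^^ k) -` w" by blast
    have "(T ^^ (k + i)) x = (T ^^ i) ((T ^^ k) x)" for i x
      by (metis add.commute comp_apply funpow_add)
    then show "\<exists>u. \<forall>i\<in>(+) k ` F. u i \<in> U \<and> (\<forall>x\<in>w'. (T ^^ i) x \<in> u i)"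
      using w(2) bspec[OF W(4) w(1)] by (intro exI[of _ "\<lambda>i. u w (i - k)"]) auto
  qed (use W in simp)
  also have "\<dots> \<le> card W" by (rule card_image_le[OF W(1)])
  finally show ?thesis using W by simp
qed

lemma cov_num_singleton: "cov_num T U {i} \<le> card U"
proof -
  have "cov_num T U {i} \<le> card ((\<lambda>w. (T ^^ i) -` w) ` U)"
    using fin cover by (intro cov_num_le) auto
  also have "\<dots> \<le> card U" by (rule card_image_le[OF fin])
  finally show ?thesis .
qed

lemma cov_num_le_power:
  assumes "finite F"
  shows "cov_num T U F \<le> card U ^ card F"
  using assms
proof (induction F)
  case empty
  then show ?case using cov_num_empty[of T U] by simp
next
  case (insert i F)
  have "cov_num T U (insert i F) \<le> cov_num T U {i} * cov_num T U F"
    using cov_num_Un[of "{i}" F] insert.hyps(1) by simp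
  also have "\<dots> \<le> card U * card U ^ card F"
    by (intro mult_mono cov_num_singleton insert.IH) auto
  finally show ?case using insert.hyps by simp
qed

definition lnN :: "nat set \<Rightarrow> real" where
  "lnN F = ln (real (cov_num T U F))"

lemma lnN_nonneg:
  assumes "finite F" shows "0 \<le> lnN F"
  using cov_num_pos[OF assms] by (simp add: lnN_def)

lemma lnN_mono:
  assumes "finite G" "F \<subseteq> G" shows "lnN F \<le> lnN G"
  using cov_num_mono[OF assms] cov_num_pos[OF finite_subset[OF assms(2,1)]]
  unfolding lnN_def by (intro ln_mono) linarith+

lemma lnN_Un:
  assumes "finite F" "finite G" shows "lnN (F \<union> G) \<le> lnN F + lnN G"
proof -
  have "real (cov_num T U (F \<union> G)) \<le> real (cov_num T U F) * real (cov_num T U G)"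
    using cov_num_Un[OF assms] by (metis of_nat_le_iff of_nat_mult)
  then have "lnN (F \<union> G) \<le> ln (real (cov_num T U F) * real (cov_num T U G))"
    using cov_num_pos[of "F \<union> G"] assms unfolding lnN_def
    by (intro ln_mono) auto
  also have "\<dots> = lnN F + lnN G"
    using cov_num_pos assms by (simp add: lnN_def ln_mult)
  finally show ?thesis .
qed

lemma lnN_shift:
  assumes "finite F" shows "lnN ((+) k ` F) \<le> lnN F"
  using cov_num_shift[OF assms, of k] cov_num_pos[OF finite_imageI[OF assms, of "(+) k"]]
  unfolding lnN_def by (intro ln_mono) linarith+

lemma lnN_le_card:
  assumes "finite F" shows "lnN F \<le> real (card F) * ln (real (card U))"
proof -
  have "lnN F \<le> ln (real (card U ^ card F))"
    using cov_num_le_power[OF assms] cov_num_pos[OF assms] unfolding lnN_def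
    by (intro ln_mono) (simp_all del: of_nat_power)
  then show ?thesis by (simp add: ln_realpow)
qed

text \<open>The blocks {f..<f + m} overlap, but their union splits into maximal runs, each of length at least m.
The bound for initial segments applies to each run by translation, and subadditivity adds the runs
up. The induction peels off the first run.\<close>

lemma lnN_runs:
  assumes m: "0 < m" and c: "\<And>L. m \<le> L \<Longrightarrow> lnN {..<L} \<le> c * real L" and F: "finite F"
  shows "lnN (\<Union>f\<in>F. {f..<f + m}) \<le> c * real (card (\<Union>f\<in>F. {f..<f + m}))"
  using F
proof (induction "card F" arbitrary: F rule: less_induct)
  case less
  show ?case
  proof (cases "F = {}")
    case True
    then show ?thesis using cov_num_empty[of T U] cov_num_pos[of "{}"] by (simp add: lnN_def)
  next
    case False
    define s where "s = Min F"
    define S where "S = (\<Union>f\<in>F. {f..<f + m})"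
    have sF: "s \<in> F" and smin: "\<And>f. f \<in> F \<Longrightarrow> s \<le> f"
      using False less.prems by (auto simp: s_def)
    have finS: "finite S" using less.prems by (simp add: S_def)
    \<comment> \<open>The first run ends just before s + L, the first time after s that is missing in S.\<close>
    define L where "L = (LEAST l. s + l \<notin> S)"
    have "\<exists>l. s + l \<notin> S"
    proof (rule ccontr)
      assume "\<not> ?thesis"
      then have "range ((+) s) \<subseteq> S" by blast
      moreover have "infinite (range ((+) s))" by (rule range_inj_infinite) simp
      ultimately show False using finS finite_subset by metis
    qed
    then have L: "s + L \<notin> S" unfolding L_def by (rule LeastI_ex)
    have sub: "{s..<s + L} \<subseteq> S"
    proof
      fix x assume x: "x \<in> {s..<s + L}"
      then have "x - s < L" by auto
      then have "s + (x - s) \<in> S" unfolding L_def by (blast dest: not_less_Least)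
      then show "x \<in> S" using x by simp
    qed
    have "m \<le> L"
    proof (rule ccontr)
      assume "\<not> m \<le> L"
      then have "s + L \<in> {s..<s + m}" by auto
      then show False using L sF by (auto simp: S_def)
    qed
    \<comment> \<open>A block that starts before the gap s + L also ends before it; the others start behind it.\<close>
    define F' where "F' = {f \<in> F. s + L < f}"
    define S' where "S' = (\<Union>f\<in>F'. {f..<f + m})"
    have "S = {s..<s + L} \<union> S'"
    proof
      show "{s..<s + L} \<union> S' \<subseteq> S" using sub by (auto simp: S_def S'_def F'_def)
      show "S \<subseteq> {s..<s + L} \<union> S'"
      proof
        fix x assume "x \<in> S"
        then obtain f where f: "f \<in> F" "x \<in> {f..<f + m}" by (auto simp: S_def)
        show "x \<in> {s..<s + L} \<union> S'"
        proof (cases "s + L < f")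
          case True
          then show ?thesis using f by (auto simp: S'_def F'_def)
        next
          case False
          have "s + L \<notin> {f..<f + m}" using L f by (auto simp: S_def)
          then show ?thesis using False f smin[OF f(1)] by auto
        qed
      qed
    qed
    moreover have "{s..<s + L} \<inter> S' = {}" by (auto simp: S'_def F'_def)
    moreover have finF': "finite F'" "F' \<subset> F" using less.prems sF by (auto simp: F'_def)
    then have "finite S'" by (simp add: S'_def)
    ultimately have card: "card S = L + card S'" by (simp add: card_Un_disjoint)
    have "lnN S' \<le> c * card S'"
      unfolding S'_def using finF' less.prems by (intro less.hyps psubset_card_mono) auto
    moreover have "lnN {s..<s + L} \<le> c * L"
    proof -
      have "{s..<s + L} = (+) s ` {..<L}"
        unfolding lessThan_atLeast0 image_add_atLeastLessThan by (simp add: add.commute)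
      then have "lnN {s..<s + L} \<le> lnN {..<L}" using lnN_shift[of "{..<L}" s] by simp
      also have "\<dots> \<le> c * L" by (rule c[OF \<open>m \<le> L\<close>])
      finally show ?thesis .
    qed
    moreover have "lnN S \<le> lnN {s..<s + L} + lnN S'"
      unfolding \<open>S = {s..<s + L} \<union> S'\<close> by (rule lnN_Un) (use \<open>finite S'\<close> in auto)
    moreover have "c * real (card S) = c * real L + c * real (card S')"
      unfolding card by (simp add: distrib_left)
    ultimately have "lnN S \<le> c * real (card S)" by linarith
    then show ?thesis unfolding S_def .
  qed
qed

end

lemma sumset_SA_eq: "sumset_SA A n m = (\<Union>f\<in>A ` {1..n}. {f..<f + m})"
proof
  show "(\<Union>f\<in>A ` {1..n}. {f..<f + m}) \<subseteq> sumset_SA A n m"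
  proof
    fix x assume "x \<in> (\<Union>f\<in>A ` {1..n}. {f..<f + m})"
    then obtain i where "i \<in> {1..n}" "A i \<le> x" "x < A i + m" by auto
    then show "x \<in> sumset_SA A n m"
      unfolding sumset_SA_def by (intro CollectI exI[of _ i] exI[of _ "x - A i"]) auto
  qed
qed (auto simp: sumset_SA_def)

lemma finite_sumset_SA: "finite (sumset_SA A n m)"
  by (simp add: sumset_SA_eq)

definition K_part :: "(nat \<Rightarrow> nat) \<Rightarrow> nat \<Rightarrow> ereal" where
  "K_part A m = limsup (\<lambda>n. ereal (real (card (sumset_SA A n m)) / real n))"

text \<open>The limit in m exists because the inner quantity increases with m.\<close>

lemma K_const_eq_SUP: "K_const A = (SUP m. K_part A m)"
proof -
  have "incseq (K_part A)"
  proof (rule incseq_SucI)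
    fix m
    have "card (sumset_SA A n m) \<le> card (sumset_SA A n (Suc m))" for n
      by (intro card_mono finite_sumset_SA) (auto simp: sumset_SA_eq)
    then show "K_part A m \<le> K_part A (Suc m)"
      unfolding K_part_def by (intro Limsup_mono eventuallyI) (simp add: divide_right_mono)
  qed
  then have "K_part A \<longlonglongrightarrow> (SUP m. K_part A m)" by (rule LIMSEQ_SUP)
  then show ?thesis unfolding K_const_def K_part_def[symmetric] by (rule limI)
qed

lemma K_part_nonneg: "0 \<le> K_part A m"
  unfolding K_part_def by (rule le_Limsup) (auto intro: always_eventually)

lemma K_const_nonneg: "0 \<le> K_const A"
  unfolding K_const_eq_SUP by (rule SUP_upper2[of 0]) (rule UNIV_I, rule K_part_nonneg)

lemma image_pred_atLeastAtMost: "(\<lambda>n::nat. n - 1) ` {1..n} = {..<n}"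
proof (intro equalityI subsetI)
  fix x assume "x \<in> {..<n}"
  then have "x = Suc x - 1" "Suc x \<in> {1..n}" by auto
  then show "x \<in> (\<lambda>n. n - 1) ` {1..n}" by (rule image_eqI)
qed auto

lemma limsup_cmult_ereal:
  assumes "0 \<le> c"
  shows "limsup (\<lambda>n. ereal (c * x n / real n)) = ereal c * limsup (\<lambda>n. ereal (x n / real n))"
  by (subst limsup_ereal_mult_left[OF assms, symmetric]) simp

section \<open>Sequence entropy is at most K times topological entropy\<close>

lemma finite_open_covers_system: "U \<in> finite_open_covers \<Longrightarrow> cover_system U"
  by (simp add: cover_system_def finite_open_covers_def)

context cover_system
begin

lemma top_seq_entropy_cover_eq: "top_seq_entropy_cover A T U = limsup (\<lambda>n. ereal (lnN (A ` {1..n}) / real n))"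
  by (simp add: top_seq_entropy_cover_def lnN_def cov_num_def)

lemma entropy_cover_eq: "top_seq_entropy_cover (\<lambda>n. n - 1) T U = limsup (\<lambda>n. ereal (lnN {..<n} / real n))"
  unfolding top_seq_entropy_cover_eq image_pred_atLeastAtMost ..

lemma top_seq_entropy_cover_nonneg: "0 \<le> top_seq_entropy_cover A T U"
  unfolding top_seq_entropy_cover_eq
proof (rule le_Limsup)
  show "\<forall>\<^sub>F n in sequentially. 0 \<le> ereal (lnN (A ` {1..n}) / real n)"
    by (rule always_eventually) (simp add: lnN_nonneg)
qed simp

lemma entropy_cover_le_ln_card: "top_seq_entropy_cover (\<lambda>n. n - 1) T U \<le> ereal (ln (real (card U)))"
  unfolding entropy_cover_eq
proof (rule Limsup_bounded, rule eventually_sequentiallyI[of 1])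
  fix n :: nat assume "1 \<le> n"
  then show "ereal (lnN {..<n} / real n) \<le> ereal (ln (real (card U)))"
    using lnN_le_card[of "{..<n}"] by (simp add: divide_le_eq mult.commute)
qed

text \<open>The set {t_1, ..., t_n} is contained in S_A(n, m), whose runs are long enough for large m to be
charged with c per time.\<close>

lemma top_seq_entropy_cover_le_K:
  assumes c: "top_seq_entropy_cover (\<lambda>n. n - 1) T U < ereal c"
  shows "top_seq_entropy_cover A T U \<le> ereal c * K_const A"
proof -
  have "\<forall>\<^sub>F n in sequentially. ereal (lnN {..<n} / real n) < ereal c"
    using c unfolding entropy_cover_eq by (rule Limsup_lessD)
  then obtain m0 where m0: "\<And>n. m0 \<le> n \<Longrightarrow> lnN {..<n} / real n < c"
    unfolding eventually_sequentially by auto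
  define m where "m = max 1 m0"
  have "0 < m" by (simp add: m_def)
  have L: "lnN {..<L} \<le> c * real L" if "m \<le> L" for L
    using m0[of L] that \<open>0 < m\<close> by (simp add: m_def divide_less_eq)
  have "0 \<le> lnN {..<m} / real m" by (simp add: lnN_nonneg)
  also have "\<dots> < c" using m0[of m] by (simp add: m_def)
  finally have "0 \<le> c" by simp
  have "lnN (A ` {1..n}) \<le> c * real (card (sumset_SA A n m))" for n
  proof -
    have "lnN (A ` {1..n}) \<le> lnN (sumset_SA A n m)"
    proof (rule lnN_mono[OF finite_sumset_SA])
      show "A ` {1..n} \<subseteq> sumset_SA A n m"
        unfolding sumset_SA_eq
      proof
        fix x assume "x \<in> A ` {1..n}"
        then show "x \<in> (\<Union>f\<in>A ` {1..n}. {f..<f + m})"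
          by (rule UN_I) (simp add: \<open>0 < m\<close>)
      qed
    qed
    also have "\<dots> \<le> c * real (card (sumset_SA A n m))"
      unfolding sumset_SA_eq by (rule lnN_runs[OF \<open>0 < m\<close> L]) simp_all
    finally show ?thesis .
  qed
  then have "top_seq_entropy_cover A T U \<le> limsup (\<lambda>n. ereal (c * real (card (sumset_SA A n m)) / real n))"
    unfolding top_seq_entropy_cover_eq
    by (intro Limsup_mono always_eventually allI) (simp add: divide_right_mono)
  also have "\<dots> = ereal c * K_part A m"
    unfolding K_part_def by (rule limsup_cmult_ereal[OF \<open>0 \<le> c\<close>])
  also have "\<dots> \<le> ereal c * K_const A"
    unfolding K_const_eq_SUP using \<open>0 \<le> c\<close>
    by (intro ereal_mult_left_mono SUP_upper) simp_all
  finally show ?thesis .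
qed

text \<open>The entropy of a single finite cover is a real number u, which leaves room for real numbers c > u close
to u; this is what settles K(A) = 0 also in the case of infinite topological entropy.\<close>

lemma top_seq_entropy_cover_le_mult:
  assumes "K_const A < \<infinity>"
  shows "top_seq_entropy_cover A T U \<le> K_const A * top_seq_entropy_cover (\<lambda>n. n - 1) T U"
proof -
  define h where "h = top_seq_entropy_cover (\<lambda>n. n - 1) T U"
  have "0 \<le> h" "h \<le> ereal (ln (real (card U)))"
    unfolding h_def by (rule top_seq_entropy_cover_nonneg, rule entropy_cover_le_ln_card)
  then obtain u where u: "h = ereal u" "0 \<le> u" by (cases h) auto
  obtain k where k: "K_const A = ereal k" "0 \<le> k"
    using assms K_const_nonneg[of A] by (cases "K_const A") auto
  have le: "top_seq_entropy_cover A T U \<le> ereal (k * u + k * e)" if "0 < e" for e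
  proof -
    have "h < ereal (u + e)" using u that by simp
    from top_seq_entropy_cover_le_K[OF this[unfolded h_def], of A] show ?thesis
      by (simp add: k algebra_simps)
  qed
  have "top_seq_entropy_cover A T U \<le> ereal (k * u)"
  proof (rule ereal_le_epsilon2)
    fix e :: real assume "0 < e"
    show "top_seq_entropy_cover A T U \<le> ereal (k * u) + ereal e"
    proof (cases "k = 0")
      case True
      then show ?thesis using le[OF \<open>0 < e\<close>] \<open>0 < e\<close> by (auto intro: order_trans)
    next
      case False
      then show ?thesis using le[of "e / k"] \<open>0 < e\<close> k(2) by simp
    qed
  qed
  then show ?thesis unfolding h_def[symmetric] k u by simp
qed

end

lemma UNIV_cover: "{UNIV} \<in> finite_open_covers"
  by (simp add: finite_open_covers_def)

lemma top_seq_entropy_nonneg: "0 \<le> top_seq_entropy A T"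
proof -
  interpret cover_system T "{UNIV}" using UNIV_cover by (rule finite_open_covers_system)
  show ?thesis unfolding top_seq_entropy_def
    by (rule SUP_upper2[of "{UNIV}"]) (rule UNIV_cover, rule top_seq_entropy_cover_nonneg)
qed

theorem top_seq_entropy_le_K_mult:
  assumes "\<not> (K_const A = \<infinity> \<and> top_entropy T = 0)"
  shows "top_seq_entropy A T \<le> K_const A * top_entropy T"
proof (cases "K_const A = \<infinity>")
  case True
  moreover have "0 \<le> top_entropy T" unfolding top_entropy_def by (rule top_seq_entropy_nonneg)
  ultimately have "K_const A * top_entropy T = \<infinity>" using assms by (simp add: ereal_mult_eq_PInfty)
  then show ?thesis by (metis ereal_less_eq(1))
next
  case False
  show ?thesis unfolding top_seq_entropy_def[of A]
  proof (rule SUP_least)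
    fix U :: "'a set set" assume U: "U \<in> finite_open_covers"
    interpret cover_system T U using U by (rule finite_open_covers_system)
    have "top_seq_entropy_cover A T U \<le> K_const A * top_seq_entropy_cover (\<lambda>n. n - 1) T U"
      using False by (intro top_seq_entropy_cover_le_mult) simp
    also have "\<dots> \<le> K_const A * top_entropy T"
      unfolding top_entropy_def top_seq_entropy_def
      by (intro ereal_mult_left_mono SUP_upper U K_const_nonneg)
    finally show "top_seq_entropy_cover A T U \<le> K_const A * top_entropy T" .
  qed
qed

section \<open>Approximation of Borel sets by closed and open sets\<close>

lemma closed_eq_INT_infdist:
  fixes C :: "'a::metric_space set"
  assumes "closed C" "C \<noteq> {}"
  shows "(\<Inter>n. {x. infdist x C < 1 / real (Suc n)}) = C"
proof (intro equalityI subsetI)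
  fix x assume x: "x \<in> (\<Inter>n. {x. infdist x C < 1 / real (Suc n)})"
  have "infdist x C = 0"
  proof (rule ccontr)
    assume "infdist x C \<noteq> 0"
    then have "0 < infdist x C" using infdist_nonneg[of x C] by linarith
    then obtain n where "1 / real (Suc n) < infdist x C"
      using reals_Archimedean by (metis inverse_eq_divide)
    moreover have "infdist x C < 1 / real (Suc n)" using x by blast
    ultimately show False by linarith
  qed
  then show "x \<in> C" using in_closed_iff_infdist_zero[OF assms] by blast
qed (simp add: in_closed_iff_infdist_zero[OF assms, symmetric])

text \<open>The sets with this property contain the closed sets, as a closed set is a decreasing intersection of
open neighbourhoods, and they form a sigma-algebra. For a countable union, the closed sets are
united only up to a finite index.\<close>

lemma borel_sandwich_closed_open:
  fixes M :: "'a::metric_space measure"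
  assumes fin: "finite_measure M" and sets: "sets M = sets borel" and B: "B \<in> sets borel" and "0 < e"
  shows "\<exists>C V. closed C \<and> open V \<and> C \<subseteq> B \<and> B \<subseteq> V \<and> measure M (V - C) < e"
proof -
  interpret finite_measure M by (rule fin)
  have closed_sets: "C \<in> sets M" if "closed C" for C using that sets by simp
  have open_sets: "V \<in> sets M" if "open V" for V using that sets by simp
  have "B \<in> sigma_sets UNIV (Collect closed)"
    using B by (simp add: borel_eq_closed)
  then show ?thesis using \<open>0 < e\<close>
  proof (induction B arbitrary: e rule: sigma_sets.induct)
    case (Basic C)
    show ?case
    proof (cases "C = {}")
      case True
      then show ?thesis using Basic by (intro exI[of _ "{}"]) simp
    next
      case False
      define V where "V n = {x. infdist x C < 1 / real (Suc n)}" for n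
      have "open (V n)" for n
        unfolding V_def by (intro open_Collect_less continuous_intros)
      have "decseq V"
      proof (rule decseq_SucI)
        fix n
        have "1 / real (Suc (Suc n)) \<le> 1 / real (Suc n)" by (simp add: frac_le)
        then show "V (Suc n) \<subseteq> V n" unfolding V_def by (auto simp del: of_nat_Suc)
      qed
      moreover have "range V \<subseteq> sets M" using \<open>\<And>n. open (V n)\<close> open_sets by blast
      ultimately have "(\<lambda>n. measure M (V n)) \<longlonglongrightarrow> measure M (\<Inter>n. V n)"
        by (intro finite_Lim_measure_decseq)
      also have "(\<Inter>n. V n) = C"
        unfolding V_def using Basic False by (intro closed_eq_INT_infdist) auto
      finally have "\<forall>\<^sub>F n in sequentially. measure M (V n) < measure M C + e"
        using Basic.prems by (intro order_tendstoD) auto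
      then obtain n where n: "measure M (V n) < measure M C + e"
        unfolding eventually_sequentially by blast
      have "C \<subseteq> V n" using \<open>(\<Inter>n. V n) = C\<close> by blast
      then have "measure M (V n - C) = measure M (V n) - measure M C"
        using Basic closed_sets open_sets[OF \<open>open (V n)\<close>] by (intro finite_measure_Diff) auto
      then show ?thesis using n Basic \<open>C \<subseteq> V n\<close> \<open>open (V n)\<close>
        by (intro exI[of _ C] exI[of _ "V n"]) auto
    qed
  next
    case Empty
    then show ?case by (intro exI[of _ "{}"]) simp
  next
    case (Compl B)
    from Compl.IH[OF Compl.prems] obtain C V
      where CV: "closed C" "open V" "C \<subseteq> B" "B \<subseteq> V" "measure M (V - C) < e" by blast
    have "- C - - V = V - C" by blast
    then have "measure M (- C - - V) < e" using CV(5) by simp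
    moreover have "closed (- V)" "open (- C)"
      using CV(1,2) by (simp_all add: closed_Compl open_Compl)
    moreover have "- V \<subseteq> UNIV - B" "UNIV - B \<subseteq> - C" using CV(3,4) by blast+
    ultimately show ?case by blast
  next
    case (Union a)
    have "\<exists>C V. closed C \<and> open V \<and> C \<subseteq> a n \<and> a n \<subseteq> V \<and> measure M (V - C) < e / 4 * (1 / 2) ^ n" for n
      using Union.prems by (intro Union.IH) simp
    then obtain C V where CV: "\<And>n. closed (C n)" "\<And>n. open (V n)" "\<And>n. C n \<subseteq> a n" "\<And>n. a n \<subseteq> V n"
      "\<And>n. measure M (V n - C n) < e / 4 * (1 / 2) ^ n" by metis
    define D where "D N = (\<Union>n<N. C n)" for N
    let ?V = "\<Union>n. V n" and ?D = "\<Union>N. D N"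
    have closedD: "closed (D N)" for N unfolding D_def using CV(1) by auto
    have "incseq D"
    proof (rule incseq_SucI)
      fix N show "D N \<subseteq> D (Suc N)" unfolding D_def by (intro UN_mono) auto
    qed
    moreover have "range D \<subseteq> sets M" using closedD closed_sets by blast
    ultimately have "(\<lambda>N. measure M (D N)) \<longlonglongrightarrow> measure M ?D"
      by (intro finite_Lim_measure_incseq)
    then have "\<forall>\<^sub>F N in sequentially. measure M ?D - e / 2 < measure M (D N)"
      using Union.prems by (intro order_tendstoD) auto
    then obtain N where N: "measure M ?D - e / 2 < measure M (D N)"
      unfolding eventually_sequentially by blast
    have Dsets: "?D \<in> sets M" using \<open>range D \<subseteq> sets M\<close> by (intro sets.countable_UN) auto
    have Vsets: "?V \<in> sets M" using CV(2) by (intro open_sets open_UN) auto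
    have V_C_sets: "range (\<lambda>n. V n - C n) \<subseteq> sets M"
      using CV(1,2) closed_sets open_sets by (auto intro!: sets.Diff)
    have geo: "summable (\<lambda>n. e / 4 * (1 / 2 :: real) ^ n)" by (intro summable_mult summable_geometric) simp
    have summ: "summable (\<lambda>n. measure M (V n - C n))"
      using less_imp_le[OF CV(5)] by (intro summable_comparison_test'[OF geo, of 0]) simp
    have "?V - ?D \<subseteq> (\<Union>n. V n - C n)" unfolding D_def by blast
    then have "measure M (?V - ?D) \<le> measure M (\<Union>n. V n - C n)"
      using V_C_sets by (intro finite_measure_mono) (auto intro!: sets.countable_UN)
    also have "\<dots> \<le> (\<Sum>n. measure M (V n - C n))"
      by (rule finite_measure_subadditive_countably[OF V_C_sets summ])
    also have "\<dots> \<le> (\<Sum>n. e / 4 * (1 / 2) ^ n)"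
      using less_imp_le[OF CV(5)] by (intro suminf_le summ geo)
    also have "\<dots> = e / 2"
      by (subst suminf_mult) (simp_all add: suminf_geometric)
    finally have 1: "measure M (?V - ?D) \<le> e / 2" .
    have "D N \<subseteq> ?D" by blast
    then have "measure M (?D - D N) = measure M ?D - measure M (D N)"
      using Dsets closed_sets[OF closedD] by (intro finite_measure_Diff) auto
    with N have 2: "measure M (?D - D N) < e / 2" by linarith
    have "measure M (?V - D N) \<le> measure M ((?V - ?D) \<union> (?D - D N))"
      using Dsets Vsets closed_sets[OF closedD] by (intro finite_measure_mono) auto
    also have "\<dots> \<le> measure M (?V - ?D) + measure M (?D - D N)"
      using Dsets Vsets closed_sets[OF closedD] by (intro measure_Un_le) auto
    also have "\<dots> < e" using 1 2 by linarith
    finally have "measure M (?V - D N) < e" .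
    moreover have "D N \<subseteq> \<Union>(range a)" unfolding D_def using CV(3) by blast
    moreover have "\<Union>(range a) \<subseteq> ?V" using CV(4) by blast
    moreover have "open ?V" using CV(2) by blast
    ultimately show ?case using closedD[of N]
      by (intro exI[of _ "D N"] exI[of _ ?V] conjI)
  qed
qed

section \<open>Measure-theoretic sequence entropy is at most topological sequence entropy\<close>

text \<open>A modulus of continuity of p ln p at 0: apply ln x \<le> x - 1 to 1 / sqrt p.\<close>

lemma neg_mult_ln_le_2_sqrt:
  fixes p :: real assumes "0 \<le> p"
  shows "- (p * ln p) \<le> 2 * sqrt p"
proof (cases "p = 0")
  case False
  then have p: "0 < p" "0 < sqrt p" using assms by simp_all
  have "- (ln p / 2) = ln (1 / sqrt p)" using p by (simp add: ln_div ln_sqrt)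
  also have "\<dots> \<le> 1 / sqrt p - 1" using p by (intro ln_le_minus_one) simp
  finally have "- ln p \<le> 2 / sqrt p" by simp
  then have "p * (- ln p) \<le> p * (2 / sqrt p)"
    using p(1) by (intro mult_left_mono) simp_all
  also have "p * (2 / sqrt p) = 2 * sqrt p"
  proof -
    have "p * (2 / sqrt p) = 2 * (p / sqrt p)" by simp
    then show ?thesis using real_div_sqrt[of p] p(1) by simp
  qed
  finally show ?thesis by simp
qed simp

lemma neg_mult_ln_le_one_minus:
  fixes p :: real assumes "0 \<le> p"
  shows "- (p * ln p) \<le> 1 - p"
proof (cases "p = 0")
  case False
  then have p: "0 < p" using assms by simp
  have "- ln p = ln (1 / p)" using p by (simp add: ln_div)
  also have "\<dots> \<le> 1 / p - 1" using p by (intro ln_le_minus_one) simp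
  finally have "p * (- ln p) \<le> p * (1 / p - 1)"
    using p by (intro mult_left_mono) simp_all
  then show ?thesis using p by (simp add: right_diff_distrib)
qed simp

lemma simple_functionI_UNIV:
  assumes "space M = UNIV" "finite (range f)" "\<And>v. v \<in> range f \<Longrightarrow> f -` {v} \<in> sets M"
  shows "simple_function M f"
  unfolding simple_function_def assms(1) Int_UNIV_right using assms(2,3) by blast

lemma simple_function_vimage_UNIV:
  assumes "space M = UNIV" "simple_function M f"
  shows "f -` B \<in> sets M" "finite (range f)"
  using simple_functionD(2)[OF assms(2), of B] simple_functionD(1)[OF assms(2)]
  unfolding assms(1) Int_UNIV_right .

context prob_space
begin

text \<open>Almost all mass sits on the value None. The value None contributes at most the missing mass, and each
other value at most twice the square root of its weight.\<close>

lemma ent_le_option_partition: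
  assumes space: "space M = UNIV" and g: "simple_function M g" and V: "finite V"
    and rng: "range g \<subseteq> insert None (Some ` V)"
    and small: "\<And>v. v \<in> V \<Longrightarrow> prob (g -` {Some v}) \<le> r\<^sup>2" and r: "0 \<le> r" "r \<le> 1"
  shows "ent M g \<le> 3 * real (card V) * r"
proof -
  define \<phi> where "\<phi> w = - (prob (g -` {w}) * ln (prob (g -` {w})))" for w
  have \<phi>_nonneg: "0 \<le> \<phi> w" for w
    unfolding \<phi>_def by (rule neg_prob_ln_prob_nonneg)
  have sets: "g -` B \<in> sets M" for B
    by (rule simple_function_vimage_UNIV(1)[OF space g])
  have "- (g -` {None}) \<subseteq> (\<Union>v\<in>V. g -` {Some v})"
  proof
    fix x assume "x \<in> - (g -` {None})"
    moreover have "g x \<in> insert None (Some ` V)" using rng by blast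
    ultimately obtain v where "v \<in> V" "g x = Some v" by auto
    then show "x \<in> (\<Union>v\<in>V. g -` {Some v})" by auto
  qed
  have "1 - prob (g -` {None}) = prob (- (g -` {None}))"
    using prob_compl[OF sets[of "{None}"]] space by (simp add: Compl_eq_Diff_UNIV)
  also have "\<dots> \<le> prob (\<Union>v\<in>V. g -` {Some v})"
    by (rule finite_measure_mono[OF \<open>- (g -` {None}) \<subseteq> _\<close> sets.finite_UN[OF V sets]])
  also have "\<dots> \<le> (\<Sum>v\<in>V. prob (g -` {Some v}))"
    by (rule finite_measure_subadditive_finite[OF V]) (use sets in blast)
  also have "\<dots> \<le> (\<Sum>v\<in>V. r\<^sup>2)" by (intro sum_mono small)
  also have "\<dots> = real (card V) * (r * r)" by (simp add: power2_eq_square)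
  also have "\<dots> \<le> real (card V) * r"
    using r by (intro mult_left_mono mult_left_le) simp_all
  finally have none: "\<phi> None \<le> real (card V) * r"
    using neg_mult_ln_le_one_minus[of "prob (g -` {None})"] by (simp add: \<phi>_def)
  have "\<phi> (Some v) \<le> 2 * r" if "v \<in> V" for v
  proof -
    have "\<phi> (Some v) \<le> 2 * sqrt (prob (g -` {Some v}))"
      unfolding \<phi>_def by (rule neg_mult_ln_le_2_sqrt) simp
    also have "sqrt (prob (g -` {Some v})) \<le> sqrt (r\<^sup>2)"
      using small[OF that] by (rule real_sqrt_le_mono)
    finally show ?thesis using r by simp
  qed
  then have some: "(\<Sum>v\<in>V. \<phi> (Some v)) \<le> (\<Sum>v\<in>V. 2 * r)" by (rule sum_mono)
  have "ent M g = (\<Sum>w\<in>range g. \<phi> w)"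
    by (simp add: ent_def \<phi>_def space sum_negf)
  also have "\<dots> \<le> (\<Sum>w\<in>insert None (Some ` V). \<phi> w)"
    using rng V \<phi>_nonneg by (intro sum_mono2) simp_all
  also have "\<dots> = \<phi> None + (\<Sum>w\<in>Some ` V. \<phi> w)"
    using V by (intro sum.insert) auto
  also have "(\<Sum>w\<in>Some ` V. \<phi> w) = (\<Sum>v\<in>V. \<phi> (Some v))"
    by (simp add: sum.reindex)
  finally have "ent M g \<le> \<phi> None + (\<Sum>v\<in>V. \<phi> (Some v))" .
  moreover have "(\<Sum>v\<in>V. 2 * r) = 2 * (real (card V) * r)" by simp
  ultimately show ?thesis using none some by linarith
qed

end

context measure_system
begin

text \<open>A finite measurable cover is made disjoint by sending a point to the index of the first member that
contains it.\<close>

lemma ex_least_index_function: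
  assumes N: "finite W" "\<Union>W = UNIV" and sets: "W \<subseteq> sets M"
  shows "\<exists>\<gamma>::'a \<Rightarrow> nat. simple_function M \<gamma> \<and> card (range \<gamma>) \<le> card W \<and>
    (\<forall>i\<in>range \<gamma>. \<exists>w\<in>W. \<forall>x. \<gamma> x = i \<longrightarrow> x \<in> w)"
proof -
  obtain h where h: "bij_betw h {0..<card W} W"
    using ex_bij_betw_nat_finite[OF N(1)] by blast
  define \<gamma> where "\<gamma> x = (LEAST i. i < card W \<and> x \<in> h i)" for x
  have \<gamma>: "\<gamma> x < card W" "x \<in> h (\<gamma> x)" for x
  proof -
    have "x \<in> \<Union>W" using N(2) by simp
    then obtain w where "w \<in> W" "x \<in> w" by blast
    then obtain i where "i < card W" "x \<in> h i"
    proof -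
      have "w \<in> h ` {0..<card W}" using bij_betw_imp_surj_on[OF h] \<open>w \<in> W\<close> by simp
      then obtain i where "i \<in> {0..<card W}" "w = h i" by blast
      then show ?thesis using that \<open>x \<in> w\<close> by simp
    qed
    then have "\<exists>i. i < card W \<and> x \<in> h i" by blast
    from LeastI_ex[OF this] show "\<gamma> x < card W" "x \<in> h (\<gamma> x)" unfolding \<gamma>_def by blast+
  qed
  have hW: "h i \<in> W" if "i < card W" for i
  proof -
    have "h i \<in> h ` {0..<card W}" using that by (intro imageI) simp
    then show ?thesis using bij_betw_imp_surj_on[OF h] by simp
  qed
  have rng: "range \<gamma> \<subseteq> {..<card W}" using \<gamma>(1) by blast
  have "simple_function M \<gamma>"
  proof (rule simple_functionI_UNIV[OF space_UNIV])
    show "finite (range \<gamma>)" using rng finite_subset by blast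
    fix i assume "i \<in> range \<gamma>"
    then have i: "i < card W" using rng by blast
    have eq: "\<gamma> -` {i} = h i - (\<Union>j\<in>{..<i}. h j)"
    proof (intro equalityI subsetI)
      fix x assume "x \<in> \<gamma> -` {i}"
      then have x: "\<gamma> x = i" by simp
      have "x \<notin> h j" if "j < i" for j
      proof
        assume "x \<in> h j"
        then have "\<gamma> x \<le> j" unfolding \<gamma>_def using that i by (intro Least_le) simp
        then show False using x that by simp
      qed
      then show "x \<in> h i - (\<Union>j\<in>{..<i}. h j)" using \<gamma>(2)[of x] x by blast
    next
      fix x assume x: "x \<in> h i - (\<Union>j\<in>{..<i}. h j)"
      have "\<gamma> x = i" unfolding \<gamma>_def
      proof (rule Least_equality)
        fix j assume "j < card W \<and> x \<in> h j"
        with x have "\<not> j < i" by blast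
        then show "i \<le> j" by simp
      qed (use x i in simp)
      then show "x \<in> \<gamma> -` {i}" by simp
    qed
    have "h j \<in> sets M" if "j \<le> i" for j
      using hW[of j] that i sets by (meson le_less_trans subset_iff)
    then show "\<gamma> -` {i} \<in> sets M"
      unfolding eq by (intro sets.Diff sets.finite_UN) simp_all
  qed
  moreover have "card (range \<gamma>) \<le> card W"
    using card_mono[OF _ rng] by simp
  moreover have "\<exists>w\<in>W. \<forall>x. \<gamma> x = i \<longrightarrow> x \<in> w" if "i \<in> range \<gamma>" for i
  proof (rule bexI[of _ "h i"])
    show "\<forall>x. \<gamma> x = i \<longrightarrow> x \<in> h i" using \<gamma>(2) by blast
    have "i < card W" using rng that by blast
    then show "h i \<in> W" by (rule hW)
  qed
  ultimately show ?thesis by blast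
qed

text \<open>The basic comparison of the two entropies. If U and g together determine f, then an element of the
joined cover and the g-itinerary determine the f-itinerary. The choice of an element among cov_num
many costs at most the logarithm of that number, and g costs at most its entropy at every time.\<close>

lemma H_le_cov_num:
  fixes f :: "'a \<Rightarrow> 'b" and g :: "'a \<Rightarrow> 'c"
  assumes f: "simple_function M f" and g: "simple_function M g" and F: "finite F"
    and U: "finite U" "\<Union>U = UNIV" "U \<subseteq> sets M"
    and det: "\<And>V x y. V \<in> U \<Longrightarrow> x \<in> V \<Longrightarrow> y \<in> V \<Longrightarrow> g x = g y \<Longrightarrow> f x = f y"
  shows "H f F \<le> ln (real (cov_num T U F)) + real (card F) * ent M g"
proof -
  obtain W u where W: "finite W" "card W = cov_num T U F" "\<Union>W = UNIV"
    "\<forall>w\<in>W. \<forall>i\<in>F. u w i \<in> U \<and> (\<forall>x\<in>w. (T ^^ i) x \<in> u w i)"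
    using ex_cov_num[where T=T, OF U(1,2) F] by blast
  \<comment> \<open>The members w of W are replaced by larger sets that are certainly measurable.\<close>
  define V where "V w = {x\<in>space M. \<forall>i\<in>F. (T ^^ i) x \<in> u w i}" for w
  have Ti: "T ^^ i \<in> measurable M M" for i
    using T_meas by (rule measurable_compose_n)
  have "V w \<in> sets M" if "w \<in> W" for w
    unfolding V_def
  proof (rule sets.sets_Collect_finite_All[OF _ F])
    fix i assume "i \<in> F"
    then have "u w i \<in> sets M" using W(4) that U(3) by blast
    from measurable_sets[OF Ti this]
    show "{x \<in> space M. (T ^^ i) x \<in> u w i} \<in> sets M" by (simp add: vimage_def space_UNIV)
  qed
  then have "V ` W \<subseteq> sets M" by blast
  moreover have "w \<subseteq> V w" if "w \<in> W" for w
    unfolding V_def using W(4) that by (auto simp: space_UNIV)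
  then have "\<Union>(V ` W) = UNIV" using W(3) by blast
  ultimately obtain \<gamma> :: "'a \<Rightarrow> nat" where \<gamma>: "simple_function M \<gamma>" "card (range \<gamma>) \<le> card (V ` W)"
    "\<forall>i\<in>range \<gamma>. \<exists>w\<in>V ` W. \<forall>x. \<gamma> x = i \<longrightarrow> x \<in> w"
    using ex_least_index_function[of "V ` W"] W(1) by blast
  have "H f F \<le> ent M (\<lambda>x. (\<gamma> x, itinerary T g F x))"
    unfolding H_def
  proof (rule ent_mono[OF simple_function_Pair[OF \<gamma>(1) sf_itinerary[OF g F]]])
    fix x y assume "(\<gamma> x, itinerary T g F x) = (\<gamma> y, itinerary T g F y)"
    then have eq: "\<gamma> x = \<gamma> y" "\<And>i. i \<in> F \<Longrightarrow> g ((T ^^ i) x) = g ((T ^^ i) y)"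
      by (simp_all add: itinerary_eq_iff)
    obtain w where w: "w \<in> W" "x \<in> V w" "y \<in> V w"
      using \<gamma>(3) eq(1) by (metis imageE rangeI)
    show "itinerary T f F x = itinerary T f F y"
      unfolding itinerary_eq_iff
    proof
      fix i assume i: "i \<in> F"
      have "u w i \<in> U" using W(4) w(1) i by blast
      moreover have "(T ^^ i) x \<in> u w i" "(T ^^ i) y \<in> u w i"
        using w i unfolding V_def by blast+
      ultimately show "f ((T ^^ i) x) = f ((T ^^ i) y)" using eq(2)[OF i] by (rule det)
    qed
  qed
  also have "\<dots> \<le> ent M \<gamma> + H g F"
    unfolding H_def by (rule ent_Pair_le[OF \<gamma>(1) sf_itinerary[OF g F]])
  also have "H g F \<le> real (card F) * ent M g" by (rule H_le_card[OF g F])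
  also have "ent M \<gamma> \<le> ln (real (card (range \<gamma>)))"
    using ent_le_ln_card[OF \<gamma>(1)] by (simp add: space_UNIV)
  also have "\<dots> \<le> ln (real (cov_num T U F))"
  proof (rule ln_mono)
    have "finite (range \<gamma>)" using simple_function_vimage_UNIV(2)[OF space_UNIV \<gamma>(1)] .
    then show "0 < real (card (range \<gamma>))" by (simp add: card_gt_0_iff)
    have "card (range \<gamma>) \<le> card W" using \<gamma>(2) card_image_le[OF W(1), of V] by linarith
    then show "real (card (range \<gamma>)) \<le> real (cov_num T U F)" by (simp add: W(2))
  qed
  finally show ?thesis by simp
qed

end

locale borel_system = measure_system M T for M :: "'a::topological_space measure" and T :: "'a \<Rightarrow> 'a" +
  assumes sets: "sets M = sets borel"

lemma invariant_prob_measures_system: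
  fixes T :: "'a::topological_space \<Rightarrow> 'a"
  assumes \<mu>: "\<mu> \<in> invariant_prob_measures T" and T: "continuous_on UNIV T"
  shows "borel_system \<mu> T"
proof -
  have p: "prob_space \<mu>" and sets: "sets \<mu> = sets borel" and inv: "distr \<mu> borel T = \<mu>"
    using \<mu> by (simp_all add: invariant_prob_measures_def)
  have "T \<in> measurable \<mu> \<mu>"
    unfolding measurable_cong_sets[OF sets sets] by (rule borel_measurable_continuous_onI[OF T])
  moreover have "distr \<mu> \<mu> T = \<mu>"
    using inv distr_cong[of \<mu> \<mu> \<mu> borel T T] sets by simp
  moreover have "space \<mu> = UNIV" using sets_eq_imp_space_eq[OF sets] by simp
  ultimately show ?thesis
    using p sets by (simp add: borel_system_def borel_system_axioms_def measure_system_def measure_system_axioms_def)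
qed

context measure_system
begin

lemma partition_entropy_level_sets:
  assumes "simple_function M f" "finite F"
  shows "partition_entropy M (dyn_join T (level_sets f) F) = H f F"
  unfolding H_def
  by (rule partition_entropy_dyn_join[OF simple_function_vimage_UNIV(2)[OF space_UNIV assms(1)] assms(2) space_UNIV])

text \<open>The auxiliary function g is None on the cores C v and reveals f elsewhere. Within one element of the
cover, all points lying in cores lie in the same core, so that None is enough to determine f.\<close>

lemma H_le_cover_plus:
  fixes f :: "'a \<Rightarrow> 'b"
  assumes f: "simple_function M f" and "0 < e"
    and U: "finite U" "\<Union>U = UNIV" "U \<subseteq> sets M"
    and C: "\<And>v. v \<in> range f \<Longrightarrow> C v \<in> sets M" "\<And>v. v \<in> range f \<Longrightarrow> C v \<subseteq> f -` {v}"
    and small: "\<And>v. v \<in> range f \<Longrightarrow> measure M (f -` {v} - C v) \<le> (min 1 (e / (3 * real (card (range f)))))\<^sup>2"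
    and sep: "\<And>V x y. V \<in> U \<Longrightarrow> x \<in> V \<Longrightarrow> y \<in> V \<Longrightarrow> x \<in> C (f x) \<Longrightarrow> y \<in> C (f y) \<Longrightarrow> f x = f y"
    and F: "finite F"
  shows "H f F \<le> ln (real (cov_num T U F)) + real (card F) * e"
proof -
  define g where "g x = (if x \<in> C (f x) then None else Some (f x))" for x
  let ?k = "real (card (range f))" and ?r = "min 1 (e / (3 * real (card (range f))))"
  have fin: "finite (range f)" and f_sets: "\<And>B. f -` B \<in> sets M"
    using simple_function_vimage_UNIV[OF space_UNIV f] by blast+
  have k: "0 < ?k" using fin by (simp add: card_gt_0_iff)
  have rng: "range g \<subseteq> insert None (Some ` range f)" by (auto simp: g_def)
  have Some_vim: "g -` {Some v} = f -` {v} - C v" for v by (auto simp: g_def split: if_splits)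
  have None_vim: "g -` {None} = (\<Union>v\<in>range f. C v)"
  proof (intro equalityI subsetI)
    fix x assume "x \<in> (\<Union>v\<in>range f. C v)"
    then obtain v where v: "v \<in> range f" "x \<in> C v" by blast
    then have "f x = v" using C(2) by blast
    then show "x \<in> g -` {None}" using v by (simp add: g_def)
  qed (auto simp: g_def split: if_splits)
  have g: "simple_function M g"
  proof (rule simple_functionI_UNIV[OF space_UNIV])
    show "finite (range g)" by (rule finite_subset[OF rng]) (simp add: fin)
    fix w assume "w \<in> range g"
    then consider "w = None" | v where "v \<in> range f" "w = Some v" using rng by blast
    then show "g -` {w} \<in> sets M"
    proof cases
      case 1
      then show ?thesis using None_vim fin C(1) by (simp only:) (intro sets.finite_UN)
    next
      case (2 v)
      then show ?thesis using Some_vim f_sets C(1) by (simp only:) (intro sets.Diff)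
    qed
  qed
  have "0 \<le> ?r" using \<open>0 < e\<close> by simp
  then have "ent M g \<le> 3 * ?k * ?r"
    using small by (intro ent_le_option_partition[OF space_UNIV g fin rng]) (simp_all only: Some_vim min.cobounded1)
  also have "\<dots> \<le> 3 * ?k * (e / (3 * ?k))" using k by (intro mult_left_mono) simp_all
  also have "\<dots> = e" using k by simp
  finally have "ent M g \<le> e" .
  have "H f F \<le> ln (real (cov_num T U F)) + real (card F) * ent M g"
  proof (rule H_le_cov_num[OF f g F U])
    fix V x y assume V: "V \<in> U" "x \<in> V" "y \<in> V" and eq: "g x = g y"
    show "f x = f y"
    proof (cases "g x")
      case None
      then have "x \<in> C (f x)" "y \<in> C (f y)" using eq by (auto simp: g_def split: if_splits)
      then show ?thesis by (rule sep[OF V])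
    next
      case (Some v)
      then show ?thesis using eq by (auto simp: g_def split: if_splits)
    qed
  qed
  also have "\<dots> \<le> ln (real (cov_num T U F)) + real (card F) * e"
    using \<open>ent M g \<le> e\<close> by (intro add_left_mono mult_left_mono) simp_all
  finally show ?thesis .
qed

end

lemma (in measure_system) limsup_H_le:
  assumes le: "\<And>F. finite F \<Longrightarrow> H f F \<le> ln (real (cov_num T U F)) + real (card F) * e" and "0 \<le> e"
  shows "limsup (\<lambda>n. ereal (H f (A ` {1..n}) / real n)) \<le> top_seq_entropy_cover A T U + ereal e"
proof -
  have "H f (A ` {1..n}) / real n \<le> ln (real (cov_num T U (A ` {1..n}))) / real n + e" for n
  proof -
    have "card (A ` {1..n}) \<le> n" using card_image_le[of "{1..n}" A] by simp
    then have "real (card (A ` {1..n})) * e \<le> real n * e"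
      using \<open>0 \<le> e\<close> by (intro mult_right_mono) simp_all
    then have "H f (A ` {1..n}) \<le> ln (real (cov_num T U (A ` {1..n}))) + real n * e"
      using le[of "A ` {1..n}"] by simp
    then have "H f (A ` {1..n}) / real n \<le> (ln (real (cov_num T U (A ` {1..n}))) + real n * e) / real n"
      by (rule divide_right_mono) simp
    also have "\<dots> \<le> ln (real (cov_num T U (A ` {1..n}))) / real n + e"
      using \<open>0 \<le> e\<close> by (cases "n = 0") (simp_all add: add_divide_distrib)
    finally show ?thesis .
  qed
  then have "limsup (\<lambda>n. ereal (H f (A ` {1..n}) / real n)) \<le>
      limsup (\<lambda>n. ereal (ln (real (cov_num T U (A ` {1..n}))) / real n) + ereal e)"
    by (intro Limsup_mono always_eventually allI) simp
  also have "\<dots> = limsup (\<lambda>n. ereal (ln (real (cov_num T U (A ` {1..n}))) / real n)) + ereal e"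
    by (rule Limsup_add_ereal_right) simp_all
  finally show ?thesis by (simp add: top_seq_entropy_cover_def cov_num_def)
qed

text \<open>The cores are closed sets inside the atoms, so the sets V v, which avoid all cores but that of v, form
an open cover, and H_le_cover_plus applies with an arbitrarily small error e per time.\<close>

theorem meas_seq_entropy_le_top:
  fixes T :: "'a::metric_space \<Rightarrow> 'a"
  assumes \<mu>: "\<mu> \<in> invariant_prob_measures T" and T: "continuous_on UNIV T"
  shows "meas_seq_entropy \<mu> A T \<le> top_seq_entropy A T"
  unfolding meas_seq_entropy_def
proof (rule SUP_least)
  fix \<xi> :: "'a set set" assume \<xi>: "\<xi> \<in> finite_borel_partitions"
  interpret borel_system \<mu> T using \<mu> T by (rule invariant_prob_measures_system)
  have \<xi>': "finite \<xi>" "\<xi> \<subseteq> sets borel" "partition_on UNIV \<xi>"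
    using \<xi> by (simp_all add: finite_borel_partitions_def)
  obtain f :: "'a \<Rightarrow> 'a set" where f: "\<xi> = level_sets f" "range f = \<xi>"
    using partition_eq_level_sets[OF \<xi>'(3)] by blast
  have f_vim: "f -` {v} \<in> sets borel" if "v \<in> range f" for v
    using \<xi>'(2) that unfolding f(1) level_sets_def by blast
  have sf: "simple_function \<mu> f"
    using f_vim sets \<xi>'(1) f(2) by (intro simple_functionI_UNIV[OF space_UNIV]) simp_all
  have "meas_seq_entropy_partition \<mu> A T \<xi> \<le> top_seq_entropy A T + ereal e" if "0 < e" for e
  proof -
    \<comment> \<open>The mass lost in each atom, chosen so that the bound 3 card (range f) r of ent_le_option_partition
    is at most e.\<close>
    let ?r = "min 1 (e / (3 * real (card (range f))))"
    have fin: "finite (range f)" using \<xi>'(1) f(2) by simp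
    then have "0 < card (range f)" by (simp add: card_gt_0_iff)
    then have "0 < ?r" using \<open>0 < e\<close> by simp
    then have "0 < ?r\<^sup>2" by (rule zero_less_power)
    have "\<exists>C. closed C \<and> C \<subseteq> f -` {v} \<and> measure \<mu> (f -` {v} - C) \<le> ?r\<^sup>2" if v: "v \<in> range f" for v
    proof -
      obtain C V where CV: "closed C" "open V" "C \<subseteq> f -` {v}" "f -` {v} \<subseteq> V" "measure \<mu> (V - C) < ?r\<^sup>2"
        using borel_sandwich_closed_open[OF finite_measure_axioms sets f_vim[OF v] \<open>0 < ?r\<^sup>2\<close>] by blast
      have "measure \<mu> (f -` {v} - C) \<le> measure \<mu> (V - C)"
        using CV(1,2,4) sets by (intro finite_measure_mono) auto
      then have "measure \<mu> (f -` {v} - C) \<le> ?r\<^sup>2" using CV(5) by linarith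
      then show ?thesis using CV(1,3) by blast
    qed
    then obtain C where C: "\<And>v. v \<in> range f \<Longrightarrow> closed (C v)" "\<And>v. v \<in> range f \<Longrightarrow> C v \<subseteq> f -` {v}"
      "\<And>v. v \<in> range f \<Longrightarrow> measure \<mu> (f -` {v} - C v) \<le> ?r\<^sup>2" by metis
    define V where "V v = - (\<Union>w\<in>range f - {v}. C w)" for v
    define U where "U = V ` range f"
    have openV: "open (V v)" for v
      unfolding V_def using fin C(1) by (intro open_Compl closed_UN) simp_all
    have coverU: "\<Union>U = UNIV"
    proof (intro equalityI subsetI)
      fix x
      have "x \<in> V (f x)" unfolding V_def using C(2) by blast
      then show "x \<in> \<Union>U" unfolding U_def by blast
    qed simp
    have finU: "finite U" unfolding U_def using fin by simp
    have U: "U \<in> finite_open_covers"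
      using finU coverU openV by (auto simp: finite_open_covers_def U_def)
    have sep: "f x = f y" if "W \<in> U" "x \<in> W" "y \<in> W" "x \<in> C (f x)" "y \<in> C (f y)" for W x y
    proof -
      obtain v where v: "W = V v" using \<open>W \<in> U\<close> unfolding U_def by blast
      have "f z = v" if "z \<in> V v" "z \<in> C (f z)" for z
        using that unfolding V_def by blast
      then show ?thesis using that v by metis
    qed
    have "H f F \<le> ln (real (cov_num T U F)) + real (card F) * e" if "finite F" for F
    proof (rule H_le_cover_plus[OF sf \<open>0 < e\<close> finU coverU _ _ C(2) C(3) sep that])
      show "U \<subseteq> sets \<mu>" using openV sets by (auto simp: U_def)
      show "C v \<in> sets \<mu>" if "v \<in> range f" for v using C(1)[OF that] sets by simp
    qed
    then have "limsup (\<lambda>n. ereal (H f (A ` {1..n}) / real n)) \<le> top_seq_entropy_cover A T U + ereal e"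
      using \<open>0 < e\<close> by (intro limsup_H_le) simp_all
    also have "\<dots> \<le> top_seq_entropy A T + ereal e"
      unfolding top_seq_entropy_def by (intro add_right_mono SUP_upper U)
    finally show ?thesis
      unfolding meas_seq_entropy_partition_def f(1) by (simp add: partition_entropy_level_sets[OF sf])
  qed
  then show "meas_seq_entropy_partition \<mu> A T \<xi> \<le> top_seq_entropy A T" by (rule ereal_le_epsilon2)
qed

section \<open>Weak sequential compactness of probability measures on a compact metric space\<close>

text \<open>Digits 0 and 1 in base 3: the first digit in which two sequences differ outweighs all later ones, so
that close codes have long common initial segments.\<close>

definition binary_code :: "(nat \<Rightarrow> bool) \<Rightarrow> real" where
  "binary_code b = (\<Sum>n. of_bool (b n) * (1 / 3) ^ n)"

lemma summable_third: "summable (\<lambda>n. (1 / 3 :: real) ^ n)"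
  by (intro summable_geometric) simp

lemma summable_binary_code: "summable (\<lambda>n. of_bool (b n) * (1 / 3 :: real) ^ n)"
  by (rule summable_comparison_test'[OF summable_third, of 0]) simp

lemma binary_code_bounds: "0 \<le> binary_code b" "binary_code b \<le> 3 / 2"
proof -
  show "0 \<le> binary_code b"
    unfolding binary_code_def by (intro suminf_nonneg summable_binary_code) simp
  have "binary_code b \<le> (\<Sum>n. (1 / 3) ^ n)"
    unfolding binary_code_def by (intro suminf_le summable_binary_code summable_third) simp
  also have "\<dots> = 3 / 2" by (simp add: suminf_geometric)
  finally show "binary_code b \<le> 3 / 2" .
qed

lemma binary_code_agree:
  assumes close: "\<bar>binary_code b - binary_code c\<bar> < (1 / 3) ^ k / 2" and "i \<le> k"
  shows "b i = c i"
proof (rule ccontr)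
  assume "b i \<noteq> c i"
  define j where "j = (LEAST j. b j \<noteq> c j)"
  have j: "b j \<noteq> c j" unfolding j_def using \<open>b i \<noteq> c i\<close> by (rule LeastI)
  have "j \<le> i" unfolding j_def using \<open>b i \<noteq> c i\<close> by (rule Least_le)
  have before: "b n = c n" if "n < j" for n
    using that not_less_Least[of n "\<lambda>j. b j \<noteq> c j"] unfolding j_def by blast
  define d where "d n = (of_bool (b n) - of_bool (c n)) * (1 / 3 :: real) ^ n" for n
  have d_abs: "\<bar>d n\<bar> \<le> (1 / 3) ^ n" for n by (simp add: d_def abs_mult)
  have summ_d: "summable d"
    unfolding d_def left_diff_distrib by (intro summable_diff summable_binary_code)
  have "binary_code b - binary_code c = suminf d"
    unfolding binary_code_def d_def left_diff_distrib by (intro suminf_diff summable_binary_code)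
  also have "\<dots> = (\<Sum>n. d (n + Suc j)) + (\<Sum>n<Suc j. d n)"
    by (rule suminf_split_initial_segment[OF summ_d])
  also have "(\<Sum>n<Suc j. d n) = d j" using before by (simp add: d_def)
  finally have eq: "binary_code b - binary_code c = (\<Sum>n. d (n + Suc j)) + d j" .
  have summ: "summable (\<lambda>n. (1 / 3 :: real) ^ (n + Suc j))"
    by (subst summable_iff_shift) (rule summable_third)
  have "\<bar>\<Sum>n. d (n + Suc j)\<bar> \<le> (\<Sum>n. (1 / 3 :: real) ^ (n + Suc j))"
    unfolding real_norm_def[symmetric]
    by (rule norm_suminf_le[OF _ summ]) (simp only: real_norm_def d_abs)
  also have "\<dots> = (\<Sum>n. (1 / 3) ^ Suc j * (1 / 3) ^ n)"
  proof -
    have "(1 / 3 :: real) ^ (n + Suc j) = (1 / 3) ^ Suc j * (1 / 3) ^ n" for n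
      by (simp add: power_add)
    then show ?thesis by (simp only:)
  qed
  also have "\<dots> = (1 / 3) ^ Suc j * (\<Sum>n. (1 / 3) ^ n)"
    by (rule suminf_mult[OF summable_third])
  also have "\<dots> = (1 / 3) ^ j / 2" by (simp add: suminf_geometric)
  finally have "\<bar>\<Sum>n. d (n + Suc j)\<bar> \<le> (1 / 3) ^ j / 2" .
  moreover have "\<bar>d j\<bar> = (1 / 3) ^ j" using j by (cases "b j") (simp_all add: d_def abs_mult)
  ultimately have "(1 / 3) ^ j / 2 \<le> \<bar>binary_code b - binary_code c\<bar>" unfolding eq by linarith
  moreover have "(1 / 3 :: real) ^ k \<le> (1 / 3) ^ j"
    using \<open>j \<le> i\<close> \<open>i \<le> k\<close> by (intro power_decreasing) simp_all
  ultimately show False using close by linarith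
qed

text \<open>The finite covers by balls of radius 1 / (m + 1), for all m, arranged in one sequence.\<close>

lemma compact_fine_sequence:
  assumes "compact (UNIV :: 'a::metric_space set)"
  shows "\<exists>B :: nat \<Rightarrow> 'a set. (\<forall>n. open (B n)) \<and>
    (\<forall>e>0. \<exists>k. \<forall>x. \<exists>i<k. x \<in> B i \<and> (\<forall>y\<in>B i. dist x y < e))"
proof -
  have "\<exists>D. finite D \<and> (UNIV :: 'a set) \<subseteq> (\<Union>d\<in>D. ball d e)" if "0 < e" for e
    using assms that unfolding compact_eq_totally_bounded by blast
  then have "\<exists>D. finite D \<and> (UNIV :: 'a set) \<subseteq> (\<Union>d\<in>D. ball d (1 / real (Suc m)))" for m by simp
  then obtain D where D: "\<And>m. finite (D m)" "\<And>m. (UNIV :: 'a set) \<subseteq> (\<Union>d\<in>D m. ball d (1 / real (Suc m)))"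
    by metis
  define \<B> where "\<B> = (\<Union>m. (\<lambda>d. ball d (1 / real (Suc m))) ` D m)"
  have count: "countable \<B>" unfolding \<B>_def
    by (intro countable_UN countableI_type countable_image countable_finite D(1))
  have "\<B> \<noteq> {}"
  proof -
    have "D 0 \<noteq> {}" using D(2)[of 0] by auto
    then show ?thesis unfolding \<B>_def by auto
  qed
  define B where "B = from_nat_into \<B>"
  have rng: "range B = \<B>" unfolding B_def by (rule range_from_nat_into[OF \<open>\<B> \<noteq> {}\<close> count])
  have "open (B n)" for n
  proof -
    have "B n \<in> \<B>" using rng by blast
    then show ?thesis unfolding \<B>_def by auto
  qed
  moreover have "\<exists>k. \<forall>x. \<exists>i<k. x \<in> B i \<and> (\<forall>y\<in>B i. dist x y < e)" if e: "0 < e" for e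
  proof -
    obtain m where m: "1 / real (Suc m) < e / 2"
      using reals_Archimedean[of "e / 2"] \<open>0 < e\<close> by (auto simp: inverse_eq_divide)
    let ?S = "(\<lambda>d. ball d (1 / real (Suc m))) ` D m"
    have "?S \<subseteq> range B" unfolding rng \<B>_def by blast
    then obtain I where I: "finite I" "?S = B ` I"
      using D(1)[of m] finite_subset_image[of ?S B UNIV] by auto
    have "\<exists>i<Suc (Max I). x \<in> B i \<and> (\<forall>y\<in>B i. dist x y < e)" for x
    proof -
      obtain d where d: "d \<in> D m" "x \<in> ball d (1 / real (Suc m))" using D(2)[of m] by blast
      have "ball d (1 / real (Suc m)) \<in> B ` I"
        unfolding I(2)[symmetric] using d(1) by (rule imageI)
      then obtain i where i: "i \<in> I" "B i = ball d (1 / real (Suc m))" by force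
      have "dist x y < e" if "y \<in> B i" for y
      proof -
        have "dist d y < 1 / real (Suc m)" using that i(2) by simp
        moreover have "dist d x < 1 / real (Suc m)" using d(2) by simp
        ultimately show ?thesis using m dist_triangle[of x y d] by (simp add: dist_commute)
      qed
      moreover have "i \<le> Max I" using i(1) I(1) by simp
      ultimately show ?thesis using i(2) d(2) by (intro exI[of _ i]) simp
    qed
    then show ?thesis by blast
  qed
  ultimately show ?thesis by blast
qed

text \<open>Code a point by the list of those sets of a fine sequence that contain it. Points that agree on the
first k sets lie together in a small one.\<close>

lemma compact_real_coding:
  assumes "compact (UNIV :: 'a::metric_space set)"
  shows "\<exists>s :: 'a \<Rightarrow> real. s \<in> borel_measurable borel \<and> (\<forall>x. 0 \<le> s x \<and> s x \<le> 3 / 2) \<and>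
    (\<forall>e>0. \<exists>\<delta>>0. \<forall>x y. \<bar>s x - s y\<bar> < \<delta> \<longrightarrow> dist x y < e)"
proof -
  obtain B :: "nat \<Rightarrow> 'a set" where B: "\<And>n. open (B n)"
    "\<And>e. 0 < e \<Longrightarrow> \<exists>k. \<forall>x. \<exists>i<k. x \<in> B i \<and> (\<forall>y\<in>B i. dist x y < e)"
    using compact_fine_sequence[OF assms] by blast
  define s where "s x = binary_code (\<lambda>n. x \<in> B n)" for x
  have "s \<in> borel_measurable borel"
  proof -
    have "s = (\<lambda>x. \<Sum>n. indicator (B n) x * (1 / 3) ^ n)"
      by (simp add: s_def binary_code_def indicator_def fun_eq_iff of_bool_def if_distrib cong: if_cong)
    moreover have "(\<lambda>x. indicator (B n) x * (1 / 3) ^ n :: real) \<in> borel_measurable borel" for n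
      using B(1)[of n] by (intro borel_measurable_times borel_measurable_indicator) auto
    ultimately show ?thesis by (simp add: borel_measurable_suminf)
  qed
  moreover have "\<exists>\<delta>>0. \<forall>x y. \<bar>s x - s y\<bar> < \<delta> \<longrightarrow> dist x y < e" if e: "0 < e" for e
  proof -
    obtain k where k: "\<forall>x. \<exists>i<k. x \<in> B i \<and> (\<forall>y\<in>B i. dist x y < e)" using B(2)[OF e] by blast
    have "dist x y < e" if close: "\<bar>s x - s y\<bar> < (1 / 3) ^ k / 2" for x y
    proof -
      obtain i where i: "i < k" "x \<in> B i" "\<And>y. y \<in> B i \<Longrightarrow> dist x y < e" using k by blast
      have "(x \<in> B i) = (y \<in> B i)"
        using close i(1) unfolding s_def by (intro binary_code_agree[where k=k]) simp_all
      then show ?thesis using i by blast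
    qed
    then show ?thesis by (intro exI[of _ "(1 / 3) ^ k / 2"]) simp
  qed
  moreover have "0 \<le> s x \<and> s x \<le> 3 / 2" for x
    unfolding s_def using binary_code_bounds by blast
  ultimately show ?thesis by blast
qed

text \<open>The inverse of the coding s extends to the closure of its range. The relation G t x says that x is a
limit of points whose codes tend to t; such an x exists by compactness, and the hypothesis on s makes
it unique and uniformly continuous in t.\<close>

lemma compact_real_coding_inverse:
  fixes s :: "'a::metric_space \<Rightarrow> real"
  assumes comp: "compact (UNIV :: 'a set)"
    and s: "\<And>e. 0 < e \<Longrightarrow> \<exists>\<delta>>0. \<forall>x y. \<bar>s x - s y\<bar> < \<delta> \<longrightarrow> dist x y < e"
  shows "\<exists>g. continuous_on (closure (range s)) g \<and> (\<forall>x. g (s x) = x)"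
proof -
  define G where "G t x \<longleftrightarrow> (\<forall>e>0. \<exists>y. \<bar>s y - t\<bar> < e \<and> dist y x < e)" for t x
  have ex: "\<exists>x. G t x" if t: "t \<in> closure (range s)" for t
  proof -
    obtain \<sigma> where \<sigma>: "\<And>n. \<sigma> n \<in> range s" "\<sigma> \<longlonglongrightarrow> t" using t unfolding closure_sequential by blast
    have "\<exists>y. \<sigma> n = s y" for n using \<sigma>(1)[of n] by blast
    then obtain y where y: "\<And>n. \<sigma> n = s (y n)" by metis
    obtain l r where lr: "strict_mono r" "(y \<circ> r) \<longlonglongrightarrow> l"
      using comp unfolding compact_def by blast
    have "G t l" unfolding G_def
    proof (intro allI impI)
      fix e :: real assume "0 < e"
      have "(\<sigma> \<circ> r) \<longlonglongrightarrow> t" by (rule LIMSEQ_subseq_LIMSEQ[OF \<sigma>(2) lr(1)])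
      then have "\<forall>\<^sub>F n in sequentially. dist ((\<sigma> \<circ> r) n) t < e" using \<open>0 < e\<close> by (rule tendstoD)
      moreover have "\<forall>\<^sub>F n in sequentially. dist ((y \<circ> r) n) l < e" using lr(2) \<open>0 < e\<close> by (rule tendstoD)
      ultimately have "\<forall>\<^sub>F n in sequentially. dist ((\<sigma> \<circ> r) n) t < e \<and> dist ((y \<circ> r) n) l < e"
        by (rule eventually_conj)
      then obtain n where "dist (\<sigma> (r n)) t < e" "dist (y (r n)) l < e"
        unfolding eventually_sequentially by auto
      then show "\<exists>y. \<bar>s y - t\<bar> < e \<and> dist y l < e"
        unfolding y by (intro exI[of _ "y (r n)"]) (simp add: dist_real_def)
    qed
    then show ?thesis by blast
  qed
  have unif: "\<exists>\<delta>>0. \<forall>t t' x x'. G t x \<longrightarrow> G t' x' \<longrightarrow> \<bar>t - t'\<bar> < \<delta> \<longrightarrow> dist x x' < e" if "0 < e" for e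
  proof -
    obtain \<delta> where \<delta>: "0 < \<delta>" "\<And>x y. \<bar>s x - s y\<bar> < \<delta> \<Longrightarrow> dist x y < e / 3"
      using s[of "e / 3"] \<open>0 < e\<close> by (auto simp only: zero_less_divide_iff zero_less_numeral)
    define \<eta> where "\<eta> = min (\<delta> / 3) (e / 3)"
    have \<eta>: "0 < \<eta>" "\<eta> \<le> \<delta> / 3" "\<eta> \<le> e / 3" using \<delta>(1) \<open>0 < e\<close> by (auto simp: \<eta>_def)
    have "dist x x' < e" if Gt: "G t x" "G t' x'" "\<bar>t - t'\<bar> < \<delta> / 3" for t t' x x'
    proof -
      obtain y where y: "\<bar>s y - t\<bar> < \<eta>" "dist y x < \<eta>" using Gt(1) \<eta>(1) unfolding G_def by blast
      obtain y' where y': "\<bar>s y' - t'\<bar> < \<eta>" "dist y' x' < \<eta>" using Gt(2) \<eta>(1) unfolding G_def by blast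
      have "\<bar>s y - s y'\<bar> < \<delta>" using y(1) y'(1) Gt(3) \<eta>(2) by linarith
      then have "dist y y' < e / 3" by (rule \<delta>(2))
      moreover have "dist x x' \<le> dist x y + dist y y' + dist y' x'"
        using dist_triangle[of x x' y] dist_triangle[of y x' y'] by linarith
      ultimately show ?thesis using y(2) y'(2) \<eta>(3) by (simp add: dist_commute)
    qed
    then show ?thesis using \<delta>(1) by (intro exI[of _ "\<delta> / 3"]) auto
  qed
  define g where "g t = (SOME x. G t x)" for t
  have g: "G t (g t)" if "t \<in> closure (range s)" for t
    unfolding g_def using ex[OF that] by (rule someI_ex)
  have "continuous_on (closure (range s)) g"
    unfolding continuous_on_iff
  proof (intro ballI allI impI)
    fix t and e :: real assume t: "t \<in> closure (range s)" and "0 < e"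
    obtain \<delta> where \<delta>: "0 < \<delta>"
      "\<And>t t' x x'. G t x \<Longrightarrow> G t' x' \<Longrightarrow> \<bar>t - t'\<bar> < \<delta> \<Longrightarrow> dist x x' < e" using unif[OF \<open>0 < e\<close>] by blast
    have "dist (g t') (g t) < e" if "t' \<in> closure (range s)" "dist t' t < \<delta>" for t'
      using \<delta>(2)[OF g[OF that(1)] g[OF t]] that(2) by (simp add: dist_real_def)
    then show "\<exists>d>0. \<forall>x'\<in>closure (range s). dist x' t < d \<longrightarrow> dist (g x') (g t) < e" using \<delta>(1) by blast
  qed
  moreover have "g (s x) = x" for x
  proof (rule ccontr)
    assume "g (s x) \<noteq> x"
    then have "0 < dist (g (s x)) x" by simp
    from unif[OF this] obtain \<delta> where \<delta>: "0 < \<delta>"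
      "\<And>t t' y y'. G t y \<Longrightarrow> G t' y' \<Longrightarrow> \<bar>t - t'\<bar> < \<delta> \<Longrightarrow> dist y y' < dist (g (s x)) x" by blast
    have "s x \<in> closure (range s)" by (rule subsetD[OF closure_subset rangeI])
    moreover have "G (s x) x"
      unfolding G_def
    proof (intro allI impI)
      fix e :: real assume "0 < e"
      then show "\<exists>y. \<bar>s y - s x\<bar> < e \<and> dist y x < e" by (intro exI[of _ x]) simp
    qed
    ultimately have "dist (g (s x)) x < dist (g (s x)) x"
      using \<delta>(2)[OF g[of "s x"], of "s x" x] \<delta>(1) by simp
    then show False by simp
  qed
  ultimately show ?thesis by blast
qed

text \<open>The laws of the code s are probability measures on a bounded interval, so Helly's theorem provides a
subsequence with a weak limit M. The limit lives on the closure K of the codes, where the continuous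
inverse g of the coding carries it back to the space.\<close>

theorem compact_prob_weakly_convergent_subsequence:
  fixes \<nu> :: "nat \<Rightarrow> 'a::metric_space measure"
  assumes comp: "compact (UNIV :: 'a set)" and prob: "\<And>n. prob_space (\<nu> n)"
    and sets: "\<And>n. sets (\<nu> n) = sets borel"
  shows "\<exists>r \<mu>. strict_mono r \<and> prob_space \<mu> \<and> sets \<mu> = sets borel \<and>
    (\<forall>f :: 'a \<Rightarrow> real. continuous_on UNIV f \<longrightarrow> (\<lambda>n. \<integral>x. f x \<partial>\<nu> (r n)) \<longlonglongrightarrow> (\<integral>x. f x \<partial>\<mu>))"
proof -
  obtain s :: "'a \<Rightarrow> real" where s: "s \<in> borel_measurable borel" "\<And>x. 0 \<le> s x" "\<And>x. s x \<le> 3 / 2"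
    and s_inv: "\<And>e. 0 < e \<Longrightarrow> \<exists>\<delta>>0. \<forall>x y. \<bar>s x - s y\<bar> < \<delta> \<longrightarrow> dist x y < e"
    using compact_real_coding[OF comp] by blast
  define K where "K = closure (range s)"
  obtain g where g: "continuous_on K g" "\<And>x. g (s x) = x"
    using compact_real_coding_inverse[OF comp s_inv] unfolding K_def by blast
  have sK: "s x \<in> K" for x unfolding K_def by (rule subsetD[OF closure_subset rangeI])
  have closedK: "closed K" by (simp add: K_def)
  have s_meas: "s \<in> measurable (\<nu> n) borel" for n
    using s(1) unfolding measurable_cong_sets[OF sets refl] .
  define law where "law n = distr (\<nu> n) borel s" for n
  have dist: "real_distribution (law n)" for n
    unfolding law_def using prob_space.prob_space_distr[OF prob s_meas]
    by (simp add: real_distribution_def real_distribution_axioms_def)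
  have "tight law"
    unfolding tight_def
  proof (intro conjI allI impI)
    fix \<epsilon> :: real assume "0 < \<epsilon>"
    have "measure (law n) {-1<..2} = 1" for n
    proof -
      have "s x \<in> {-1<..2}" for x using s(2)[of x] s(3)[of x] by simp
      then have "s -` {-1<..2} \<inter> space (\<nu> n) = space (\<nu> n)" by blast
      then show ?thesis
        unfolding law_def by (subst measure_distr[OF s_meas]) (simp_all add: prob_space.prob_space[OF prob])
    qed
    then show "\<exists>a b. a < b \<and> (\<forall>n. 1 - \<epsilon> < measure (law n) {a<..b})"
      using \<open>0 < \<epsilon>\<close> by (intro exI[of _ "-1"] exI[of _ 2]) simp
  qed (rule dist)
  from tight_imp_convergent_subsubsequence[OF this strict_mono_id]
  obtain r M where r: "strict_mono r" and M: "real_distribution M" and "weak_conv_m (law \<circ> id \<circ> r) M"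
    by blast
  then have conv: "weak_conv_m (\<lambda>n. law (r n)) M" by (simp add: o_def)
  interpret M: real_distribution M by (rule M)
  have int_conv: "(\<lambda>n. \<integral>x. F (s x) \<partial>\<nu> (r n)) \<longlonglongrightarrow> (\<integral>t. F t \<partial>M)"
    if F: "continuous_on UNIV F" "\<And>t. norm (F t) \<le> B" for F :: "real \<Rightarrow> real" and B
  proof -
    have "(\<lambda>n. \<integral>t. F t \<partial>law (r n)) \<longlonglongrightarrow> (\<integral>t. F t \<partial>M)"
      using F by (intro weak_conv_imp_integral_bdd_continuous_conv[OF dist M conv])
        (simp_all add: continuous_on_eq_continuous_at)
    moreover have "(\<integral>t. F t \<partial>law (r n)) = (\<integral>x. F (s x) \<partial>\<nu> (r n))" for n
      unfolding law_def using F(1) by (intro integral_distr s_meas borel_measurable_continuous_onI)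
    ultimately show ?thesis by simp
  qed
  \<comment> \<open>The truncated distance to K is continuous and vanishes on all codes, so its integral with respect to
  the limit is 0.\<close>
  have AE_K: "AE t in M. t \<in> K"
  proof -
    define F where "F t = min 1 (infdist t K)" for t
    have F: "continuous_on UNIV F" "\<And>t. norm (F t) \<le> 1" "\<And>t. 0 \<le> F t"
      unfolding F_def by (intro continuous_intros, simp_all add: infdist_nonneg)
    have "F (s x) = 0" for x using sK[of x] by (simp add: F_def)
    then have "(\<lambda>n. 0) \<longlonglongrightarrow> (\<integral>t. F t \<partial>M)" using int_conv[OF F(1,2)] by simp
    then have "(\<integral>t. F t \<partial>M) = 0" using LIMSEQ_unique[OF _ tendsto_const] by metis
    moreover have "integrable M F"
    proof (rule M.integrable_const_bound[where B=1])
      show "F \<in> borel_measurable M" using F(1) by (simp add: borel_measurable_continuous_onI)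
    qed (use F(2) in simp)
    moreover have "AE t in M. 0 \<le> F t" by (rule AE_I2) (rule F(3))
    ultimately have "AE t in M. F t = 0"
      using integral_nonneg_eq_0_iff_AE by blast
    moreover have "t \<in> K" if "F t = 0" for t
    proof -
      have "infdist t K = 0" using that by (simp add: F_def min_def split: if_splits)
      moreover have "K \<noteq> {}" using sK by blast
      ultimately show ?thesis using in_closed_iff_infdist_zero[OF closedK] by blast
    qed
    ultimately show ?thesis by (auto elim!: eventually_mono)
  qed
  define h where "h t = (if t \<in> K then g t else undefined)" for t
  have h_meas: "h \<in> borel_measurable borel"
    unfolding h_def
  proof (subst measurable_If_restrict_space_iff)
    show "{x \<in> space borel. x \<in> K} \<in> sets borel" using closedK by simp
    show "g \<in> borel_measurable (restrict_space borel {x. x \<in> K}) \<and>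
      (\<lambda>_. undefined) \<in> borel_measurable (restrict_space borel {x. x \<notin> K})"
      using borel_measurable_continuous_on_restrict[OF g(1)] by simp
  qed
  then have h_meas': "h \<in> measurable M borel" by simp
  define \<mu> where "\<mu> = distr M borel h"
  have "prob_space \<mu>" unfolding \<mu>_def by (rule M.prob_space_distr[OF h_meas'])
  moreover have "(\<lambda>n. \<integral>x. f x \<partial>\<nu> (r n)) \<longlonglongrightarrow> (\<integral>x. f x \<partial>\<mu>)"
    if f: "continuous_on UNIV f" for f :: "'a \<Rightarrow> real"
  proof -
    have "bounded (range f)" using compact_continuous_image[OF f comp] by (rule compact_imp_bounded)
    then obtain B where "\<And>x. norm (f x) \<le> B" unfolding bounded_iff by blast
    then have B: "\<And>x. norm (f x) \<le> B" by blast
    have "0 \<le> B" using B[of undefined] norm_ge_zero[of "f undefined"] by linarith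
    \<comment> \<open>A test function f on the space becomes f o g on K and, by Tietze's theorem, a bounded continuous
    function F on the line with F (s x) = f x.\<close>
    have "continuous_on K (\<lambda>t. f (g t))"
      by (rule continuous_on_compose2[OF f g(1)]) simp
    moreover have "closedin (top_of_set UNIV) K" using closedK by simp
    ultimately have "\<exists>F. continuous_on UNIV F \<and> (\<forall>t\<in>K. F t = f (g t)) \<and> (\<forall>t. norm (F t) \<le> B)"
      by (rule Tietze[OF _ _ \<open>0 \<le> B\<close> B]) blast
    then obtain F where F: "continuous_on UNIV F" "\<And>t. t \<in> K \<Longrightarrow> F t = f (g t)"
      "\<And>t. norm (F t) \<le> B" by blast
    have "F (s x) = f x" for x using F(2)[OF sK] g(2) by simp
    then have "(\<lambda>n. \<integral>x. f x \<partial>\<nu> (r n)) \<longlonglongrightarrow> (\<integral>t. F t \<partial>M)"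
      using int_conv[OF F(1) F(3)] by simp
    also have "(\<integral>t. F t \<partial>M) = (\<integral>t. f (h t) \<partial>M)"
    proof (rule integral_cong_AE)
      show "F \<in> borel_measurable M" using F(1) by (simp add: borel_measurable_continuous_onI)
      show "(\<lambda>t. f (h t)) \<in> borel_measurable M"
        using measurable_compose[OF h_meas' borel_measurable_continuous_onI[OF f]] .
      show "AE t in M. F t = f (h t)"
        using AE_K by (rule eventually_mono) (simp add: h_def F(2))
    qed
    also have "\<dots> = (\<integral>x. f x \<partial>\<mu>)"
      unfolding \<mu>_def using f by (intro integral_distr[symmetric] h_meas' borel_measurable_continuous_onI)
    finally show ?thesis .
  qed
  moreover have "sets \<mu> = sets borel" by (simp add: \<mu>_def)
  ultimately show ?thesis using r by blast
qed

section \<open>Sets with negligible boundary\<close>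

text \<open>As a function of a distance d, an approximation from above of the indicator function of d = 0.\<close>

definition tent :: "nat \<Rightarrow> real \<Rightarrow> real" where
  "tent k d = max 0 (1 - real k * d)"

lemma tent_bounds: "0 \<le> d \<Longrightarrow> 0 \<le> tent k d" "0 \<le> d \<Longrightarrow> tent k d \<le> 1"
  by (simp_all add: tent_def)

lemma tent_0: "tent k 0 = 1"
  by (simp add: tent_def)

lemma tent_tendsto:
  assumes "0 \<le> d"
  shows "(\<lambda>k. tent k d) \<longlonglongrightarrow> of_bool (d = 0)"
proof (cases "d = 0")
  case False
  then have "0 < d" using assms by simp
  obtain N where N: "1 < real N * d" using reals_Archimedean3[OF \<open>0 < d\<close>] by blast
  have "tent k d = 0" if "N \<le> k" for k
  proof -
    have "real N * d \<le> real k * d" using that \<open>0 < d\<close> by (intro mult_right_mono) simp_all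
    then show ?thesis using N by (simp add: tent_def)
  qed
  then have "\<forall>\<^sub>F k in sequentially. tent k d = of_bool (d = 0)"
    using False unfolding eventually_sequentially by auto
  then show ?thesis by (rule tendsto_eventually)
qed (simp add: tent_0)

lemma continuous_on_tent:
  assumes "continuous_on S f"
  shows "continuous_on S (\<lambda>x. tent k (f x))"
  unfolding tent_def by (intro continuous_intros assms)

lemma prob_borel_integrable:
  fixes f :: "'a::topological_space \<Rightarrow> real"
  assumes "prob_space M" "sets M = sets borel" "continuous_on UNIV f" "\<And>x. \<bar>f x\<bar> \<le> B"
  shows "integrable M f"
proof -
  interpret prob_space M by fact
  show ?thesis
  proof (rule integrable_const_bound[where B=B])
    show "f \<in> borel_measurable M"
      unfolding measurable_cong_sets[OF assms(2) refl] by (rule borel_measurable_continuous_onI[OF assms(3)])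
  qed (use assms(4) in simp)
qed

lemma integral_tent_tendsto:
  fixes d :: "'a::topological_space \<Rightarrow> real"
  assumes "prob_space M" "sets M = sets borel" "continuous_on UNIV d" "\<And>x. 0 \<le> d x"
  shows "(\<lambda>k. \<integral>x. tent k (d x) \<partial>M) \<longlonglongrightarrow> measure M {x. d x = 0}"
proof -
  interpret prob_space M by fact
  have space: "space M = UNIV" using sets_eq_imp_space_eq[OF assms(2)] by simp
  have meas: "f \<in> borel_measurable M" if "continuous_on UNIV f" for f :: "'a \<Rightarrow> real"
    unfolding measurable_cong_sets[OF assms(2) refl] by (rule borel_measurable_continuous_onI[OF that])
  have "closed {x. d x = 0}" using assms(3) by (intro closed_Collect_eq continuous_on_const)
  then have Z: "{x. d x = 0} \<in> sets M" using assms(2) by simp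
  have "(\<lambda>k. \<integral>x. tent k (d x) \<partial>M) \<longlonglongrightarrow> (\<integral>x. indicator {x. d x = 0} x \<partial>M)"
  proof (rule integral_dominated_convergence[where w="\<lambda>_. 1"])
    show "(\<lambda>x. tent k (d x)) \<in> borel_measurable M" for k
      by (intro meas continuous_on_tent assms(3))
    show "AE x in M. (\<lambda>k. tent k (d x)) \<longlonglongrightarrow> indicator {x. d x = 0} x"
      using tent_tendsto[OF assms(4)] by (intro AE_I2) (simp add: indicator_def)
    show "AE x in M. norm (tent k (d x)) \<le> 1" for k
      using tent_bounds[OF assms(4)] by (intro AE_I2) simp
  qed (use Z in simp_all)
  then show ?thesis using Z space by simp
qed

text \<open>The tents over the distance to a closed set recover its measure, and the closed sets generate.\<close>

lemma prob_eqI_continuous: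
  fixes M N :: "'a::metric_space measure"
  assumes M: "prob_space M" "sets M = sets borel" and N: "prob_space N" "sets N = sets borel"
    and eq: "\<And>f :: 'a \<Rightarrow> real. continuous_on UNIV f \<Longrightarrow> (\<And>x. \<bar>f x\<bar> \<le> 1) \<Longrightarrow> (\<integral>x. f x \<partial>M) = (\<integral>x. f x \<partial>N)"
  shows "M = N"
proof (rule measure_eqI_generator_eq[where E="Collect closed" and \<Omega>=UNIV and A="\<lambda>_. UNIV"])
  interpret M: prob_space M by fact
  interpret N: prob_space N by fact
  show "Int_stable (Collect closed :: 'a set set)"
    by (rule Int_stableI) (simp add: closed_Int)
  show "sets M = sigma_sets UNIV (Collect closed)" "sets N = sigma_sets UNIV (Collect closed)"
    unfolding M(2) N(2) by (simp_all add: borel_eq_closed)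
  fix C :: "'a set" assume "C \<in> Collect closed"
  then have C: "closed C" by simp
  have "measure M C = measure N C"
  proof (cases "C = {}")
    case False
    have cont: "continuous_on UNIV (\<lambda>x. infdist x C)" by (intro continuous_intros)
    have "(\<integral>x. tent k (infdist x C) \<partial>M) = (\<integral>x. tent k (infdist x C) \<partial>N)" for k
    proof (rule eq)
      show "continuous_on UNIV (\<lambda>x. tent k (infdist x C))" by (rule continuous_on_tent[OF cont])
      fix x
      show "\<bar>tent k (infdist x C)\<bar> \<le> 1"
        using tent_bounds[OF infdist_nonneg[of x C], of k] by linarith
    qed
    then have "(\<lambda>k. \<integral>x. tent k (infdist x C) \<partial>N) \<longlonglongrightarrow> measure M {x. infdist x C = 0}"
      using integral_tent_tendsto[OF M cont infdist_nonneg] by (simp only:)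
    from LIMSEQ_unique[OF this integral_tent_tendsto[OF N cont infdist_nonneg]]
    have "measure M {x. infdist x C = 0} = measure N {x. infdist x C = 0}" .
    moreover have "{x. infdist x C = 0} = C"
      by (simp add: set_eq_iff in_closed_iff_infdist_zero[OF C False])
    ultimately show ?thesis by (simp only:)
  qed simp
  then show "emeasure M C = emeasure N C"
    by (simp add: M.emeasure_eq_measure N.emeasure_eq_measure)
qed (use M prob_space.emeasure_space_1[OF M(1)] in \<open>auto simp: sets_eq_imp_space_eq[OF M(2)]\<close>)

text \<open>On a metric space these are the sets whose boundary is a null set. In the form with continuous
functions, stability under intersections and under preimages of continuous measure-preserving maps,
and convergence of measures along weakly convergent sequences, are immediate.\<close>

definition jordan_set :: "'a::topological_space measure \<Rightarrow> 'a set \<Rightarrow> bool" where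
  "jordan_set M B \<longleftrightarrow> (\<forall>e>0. \<exists>f g :: 'a \<Rightarrow> real. continuous_on UNIV f \<and> continuous_on UNIV g \<and>
     (\<forall>x. 0 \<le> f x \<and> f x \<le> indicator B x \<and> indicator B x \<le> g x \<and> g x \<le> 1) \<and>
     (\<integral>x. g x - f x \<partial>M) < e)"

lemma jordan_setD:
  fixes M :: "'a::topological_space measure"
  assumes "jordan_set M B" "0 < e"
  shows "\<exists>f g :: 'a \<Rightarrow> real. continuous_on UNIV f \<and> continuous_on UNIV g \<and>
    (\<forall>x. 0 \<le> f x) \<and> (\<forall>x. f x \<le> indicator B x) \<and> (\<forall>x. indicator B x \<le> g x) \<and> (\<forall>x. g x \<le> 1) \<and>
    (\<integral>x. g x - f x \<partial>M) < e"
  using assms(1)[unfolded jordan_set_def, rule_format, OF assms(2)] by blast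

lemma jordan_set_Compl:
  assumes "jordan_set M B"
  shows "jordan_set M (- B)"
  unfolding jordan_set_def
proof (intro allI impI)
  fix e :: real assume "0 < e"
  obtain f g :: "'a \<Rightarrow> real" where fg: "continuous_on UNIV f" "continuous_on UNIV g"
    "\<And>x. 0 \<le> f x" "\<And>x. f x \<le> indicator B x" "\<And>x. indicator B x \<le> g x" "\<And>x. g x \<le> 1"
    "(\<integral>x. g x - f x \<partial>M) < e"
    using jordan_setD[OF assms \<open>0 < e\<close>] by blast
  have "0 \<le> 1 - g x \<and> 1 - g x \<le> indicator (- B) x \<and> indicator (- B) x \<le> 1 - f x \<and> 1 - f x \<le> 1" for x
    using fg(3,4,5,6)[of x] unfolding indicator_compl by linarith
  moreover have "(\<integral>x. (1 - f x) - (1 - g x) \<partial>M) < e" using fg(7) by simp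
  ultimately show "\<exists>f g :: 'a \<Rightarrow> real. continuous_on UNIV f \<and> continuous_on UNIV g \<and>
     (\<forall>x. 0 \<le> f x \<and> f x \<le> indicator (- B) x \<and> indicator (- B) x \<le> g x \<and> g x \<le> 1) \<and>
     (\<integral>x. g x - f x \<partial>M) < e"
    by (intro exI[of _ "\<lambda>x. 1 - g x"] exI[of _ "\<lambda>x. 1 - f x"] conjI continuous_intros fg) blast+
qed

lemma jordan_set_UNIV: "jordan_set M UNIV"
  unfolding jordan_set_def by (intro allI impI exI[of _ "\<lambda>_. 1 :: real"]) simp

text \<open>Multiply the lower functions and the upper functions: as all values lie between 0 and 1, the gaps at
most add up.\<close>

lemma jordan_set_Int:
  fixes M :: "'a::topological_space measure"
  assumes M: "prob_space M" "sets M = sets borel" and "jordan_set M B" "jordan_set M C"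
  shows "jordan_set M (B \<inter> C)"
  unfolding jordan_set_def
proof (intro allI impI)
  fix e :: real assume "0 < e"
  then have "0 < e / 2" by simp
  obtain f g :: "'a \<Rightarrow> real" where fg: "continuous_on UNIV f" "continuous_on UNIV g"
    "\<And>x. 0 \<le> f x" "\<And>x. f x \<le> indicator B x" "\<And>x. indicator B x \<le> g x" "\<And>x. g x \<le> 1"
    "(\<integral>x. g x - f x \<partial>M) < e / 2"
    using jordan_setD[OF assms(3) \<open>0 < e / 2\<close>] by blast
  obtain f' g' :: "'a \<Rightarrow> real" where fg': "continuous_on UNIV f'" "continuous_on UNIV g'"
    "\<And>x. 0 \<le> f' x" "\<And>x. f' x \<le> indicator C x" "\<And>x. indicator C x \<le> g' x" "\<And>x. g' x \<le> 1"
    "(\<integral>x. g' x - f' x \<partial>M) < e / 2"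
    using jordan_setD[OF assms(4) \<open>0 < e / 2\<close>] by blast
  have ind: "indicator B x \<le> (1 :: real)" "0 \<le> (indicator B x :: real)"
    "indicator C x \<le> (1 :: real)" "0 \<le> (indicator C x :: real)" for x
    by (simp_all add: indicator_def)
  have le1: "f x \<le> 1" "f' x \<le> 1" "0 \<le> g x" "0 \<le> g' x" for x
    using fg(4,5)[of x] fg'(4,5)[of x] ind[of x] by linarith+
  have bounds: "0 \<le> f x * f' x \<and> f x * f' x \<le> indicator (B \<inter> C) x \<and>
      indicator (B \<inter> C) x \<le> g x * g' x \<and> g x * g' x \<le> 1" for x
    using fg(3,4,5,6)[of x] fg'(3,4,5,6)[of x] le1[of x] ind[of x]
    by (simp add: indicator_inter_arith mult_mono mult_le_one)
  have diff: "g x * g' x - f x * f' x \<le> (g x - f x) + (g' x - f' x)" for x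
  proof -
    have "0 \<le> g x - f x" "0 \<le> g' x - f' x"
      using fg(4,5)[of x] fg'(4,5)[of x] by linarith+
    then have "(g x - f x) * g' x \<le> g x - f x" "f x * (g' x - f' x) \<le> g' x - f' x"
      using fg'(6)[of x] le1(4,1)[of x] fg(3)[of x]
      by (intro mult_left_le mult_left_le_one_le; simp)+
    then show ?thesis by (simp add: algebra_simps)
  qed
  have le2: "f x * f' x \<le> 1" "0 \<le> g x * g' x" for x
    using bounds[of x] ind by (intro mult_le_one mult_nonneg_nonneg le1 fg'(3))+
  have int: "integrable M (\<lambda>x. g x - f x)" "integrable M (\<lambda>x. g' x - f' x)"
    "integrable M (\<lambda>x. g x * g' x - f x * f' x)"
    using fg(3,6) fg'(3,6) le1 le2 bounds
    by (intro Bochner_Integration.integrable_diff prob_borel_integrable[OF M, where B=1]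
        continuous_intros fg(1,2) fg'(1,2); simp)+
  have "(\<integral>x. g x * g' x - f x * f' x \<partial>M) \<le> (\<integral>x. (g x - f x) + (g' x - f' x) \<partial>M)"
    using int diff by (intro integral_mono Bochner_Integration.integrable_add)
  also have "\<dots> = (\<integral>x. g x - f x \<partial>M) + (\<integral>x. g' x - f' x \<partial>M)"
    using int by (intro Bochner_Integration.integral_add)
  also have "\<dots> < e" using fg(7) fg'(7) by linarith
  finally show "\<exists>f g :: 'a \<Rightarrow> real. continuous_on UNIV f \<and> continuous_on UNIV g \<and>
     (\<forall>x. 0 \<le> f x \<and> f x \<le> indicator (B \<inter> C) x \<and> indicator (B \<inter> C) x \<le> g x \<and> g x \<le> 1) \<and>
     (\<integral>x. g x - f x \<partial>M) < e"
    using bounds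
    by (intro exI[of _ "\<lambda>x. f x * f' x"] exI[of _ "\<lambda>x. g x * g' x"] conjI continuous_intros fg fg') blast+
qed

lemma jordan_set_INT:
  assumes M: "prob_space M" "sets M = sets borel" and "finite I" "\<And>i. i \<in> I \<Longrightarrow> jordan_set M (B i)"
  shows "jordan_set M (\<Inter>i\<in>I. B i)"
  using assms(3,4)
proof (induction I)
  case empty
  then show ?case by (simp add: jordan_set_UNIV)
next
  case (insert i I)
  then show ?case using jordan_set_Int[OF M, of "B i" "\<Inter>i\<in>I. B i"] by simp
qed

lemma jordan_set_vimage:
  fixes M :: "'a::topological_space measure"
  assumes sets: "sets M = sets borel" and T: "continuous_on UNIV T" and inv: "distr M borel T = M"
    and B: "jordan_set M B"
  shows "jordan_set M (T -` B)"
  unfolding jordan_set_def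
proof (intro allI impI)
  fix e :: real assume "0 < e"
  obtain f g :: "'a \<Rightarrow> real" where fg: "continuous_on UNIV f" "continuous_on UNIV g"
    "\<And>x. 0 \<le> f x" "\<And>x. f x \<le> indicator B x" "\<And>x. indicator B x \<le> g x" "\<And>x. g x \<le> 1"
    "(\<integral>x. g x - f x \<partial>M) < e"
    using jordan_setD[OF B \<open>0 < e\<close>] by blast
  have T_meas: "T \<in> measurable M borel"
    unfolding measurable_cong_sets[OF sets refl] by (rule borel_measurable_continuous_onI[OF T])
  have "(\<lambda>x. g x - f x) \<in> borel_measurable borel"
    by (intro borel_measurable_continuous_onI continuous_intros fg)
  from integral_distr[OF T_meas this] have "(\<integral>x. g (T x) - f (T x) \<partial>M) < e"
    using fg(7) by (simp add: inv)
  moreover have "0 \<le> f (T x) \<and> f (T x) \<le> indicator (T -` B) x \<and> indicator (T -` B) x \<le> g (T x) \<and> g (T x) \<le> 1" for x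
    using fg(3-6)[of "T x"] by (simp add: indicator_def)
  ultimately show "\<exists>f g :: 'a \<Rightarrow> real. continuous_on UNIV f \<and> continuous_on UNIV g \<and>
     (\<forall>x. 0 \<le> f x \<and> f x \<le> indicator (T -` B) x \<and> indicator (T -` B) x \<le> g x \<and> g x \<le> 1) \<and>
     (\<integral>x. g x - f x \<partial>M) < e"
    by (intro exI[of _ "\<lambda>x. f (T x)"] exI[of _ "\<lambda>x. g (T x)"] conjI
        continuous_on_compose2[OF fg(1) T] continuous_on_compose2[OF fg(2) T]) blast+
qed

lemma jordan_set_vimage_funpow:
  assumes sets: "sets M = sets borel" and T: "continuous_on UNIV T" and inv: "distr M borel T = M"
    and B: "jordan_set M B"
  shows "jordan_set M ((T ^^ i) -` B)"
proof (induction i)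
  case (Suc i)
  have "(T ^^ Suc i) -` B = T -` ((T ^^ i) -` B)"
    by (simp only: funpow_Suc_right vimage_comp)
  then show ?case using jordan_set_vimage[OF sets T inv Suc] by (simp only:)
qed (simp add: B)

text \<open>Tents over max 0 (dist x y - r) approximate the closed ball from above, and complements of tents over
max 0 (r - dist x y) approximate the open ball from below. The two limits differ by the sphere.\<close>

lemma jordan_set_ball:
  fixes M :: "'a::metric_space measure"
  assumes M: "prob_space M" "sets M = sets borel" and null: "measure M {y. dist x y = r} = 0"
  shows "jordan_set M (ball x r)"
  unfolding jordan_set_def
proof (intro allI impI)
  fix e :: real assume "0 < e"
  interpret prob_space M by fact
  define d where "d y = max 0 (r - dist x y)" for y
  define d' where "d' y = max 0 (dist x y - r)" for y
  have cont: "continuous_on UNIV d" "continuous_on UNIV d'"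
    unfolding d_def d'_def by (intro continuous_intros)+
  have nn: "0 \<le> d y" "0 \<le> d' y" for y by (simp_all add: d_def d'_def)
  have borel: "{y. dist x y = r} \<in> sets M" "{y. d y = 0} \<in> sets M"
    unfolding M(2) using cont by (intro borel_closed closed_Collect_eq continuous_intros)+
  have sub: "{y. dist x y = r} \<subseteq> {y. d y = 0}" by (auto simp: d_def)
  have "{y. d' y = 0} = (UNIV - {y. d y = 0}) \<union> {y. dist x y = r}"
    by (auto simp: d_def d'_def)
  moreover have "space M = UNIV" using sets_eq_imp_space_eq[OF M(2)] by simp
  ultimately have "measure M {y. d' y = 0} \<le> (1 - measure M {y. d y = 0}) + 0"
    using prob_compl[OF borel(2)] borel null
      measure_Un_le[of "UNIV - {y. d y = 0}" M "{y. dist x y = r}"]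
      sets.compl_sets[OF borel(2)] by simp
  then have le: "measure M {y. d' y = 0} + measure M {y. d y = 0} - 1 \<le> 0" by simp
  have "(\<lambda>k. (\<integral>y. tent k (d' y) \<partial>M) + (\<integral>y. tent k (d y) \<partial>M) - 1) \<longlonglongrightarrow>
      measure M {y. d' y = 0} + measure M {y. d y = 0} - 1"
    by (intro tendsto_intros integral_tent_tendsto M cont nn)
  then have "\<forall>\<^sub>F k in sequentially. (\<integral>y. tent k (d' y) \<partial>M) + (\<integral>y. tent k (d y) \<partial>M) - 1 < e"
    by (rule order_tendstoD(2)) (use le \<open>0 < e\<close> in linarith)
  then obtain k where k: "(\<integral>y. tent k (d' y) \<partial>M) + (\<integral>y. tent k (d y) \<partial>M) - 1 < e"
    unfolding eventually_sequentially by blast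
  have int: "integrable M (\<lambda>y. tent k (d y))" "integrable M (\<lambda>y. tent k (d' y))"
    using tent_bounds nn
    by (intro prob_borel_integrable[OF M, where B=1] continuous_on_tent cont; simp)+
  have "(\<integral>y. tent k (d' y) - (1 - tent k (d y)) \<partial>M) < e"
    using k int by (simp add: prob_space)
  moreover have "0 \<le> 1 - tent k (d y) \<and> 1 - tent k (d y) \<le> indicator (ball x r) y \<and>
     indicator (ball x r) y \<le> tent k (d' y) \<and> tent k (d' y) \<le> 1" for y
  proof (cases "dist x y < r")
    case True
    then have "d' y = 0" by (simp add: d'_def)
    then show ?thesis using True tent_bounds[OF nn(1), of k y] by (simp add: tent_0)
  next
    case False
    then have "d y = 0" by (simp add: d_def)
    then show ?thesis using False tent_bounds[OF nn(2), of k y] by (simp add: tent_0)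
  qed
  ultimately show "\<exists>f g :: 'a \<Rightarrow> real. continuous_on UNIV f \<and> continuous_on UNIV g \<and>
     (\<forall>y. 0 \<le> f y \<and> f y \<le> indicator (ball x r) y \<and> indicator (ball x r) y \<le> g y \<and> g y \<le> 1) \<and>
     (\<integral>y. g y - f y \<partial>M) < e"
    by (intro exI[of _ "\<lambda>y. 1 - tent k (d y)"] exI[of _ "\<lambda>y. tent k (d' y)"] conjI
        continuous_intros continuous_on_tent cont) blast+
qed

lemma jordan_set_measure_tendsto:
  fixes M :: "'a::topological_space measure"
  assumes M: "prob_space M" "sets M = sets borel"
    and N: "\<And>n. prob_space (N n)" "\<And>n. sets (N n) = sets borel"
    and conv: "\<And>f :: 'a \<Rightarrow> real. continuous_on UNIV f \<Longrightarrow> (\<lambda>n. \<integral>x. f x \<partial>N n) \<longlonglongrightarrow> (\<integral>x. f x \<partial>M)"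
    and B: "jordan_set M B" "B \<in> sets borel"
  shows "(\<lambda>n. measure (N n) B) \<longlonglongrightarrow> measure M B"
proof (rule tendstoI)
  fix e :: real assume "0 < e"
  then have "0 < e / 2" by simp
  obtain f g :: "'a \<Rightarrow> real" where fg: "continuous_on UNIV f" "continuous_on UNIV g"
    "\<And>x. 0 \<le> f x" "\<And>x. f x \<le> indicator B x" "\<And>x. indicator B x \<le> g x" "\<And>x. g x \<le> 1"
    "(\<integral>x. g x - f x \<partial>M) < e / 2"
    using jordan_setD[OF B(1) \<open>0 < e / 2\<close>] by blast
  have ind: "0 \<le> (indicator B x :: real)" "(indicator B x :: real) \<le> 1" for x
    by (simp_all add: indicator_def)
  have abs_le: "\<bar>f x\<bar> \<le> 1" "\<bar>g x\<bar> \<le> 1" for x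
    using fg(3-6)[of x] ind[of x] by linarith+
  have sandwich: "(\<integral>x. f x \<partial>P) \<le> measure P B \<and> measure P B \<le> (\<integral>x. g x \<partial>P)"
    if P: "prob_space P" "sets P = sets borel" for P :: "'a measure"
  proof -
    interpret prob_space P by fact
    have int: "integrable P f" "integrable P g"
      by (rule prob_borel_integrable[OF P fg(1) abs_le(1)], rule prob_borel_integrable[OF P fg(2) abs_le(2)])
    have BP: "B \<in> sets P" using B(2) P(2) by simp
    then have int_B: "integrable P (indicator B :: 'a \<Rightarrow> real)"
      by (rule integrable_real_indicator) (simp add: emeasure_eq_measure)
    have "(\<integral>x. indicator B x \<partial>P) = measure P B"
      using sets_eq_imp_space_eq[OF P(2)] BP by simp
    moreover have "(\<integral>x. f x \<partial>P) \<le> (\<integral>x. indicator B x \<partial>P)"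
      by (rule integral_mono[OF int(1) int_B fg(4)])
    moreover have "(\<integral>x. indicator B x \<partial>P) \<le> (\<integral>x. g x \<partial>P)"
      by (rule integral_mono[OF int_B int(2) fg(5)])
    ultimately show ?thesis by simp
  qed
  have "(\<integral>x. g x - f x \<partial>M) = (\<integral>x. g x \<partial>M) - (\<integral>x. f x \<partial>M)"
    by (intro Bochner_Integration.integral_diff prob_borel_integrable[OF M _ abs_le(1)]
        prob_borel_integrable[OF M _ abs_le(2)] fg)
  then have gap: "(\<integral>x. g x \<partial>M) - (\<integral>x. f x \<partial>M) < e / 2" using fg(7) by simp
  have "\<forall>\<^sub>F n in sequentially. dist (\<integral>x. f x \<partial>N n) (\<integral>x. f x \<partial>M) < e / 2"
    "\<forall>\<^sub>F n in sequentially. dist (\<integral>x. g x \<partial>N n) (\<integral>x. g x \<partial>M) < e / 2"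
    using conv[OF fg(1)] conv[OF fg(2)] \<open>0 < e / 2\<close> by (simp_all only: tendstoD)
  then show "\<forall>\<^sub>F n in sequentially. dist (measure (N n) B) (measure M B) < e"
  proof eventually_elim
    case (elim n)
    then show ?case
      using sandwich[OF N(1) N(2), of n] sandwich[OF M] gap unfolding dist_real_def by linarith
  qed
qed

text \<open>The law of the distance to x has at most countably many atoms.\<close>

lemma ex_null_sphere:
  fixes M :: "'a::metric_space measure"
  assumes M: "prob_space M" "sets M = sets borel" and "a < b"
  shows "\<exists>r. a < r \<and> r < b \<and> measure M {y. dist x y = r} = 0"
proof -
  interpret prob_space M by fact
  have meas: "(\<lambda>y. dist x y) \<in> measurable M borel"
    unfolding measurable_cong_sets[OF M(2) refl]
    by (intro borel_measurable_continuous_onI continuous_intros)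
  interpret D: prob_space "distr M borel (\<lambda>y. dist x y)" by (rule prob_space_distr[OF meas])
  have eq: "measure (distr M borel (\<lambda>y. dist x y)) {r} = measure M {y. dist x y = r}" for r
    using measure_distr[OF meas, of "{r}"] sets_eq_imp_space_eq[OF M(2)] by (simp add: vimage_def)
  have "countable {r. measure M {y. dist x y = r} \<noteq> 0}"
    using D.countable_support unfolding eq .
  moreover have "uncountable {a<..<b}" using \<open>a < b\<close> by (simp add: uncountable_open_interval)
  ultimately have "\<not> {a<..<b} \<subseteq> {r. measure M {y. dist x y = r} \<noteq> 0}"
    using countable_subset by blast
  then show ?thesis by auto
qed

text \<open>The level sets are Boolean combinations of the balls with centres in D, and points in a common level set
share a ball as soon as the balls cover.\<close>

definition ball_pattern :: "'a::metric_space set \<Rightarrow> ('a \<Rightarrow> real) \<Rightarrow> 'a \<Rightarrow> 'a set" where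
  "ball_pattern D r y = {d\<in>D. dist d y < r d}"

lemma finite_range_ball_pattern:
  assumes "finite D" shows "finite (range (ball_pattern D r))"
  by (rule finite_subset[of _ "Pow D"]) (auto simp: ball_pattern_def assms)

lemma ball_pattern_vimage:
  assumes "S \<subseteq> D"
  shows "ball_pattern D r -` {S} = (\<Inter>d\<in>D. if d \<in> S then ball d (r d) else - ball d (r d))"
proof (intro equalityI subsetI)
  fix y assume y: "y \<in> (\<Inter>d\<in>D. if d \<in> S then ball d (r d) else - ball d (r d))"
  have "d \<in> S \<longleftrightarrow> dist d y < r d" if "d \<in> D" for d
    using INT_D[OF y that] by (cases "d \<in> S") simp_all
  then show "y \<in> ball_pattern D r -` {S}"
    using assms by (auto simp: ball_pattern_def)
qed (auto simp: ball_pattern_def)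

lemma ball_pattern_close:
  assumes cover: "UNIV = (\<Union>d\<in>D. ball d (r d))" and r: "\<And>d. r d \<le> e / 2"
    and eq: "ball_pattern D r x = ball_pattern D r y"
  shows "dist x y < e"
proof -
  have "x \<in> (\<Union>d\<in>D. ball d (r d))" using cover by blast
  then obtain d where d: "d \<in> ball_pattern D r x" by (auto simp: ball_pattern_def)
  then have "dist d x < r d" "dist d y < r d" using eq by (auto simp: ball_pattern_def)
  then show ?thesis using r[of d] dist_triangle[of x y d] by (simp add: dist_commute)
qed

lemma compact_ball_subcover:
  fixes r :: "'a::metric_space \<Rightarrow> real"
  assumes "compact (UNIV :: 'a set)" "\<And>x. 0 < r x"
  shows "\<exists>D. finite D \<and> UNIV = (\<Union>d\<in>D. ball d (r d))"
proof -
  obtain D where "finite D" "UNIV \<subseteq> (\<Union>d\<in>D. ball d (r d))"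
  proof (rule compactE_image[OF assms(1), of UNIV "\<lambda>x. ball x (r x)"])
    show "UNIV \<subseteq> (\<Union>x. ball x (r x))"
    proof
      fix x
      have "x \<in> ball x (r x)" using assms(2)[of x] by simp
      then show "x \<in> (\<Union>x. ball x (r x))" by blast
    qed
  qed simp_all
  then show ?thesis by blast
qed

section \<open>Separated sets and empirical measures\<close>

text \<open>Take a separated set of maximal cardinality. The cardinalities are bounded, since separated points
have different itineraries with respect to a finite partition into small sets. By maximality every
point stays \<delta>-close to a point of E up to time n, hence follows elements of U that contain the
\<delta>-balls around the orbit of that point.\<close>

lemma ex_separated_set:
  fixes T :: "'a::metric_space \<Rightarrow> 'a"
  assumes comp: "compact (UNIV :: 'a set)" and "0 < \<delta>"
    and U: "\<And>x. \<exists>V\<in>U. ball x \<delta> \<subseteq> V"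
  shows "\<exists>E. finite E \<and> E \<noteq> {} \<and> cov_num T U {..<n} \<le> card E \<and>
    (\<forall>x\<in>E. \<forall>y\<in>E. x \<noteq> y \<longrightarrow> (\<exists>i<n. \<delta> \<le> dist ((T ^^ i) x) ((T ^^ i) y)))"
proof -
  define sep where "sep E \<longleftrightarrow> (\<forall>x\<in>E. \<forall>y\<in>E. x \<noteq> y \<longrightarrow> (\<exists>i<n. \<delta> \<le> dist ((T ^^ i) x) ((T ^^ i) y)))" for E
  obtain D :: "'a set" where D: "finite D" "UNIV = (\<Union>d\<in>D. ball d (\<delta> / 2))"
    using compact_ball_subcover[OF comp, of "\<lambda>_. \<delta> / 2"] \<open>0 < \<delta>\<close> by auto
  \<comment> \<open>Level sets contain only points closer than \<delta> to each other, hence separate separated points.\<close>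
  define w where "w = ball_pattern D (\<lambda>_. \<delta> / 2)"
  have w_close: "dist x y < \<delta>" if "w x = w y" for x y
    using ball_pattern_close[OF D(2), of \<delta> x y] that unfolding w_def by simp
  let ?R = "range (itinerary T w {..<n})"
  have "?R \<subseteq> PiE {..<n} (\<lambda>_. range w)" by (rule range_itinerary_subset)
  moreover have "finite (PiE {..<n} (\<lambda>_. range w))"
    unfolding w_def by (intro finite_PiE finite_range_ball_pattern D) simp
  ultimately have finR: "finite ?R" by (rule finite_subset)
  have sep_bound: "finite E \<and> card E \<le> card ?R" if "sep E" for E
  proof -
    have "inj_on (itinerary T w {..<n}) E"
    proof (rule inj_onI, rule ccontr)
      fix x y assume xy: "x \<in> E" "y \<in> E" "itinerary T w {..<n} x = itinerary T w {..<n} y" "x \<noteq> y"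
      then obtain i where "i < n" "\<delta> \<le> dist ((T ^^ i) x) ((T ^^ i) y)"
        using \<open>sep E\<close> unfolding sep_def by blast
      moreover have "w ((T ^^ i) x) = w ((T ^^ i) y)"
        using xy(3) \<open>i < n\<close> unfolding itinerary_eq_iff by blast
      ultimately show False using w_close by (meson not_less)
    qed
    moreover have "itinerary T w {..<n} ` E \<subseteq> ?R" by blast
    ultimately show ?thesis using finR by (meson card_inj_on_le inj_on_finite)
  qed
  have "sep {}" by (simp add: sep_def)
  moreover have "\<forall>E. sep E \<longrightarrow> card E < Suc (card ?R)" using sep_bound unfolding less_Suc_eq_le by blast
  ultimately have "\<exists>E. sep E \<and> (\<forall>E'. sep E' \<longrightarrow> card E' \<le> card E)"
    by (rule ex_has_greatest_nat)
  then obtain E where E: "sep E" and max: "\<And>E'. sep E' \<Longrightarrow> card E' \<le> card E" by blast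
  have finE: "finite E" using sep_bound[OF E] by blast
  have near: "\<exists>x\<in>E. \<forall>i<n. dist ((T ^^ i) x) ((T ^^ i) y) < \<delta>" for y
  proof (cases "y \<in> E")
    case True
    then show ?thesis using \<open>0 < \<delta>\<close> by (intro bexI[of _ y]) simp_all
  next
    case False
    then have "card E < card (insert y E)" using finE by simp
    then have "\<not> sep (insert y E)" using max[of "insert y E"] by linarith
    then obtain x x' where x: "x \<in> insert y E" "x' \<in> insert y E" "x \<noteq> x'"
      "\<And>i. i < n \<Longrightarrow> dist ((T ^^ i) x) ((T ^^ i) x') < \<delta>"
      unfolding sep_def not_le[symmetric] by blast
    have "x = y \<or> x' = y"
    proof (rule ccontr)
      assume "\<not> (x = y \<or> x' = y)"
      then obtain i where "i < n" "\<delta> \<le> dist ((T ^^ i) x) ((T ^^ i) x')"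
        using E x(1-3) unfolding sep_def by blast
      then show False using x(4)[of i] by linarith
    qed
    then show ?thesis
    proof
      assume "x = y"
      then show ?thesis using x by (intro bexI[of _ x']) (simp_all add: dist_commute)
    next
      assume "x' = y"
      then show ?thesis using x by (intro bexI[of _ x]) simp_all
    qed
  qed
  have "\<forall>x. \<exists>V. V \<in> U \<and> ball x \<delta> \<subseteq> V" using U by blast
  then obtain u where u: "\<And>x. u x \<in> U \<and> ball x \<delta> \<subseteq> u x" by metis
  have "cov_num T U {..<n} \<le> card ((\<lambda>x. {y. \<forall>i<n. dist ((T ^^ i) x) ((T ^^ i) y) < \<delta>}) ` E)"
  proof (rule cov_num_le)
    show "\<Union>((\<lambda>x. {y. \<forall>i<n. dist ((T ^^ i) x) ((T ^^ i) y) < \<delta>}) ` E) = UNIV" using near by blast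
    fix w assume "w \<in> (\<lambda>x. {y. \<forall>i<n. dist ((T ^^ i) x) ((T ^^ i) y) < \<delta>}) ` E"
    then obtain x where w: "w = {y. \<forall>i<n. dist ((T ^^ i) x) ((T ^^ i) y) < \<delta>}" by blast
    have "u ((T ^^ i) x) \<in> U \<and> (\<forall>y\<in>w. (T ^^ i) y \<in> u ((T ^^ i) x))" if "i < n" for i
    proof -
      have "(T ^^ i) y \<in> ball ((T ^^ i) x) \<delta>" if "y \<in> w" for y
        using that \<open>i < n\<close> unfolding w by simp
      then show ?thesis using u[of "(T ^^ i) x"] by blast
    qed
    then show "\<exists>u. \<forall>i\<in>{..<n}. u i \<in> U \<and> (\<forall>x\<in>w. (T ^^ i) x \<in> u i)"
      by (intro exI[of _ "\<lambda>i. u ((T ^^ i) x)"]) simp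
  qed (use finE in simp)
  also have "\<dots> \<le> card E" by (rule card_image_le[OF finE])
  finally have "cov_num T U {..<n} \<le> card E" .
  moreover have "E \<noteq> {}" using near by blast
  ultimately show ?thesis using finE E unfolding sep_def by blast
qed

text \<open>Concavity of - p ln p, from the tangent at the mean q.\<close>

lemma sum_neg_mult_ln_le:
  fixes p :: "nat \<Rightarrow> real"
  assumes "0 < n" and p: "\<And>i. 0 \<le> p i" and q: "q = (\<Sum>i<n. p i) / real n"
  shows "(\<Sum>i<n. - (p i * ln (p i))) \<le> real n * (- (q * ln q))"
proof (cases "q = 0")
  case True
  then have "(\<Sum>i<n. p i) = 0" using q \<open>0 < n\<close> by simp
  then have "\<forall>i\<in>{..<n}. p i = 0" using p by (subst (asm) sum_nonneg_eq_0_iff) auto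
  then show ?thesis using True by simp
next
  case False
  moreover have "0 \<le> q" unfolding q using p by (simp add: sum_nonneg)
  ultimately have "0 < q" by simp
  have "- (p i * ln (p i)) \<le> - (p i * ln q) + q - p i" for i
  proof (cases "p i = 0")
    case False
    then have pi: "0 < p i" using p[of i] by simp
    have "ln (q / p i) \<le> q / p i - 1" using pi \<open>0 < q\<close> by (intro ln_le_minus_one) simp
    then have "p i * ln (q / p i) \<le> p i * (q / p i - 1)" using pi by (intro mult_left_mono) simp_all
    also have "p i * (q / p i - 1) = q - p i" using pi by (simp add: right_diff_distrib)
    also have "ln (q / p i) = ln q - ln (p i)" using pi \<open>0 < q\<close> by (simp add: ln_div)
    finally show ?thesis by (simp add: right_diff_distrib)
  qed (use \<open>0 < q\<close> in simp)
  then have "(\<Sum>i<n. - (p i * ln (p i))) \<le> (\<Sum>i<n. - (p i * ln q) + q - p i)" by (rule sum_mono)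
  also have "\<dots> = - ((\<Sum>i<n. p i) * ln q) + real n * q - (\<Sum>i<n. p i)"
    by (simp add: sum.distrib sum_subtractf sum_negf sum_distrib_right)
  also have "(\<Sum>i<n. p i) = real n * q" using q \<open>0 < n\<close> by simp
  finally show ?thesis by simp
qed

text \<open>The average over x in E of the uniform measures on the orbit segments x, T x, ..., T^(n-1) x.\<close>

definition empirical :: "('a::topological_space \<Rightarrow> 'a) \<Rightarrow> 'a set \<Rightarrow> nat \<Rightarrow> 'a measure" where
  "empirical T E n = distr (measure_pmf (pmf_of_set (E \<times> {..<n}))) borel (\<lambda>(x, i). (T ^^ i) x)"

lemma prob_space_empirical: "prob_space (empirical T E n)"
  unfolding empirical_def by (intro measure_pmf.prob_space_distr) simp

lemma sets_empirical: "sets (empirical T E n) = sets borel"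
  by (simp add: empirical_def)

context
  fixes T :: "'a::topological_space \<Rightarrow> 'a" and E :: "'a set" and n :: nat
  assumes E: "finite E" "E \<noteq> {}" and n: "0 < n"
begin

lemma integral_empirical:
  fixes f :: "'a \<Rightarrow> real"
  assumes "f \<in> borel_measurable borel"
  shows "(\<integral>x. f x \<partial>empirical T E n) = (\<Sum>x\<in>E. \<Sum>i<n. f ((T ^^ i) x)) / (real (card E) * real n)"
proof -
  have "(\<integral>x. f x \<partial>empirical T E n) = measure_pmf.expectation (pmf_of_set (E \<times> {..<n})) (\<lambda>p. f (case p of (x, i) \<Rightarrow> (T ^^ i) x))"
    unfolding empirical_def by (rule integral_distr) (simp_all add: assms)
  also have "\<dots> = (\<Sum>p\<in>E \<times> {..<n}. f (case p of (x, i) \<Rightarrow> (T ^^ i) x)) / real (card (E \<times> {..<n}))"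
    using E n by (intro integral_pmf_of_set) auto
  also have "(\<Sum>p\<in>E \<times> {..<n}. f (case p of (x, i) \<Rightarrow> (T ^^ i) x)) = (\<Sum>x\<in>E. \<Sum>i<n. f ((T ^^ i) x))"
    by (simp add: sum.cartesian_product split_def)
  finally show ?thesis by (simp add: card_cartesian_product)
qed

lemma measure_empirical:
  assumes B: "B \<in> sets borel"
  shows "measure (empirical T E n) B = (\<Sum>i<n. measure (measure_pmf (pmf_of_set E)) ((T ^^ i) -` B)) / real n"
proof -
  interpret prob_space "empirical T E n" by (rule prob_space_empirical)
  have "measure (empirical T E n) B = (\<integral>x. indicator B x \<partial>empirical T E n)"
    using B by (simp add: empirical_def)
  also have "\<dots> = (\<Sum>x\<in>E. \<Sum>i<n. indicator B ((T ^^ i) x)) / (real (card E) * real n)"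
    using B by (intro integral_empirical) simp
  also have "\<dots> = (\<Sum>i<n. \<Sum>x\<in>E. indicator B ((T ^^ i) x)) / (real (card E) * real n)"
    by (subst sum.swap) (rule refl)
  also have "\<dots> = (\<Sum>i<n. (\<Sum>x\<in>E. indicator B ((T ^^ i) x)) / real (card E)) / real n"
    by (simp add: sum_divide_distrib)
  also have "(\<lambda>i. (\<Sum>x\<in>E. indicator B ((T ^^ i) x)) / real (card E)) =
      (\<lambda>i. measure (measure_pmf (pmf_of_set E)) ((T ^^ i) -` B))"
  proof
    fix i
    have "(\<Sum>x\<in>E. indicator B ((T ^^ i) x) :: real) = real (card (E \<inter> (T ^^ i) -` B))"
      using E by (simp add: indicator_def of_bool_def sum.If_cases vimage_def)
    then show "(\<Sum>x\<in>E. indicator B ((T ^^ i) x)) / real (card E) = measure (measure_pmf (pmf_of_set E)) ((T ^^ i) -` B)"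
      using E by (simp add: measure_pmf_of_set)
  qed
  finally show ?thesis .
qed

text \<open>The empirical measure is almost invariant: the difference telescopes along each orbit segment.\<close>

lemma integral_empirical_comp:
  fixes f :: "'a \<Rightarrow> real"
  assumes f: "f \<in> borel_measurable borel" "(\<lambda>x. f (T x)) \<in> borel_measurable borel" "\<And>x. \<bar>f x\<bar> \<le> 1"
  shows "\<bar>(\<integral>x. f (T x) \<partial>empirical T E n) - (\<integral>x. f x \<partial>empirical T E n)\<bar> \<le> 2 / real n"
proof -
  have "(\<Sum>i<n. f (T ((T ^^ i) x))) - (\<Sum>i<n. f ((T ^^ i) x)) = f ((T ^^ n) x) - f x" for x
    using sum_lessThan_telescope[of "\<lambda>i. f ((T ^^ i) x)" n] by (simp add: sum_subtractf)
  then have "\<bar>(\<Sum>x\<in>E. \<Sum>i<n. f (T ((T ^^ i) x))) - (\<Sum>x\<in>E. \<Sum>i<n. f ((T ^^ i) x))\<bar> = \<bar>\<Sum>x\<in>E. f ((T ^^ n) x) - f x\<bar>"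
    by (simp add: sum_subtractf[symmetric])
  also have "\<dots> \<le> (\<Sum>x\<in>E. \<bar>f ((T ^^ n) x) - f x\<bar>)" by (rule sum_abs)
  also have "\<dots> \<le> (\<Sum>x\<in>E. 2)"
  proof (rule sum_mono)
    fix x show "\<bar>f ((T ^^ n) x) - f x\<bar> \<le> 2" using f(3)[of "(T ^^ n) x"] f(3)[of x] by linarith
  qed
  also have "\<dots> = 2 * real (card E)" by simp
  finally have le: "\<bar>(\<Sum>x\<in>E. \<Sum>i<n. f (T ((T ^^ i) x))) - (\<Sum>x\<in>E. \<Sum>i<n. f ((T ^^ i) x))\<bar> \<le> 2 * real (card E)" .
  have "0 < card E" using E by (simp add: card_gt_0_iff)
  have "(\<integral>x. f (T x) \<partial>empirical T E n) - (\<integral>x. f x \<partial>empirical T E n) =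
      ((\<Sum>x\<in>E. \<Sum>i<n. f (T ((T ^^ i) x))) - (\<Sum>x\<in>E. \<Sum>i<n. f ((T ^^ i) x))) / (real (card E) * real n)"
    by (simp add: integral_empirical[OF f(1)] integral_empirical[OF f(2)] diff_divide_distrib)
  also have "\<bar>\<dots>\<bar> \<le> 2 * real (card E) / (real (card E) * real n)"
    unfolding abs_divide abs_mult abs_of_nat by (intro divide_right_mono le) simp
  also have "\<dots> = 2 / real n" using \<open>0 < card E\<close> by simp
  finally show ?thesis .
qed

text \<open>The empirical measure is the mean of the images of the uniform measure on E under T^0, ..., T^(n-1),
and entropy is concave in the measure.\<close>

lemma sum_ent_le_ent_empirical:
  fixes X :: "'a \<Rightarrow> 'b"
  assumes fin: "finite (range X)" and meas: "\<And>v. X -` {v} \<in> sets borel"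
  shows "(\<Sum>i<n. ent (measure_pmf (pmf_of_set E)) (\<lambda>x. X ((T ^^ i) x))) \<le> real n * ent (empirical T E n) X"
proof -
  define p where "p v i = measure (measure_pmf (pmf_of_set E)) ((T ^^ i) -` (X -` {v}))" for v i
  have space: "space (empirical T E n) = UNIV" by (simp add: empirical_def)
  have ent: "ent (measure_pmf (pmf_of_set E)) (\<lambda>x. X ((T ^^ i) x)) = (\<Sum>v\<in>range X. - (p v i * ln (p v i)))" for i
  proof -
    have vim: "(\<lambda>x. X ((T ^^ i) x)) -` {v} = (T ^^ i) -` (X -` {v})" for v by auto
    have zero: "p v i = 0" if "v \<notin> range (\<lambda>x. X ((T ^^ i) x))" for v
    proof -
      have "(T ^^ i) -` (X -` {v}) = {}" using that by auto
      then show ?thesis by (simp add: p_def)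
    qed
    have "(\<Sum>v\<in>range X. - (p v i * ln (p v i))) = (\<Sum>v\<in>range (\<lambda>x. X ((T ^^ i) x)). - (p v i * ln (p v i)))"
      by (rule sum.mono_neutral_right[OF fin]) (auto simp: zero)
    then show ?thesis unfolding ent_def vim[symmetric] p_def by (simp add: sum_negf vim)
  qed
  have "(\<Sum>i<n. ent (measure_pmf (pmf_of_set E)) (\<lambda>x. X ((T ^^ i) x))) = (\<Sum>v\<in>range X. \<Sum>i<n. - (p v i * ln (p v i)))"
    unfolding ent by (rule sum.swap)
  also have "\<dots> \<le> (\<Sum>v\<in>range X. real n * (- (measure (empirical T E n) (X -` {v}) * ln (measure (empirical T E n) (X -` {v})))))"
    by (intro sum_mono sum_neg_mult_ln_le[OF n]) (simp_all add: p_def measure_empirical[OF meas])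
  also have "\<dots> = real n * ent (empirical T E n) X"
    unfolding ent_def space by (simp add: sum_distrib_left sum_negf)
  finally show ?thesis .
qed

end

section \<open>An invariant measure of large entropy\<close>

text \<open>The blocks of length q whose starting points are congruent to j tile all times from j on; the times
before j are smaller than q. Blocks that reach beyond n do no harm.\<close>

lemma residue_class_cover:
  fixes j q n :: nat
  assumes "j < q"
  shows "{..<n} \<subseteq> {..<q} \<union> (\<Union>p\<in>{p\<in>{..<n}. p mod q = j}. {p..<p + q})"
proof
  fix i assume i: "i \<in> {..<n}"
  show "i \<in> {..<q} \<union> (\<Union>p\<in>{p\<in>{..<n}. p mod q = j}. {p..<p + q})"
  proof (cases "i < q")
    case False
    \<comment> \<open>The last time up to i that is congruent to j.\<close>
    define p where "p = j + q * ((i - j) div q)"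
    have "i = p + (i - j) mod q"
      unfolding p_def using False assms div_mult_mod_eq[of "i - j" q] by (simp add: mult.commute)
    moreover have "(i - j) mod q < q" using assms by simp
    moreover have "p mod q = j" using assms by (simp add: p_def)
    ultimately have "p \<in> {p\<in>{..<n}. p mod q = j}" "i \<in> {p..<p + q}" using i by auto
    then show ?thesis by blast
  qed simp
qed

lemma simple_function_measure_pmf: "finite (range X) \<Longrightarrow> simple_function (measure_pmf p) X"
  by (rule simple_functionI_UNIV) simp_all

text \<open>The function X separates the points of E, each of which has weight 1 / card E.\<close>

lemma ln_card_le_ent_uniform:
  assumes E: "finite E" "E \<noteq> {}" and fin: "finite (range X)" and inj: "inj_on X E"
  shows "ln (real (card E)) \<le> ent (measure_pmf (pmf_of_set E)) X"
proof -
  let ?P = "\<lambda>v. measure (measure_pmf (pmf_of_set E)) (X -` {v})"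
  have "0 < card E" using E by (simp add: card_gt_0_iff)
  have P: "?P (X x) = 1 / real (card E)" if "x \<in> E" for x
  proof -
    have "E \<inter> X -` {X x} = {x}" using inj that by (auto simp: inj_on_def)
    then show ?thesis using E by (simp add: measure_pmf_of_set)
  qed
  have nonneg: "0 \<le> - (?P v * ln (?P v))" for v
    by (rule prob_space.neg_prob_ln_prob_nonneg[OF prob_space_measure_pmf])
  have "ln (real (card E)) = (\<Sum>x\<in>E. - (1 / real (card E) * ln (1 / real (card E))))"
    using \<open>0 < card E\<close> by (simp add: ln_div)
  also have "\<dots> = (\<Sum>x\<in>E. - (?P (X x) * ln (?P (X x))))"
    by (rule sum.cong) (simp_all only: P)
  also have "\<dots> = (\<Sum>v\<in>X ` E. - (?P v * ln (?P v)))"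
    by (simp add: sum.reindex[OF inj])
  also have "\<dots> \<le> (\<Sum>v\<in>range X. - (?P v * ln (?P v)))"
    by (rule sum_mono2[OF fin]) (use nonneg in auto)
  also have "\<dots> = ent (measure_pmf (pmf_of_set E)) X"
    by (simp add: ent_def sum_negf)
  finally show ?thesis .
qed

text \<open>Misiurewicz's counting argument. For each residue j < q, the itinerary up to time n is determined by
the first q symbols and by the blocks of length q that start at the times congruent to j. Adding up
these q estimates, every starting time p < n occurs once, and concavity replaces the sum over p by
the entropy with respect to the empirical measure. The first q symbols cost a constant that depends
neither on n nor on E.\<close>

lemma ln_card_separated_le:
  fixes T :: "'a::topological_space \<Rightarrow> 'a"
  assumes E: "finite E" "E \<noteq> {}" and n: "0 < n" and q: "0 < q"
    and T: "T \<in> measurable borel borel" and f: "simple_function borel f"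
    and inj: "inj_on (itinerary T f {..<n}) E"
  shows "real q * ln (real (card E)) \<le> real q * ln (real (card (PiE {..<q} (\<lambda>_. range f)))) +
    real n * ent (empirical T E n) (itinerary T f {..<q})"
proof -
  let ?S = "measure_pmf (pmf_of_set E)" and ?I = "itinerary T f"
  let ?C = "ln (real (card (PiE {..<q} (\<lambda>_. range f))))"
  have fin_f: "finite (range f)" using f by (simp add: simple_function_def)
  note ent_le_ln_card = prob_space.ent_le_ln_card[OF prob_space_measure_pmf]
    and ent_mono = prob_space.ent_mono[OF prob_space_measure_pmf]
    and ent_itinerary_UN_le = prob_space.ent_itinerary_UN_le[OF prob_space_measure_pmf]
  have T': "T \<in> measurable ?S ?S" by simp
  have sf: "simple_function ?S f" using fin_f by (rule simple_function_measure_pmf)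
  have sf_I: "simple_function ?S (?I F)" if "finite F" for F
    using T' sf that by (intro simple_function_itinerary) simp_all
  have fin_I: "finite (range (?I F))" if "finite F" for F
    using sf_I[OF that] by (simp add: simple_function_def)
  have C: "ent ?S (?I {..<q}) \<le> ?C"
  proof -
    have sub: "range (?I {..<q}) \<subseteq> PiE {..<q} (\<lambda>_. range f)" by (rule range_itinerary_subset)
    have fin: "finite (PiE {..<q} (\<lambda>_. range f))" using fin_f by (intro finite_PiE) simp_all
    have "ent ?S (?I {..<q}) \<le> ln (real (card (range (?I {..<q}))))"
      using ent_le_ln_card[OF sf_I[of "{..<q}"]] by simp
    also have "\<dots> \<le> ?C"
    proof (rule ln_mono)
      show "0 < real (card (range (?I {..<q})))" using fin_I[of "{..<q}"] by (simp add: card_gt_0_iff)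
      show "real (card (range (?I {..<q}))) \<le> real (card (PiE {..<q} (\<lambda>_. range f)))"
        using card_mono[OF fin sub] by simp
    qed
    finally show ?thesis .
  qed
  have shift: "ent ?S (?I {p..<p + q}) \<le> ent ?S (\<lambda>x. ?I {..<q} ((T ^^ p) x))" for p
  proof (rule ent_mono)
    have "finite (range (\<lambda>x. ?I {..<q} ((T ^^ p) x)))"
      by (rule finite_subset[OF _ fin_I[of "{..<q}"]]) auto
    then show "simple_function ?S (\<lambda>x. ?I {..<q} ((T ^^ p) x))" by (rule simple_function_measure_pmf)
    fix x y assume eq: "?I {..<q} ((T ^^ p) x) = ?I {..<q} ((T ^^ p) y)"
    show "?I {p..<p + q} x = ?I {p..<p + q} y"
      unfolding itinerary_eq_iff
    proof
      fix i assume i: "i \<in> {p..<p + q}"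
      then have "i - p \<in> {..<q}" by auto
      with eq have "f ((T ^^ (i - p)) ((T ^^ p) x)) = f ((T ^^ (i - p)) ((T ^^ p) y))"
        unfolding itinerary_eq_iff by blast
      moreover have "T ^^ i = T ^^ (i - p) \<circ> T ^^ p" using i by (simp flip: funpow_add)
      ultimately show "f ((T ^^ i) x) = f ((T ^^ i) y)" by simp
    qed
  qed
  have step: "ln (real (card E)) \<le> ?C + (\<Sum>p\<in>{p\<in>{..<n}. p mod q = j}. ent ?S (\<lambda>x. ?I {..<q} ((T ^^ p) x)))"
    if "j < q" for j
  proof -
    let ?P = "{p\<in>{..<n}. p mod q = j}"
    have "ln (real (card E)) \<le> ent ?S (?I {..<n})"
      using E fin_I inj by (intro ln_card_le_ent_uniform) simp_all
    also have "\<dots> \<le> ent ?S (?I ({..<q} \<union> (\<Union>p\<in>?P. {p..<p + q})))"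
      by (rule ent_mono[OF sf_I]) (auto intro: itinerary_eq_subset[OF residue_class_cover[OF that]])
    also have "\<dots> \<le> ent ?S (?I {..<q}) + (\<Sum>p\<in>?P. ent ?S (?I {p..<p + q}))"
      by (rule ent_itinerary_UN_le[OF T' _ sf]) simp_all
    also have "\<dots> \<le> ?C + (\<Sum>p\<in>?P. ent ?S (\<lambda>x. ?I {..<q} ((T ^^ p) x)))"
      by (intro add_mono C sum_mono shift)
    finally show ?thesis .
  qed
  have "real q * ln (real (card E)) = (\<Sum>j<q. ln (real (card E)))" by simp
  also have "\<dots> \<le> (\<Sum>j<q. ?C + (\<Sum>p\<in>{p\<in>{..<n}. p mod q = j}. ent ?S (\<lambda>x. ?I {..<q} ((T ^^ p) x))))"
    by (intro sum_mono step) simp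
  also have "\<dots> = real q * ?C + (\<Sum>j<q. \<Sum>p\<in>{p\<in>{..<n}. p mod q = j}. ent ?S (\<lambda>x. ?I {..<q} ((T ^^ p) x)))"
    by (simp add: sum.distrib)
  also have "(\<Sum>j<q. \<Sum>p\<in>{p\<in>{..<n}. p mod q = j}. ent ?S (\<lambda>x. ?I {..<q} ((T ^^ p) x))) =
      (\<Sum>p<n. ent ?S (\<lambda>x. ?I {..<q} ((T ^^ p) x)))"
    using q by (intro sum.group) auto
  also have "\<dots> \<le> real n * ent (empirical T E n) (?I {..<q})"
  proof (rule sum_ent_le_ent_empirical[OF E n])
    have "simple_function borel (?I {..<q})"
      by (rule simple_function_itinerary[OF T f]) simp_all
    from simple_function_vimage_UNIV[OF _ this]
    show "finite (range (?I {..<q}))" "\<And>v. ?I {..<q} -` {v} \<in> sets borel" by simp_all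
  qed
  finally show ?thesis by simp
qed

text \<open>Continuity of p ln p on the nonnegative reals, where ln 0 = 0 gives the right value at 0.\<close>

lemma tendsto_mult_ln:
  fixes p :: "nat \<Rightarrow> real"
  assumes p: "p \<longlonglongrightarrow> l" and nn: "\<And>k. 0 \<le> p k"
  shows "(\<lambda>k. p k * ln (p k)) \<longlonglongrightarrow> l * ln l"
proof (cases "l = 0")
  case True
  have "(\<lambda>k. - (2 * sqrt (p k))) \<longlonglongrightarrow> - (2 * sqrt 0)" "(\<lambda>k. p k * p k) \<longlonglongrightarrow> 0 * 0"
    using p unfolding True by (intro tendsto_intros; simp)+
  then have lim: "(\<lambda>k. - (2 * sqrt (p k))) \<longlonglongrightarrow> 0" "(\<lambda>k. p k * p k) \<longlonglongrightarrow> 0" by simp_all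
  have "(\<lambda>k. p k * ln (p k)) \<longlonglongrightarrow> 0"
  proof (rule tendsto_sandwich[OF _ _ lim])
    show "\<forall>\<^sub>F k in sequentially. - (2 * sqrt (p k)) \<le> p k * ln (p k)"
      using neg_mult_ln_le_2_sqrt[OF nn] by (intro always_eventually allI) (simp add: minus_le_iff)
    have "p k * ln (p k) \<le> p k * p k" for k
    proof (cases "p k = 0")
      case False
      then have "0 < p k" using nn[of k] by simp
      then have "ln (p k) \<le> p k" using ln_le_minus_one[of "p k"] by simp
      then show ?thesis using nn by (intro mult_left_mono)
    qed simp
    then show "\<forall>\<^sub>F k in sequentially. p k * ln (p k) \<le> p k * p k" by (intro always_eventually allI)
  qed
  then show ?thesis using True by simp
next
  case False
  then show ?thesis using p by (intro tendsto_intros)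
qed

lemma ent_tendsto:
  assumes fin: "finite (range X)" and space: "\<And>k. space (N k) = UNIV" "space M = UNIV"
    and lim: "\<And>v. v \<in> range X \<Longrightarrow> (\<lambda>k. measure (N k) (X -` {v})) \<longlonglongrightarrow> measure M (X -` {v})"
  shows "(\<lambda>k. ent (N k) X) \<longlonglongrightarrow> ent M X"
  unfolding ent_def space Int_UNIV_right
  by (intro tendsto_minus tendsto_sum tendsto_mult_ln lim measure_nonneg)

text \<open>Cover the space by finitely many small balls with null spheres, and take the pattern of membership.\<close>

lemma ex_jordan_partition:
  fixes M :: "'a::metric_space measure"
  assumes comp: "compact (UNIV :: 'a set)" and M: "prob_space M" "sets M = sets borel" and "0 < \<delta>"
  shows "\<exists>f :: 'a \<Rightarrow> 'a set. simple_function borel f \<and> (\<forall>S\<in>range f. jordan_set M (f -` {S})) \<and>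
    (\<forall>x y. f x = f y \<longrightarrow> dist x y < \<delta>)"
proof -
  have "\<exists>r. \<delta> / 4 < r \<and> r < \<delta> / 2 \<and> measure M {y. dist x y = r} = 0" for x :: 'a
    using \<open>0 < \<delta>\<close> by (intro ex_null_sphere[OF M]) simp
  then obtain r where r: "\<And>x. \<delta> / 4 < r x" "\<And>x. r x < \<delta> / 2" "\<And>x. measure M {y. dist x y = r x} = 0"
    by metis
  have rpos: "0 < r x" for x using r(1)[of x] \<open>0 < \<delta>\<close> by linarith
  have "\<exists>D. finite D \<and> UNIV = (\<Union>d\<in>D. ball d (r d))"
    by (rule compact_ball_subcover[OF comp rpos])
  then obtain D where D: "finite D" "UNIV = (\<Union>d\<in>D. ball d (r d))"
    by (elim exE conjE)
  define f where "f = ball_pattern D r"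
  have vim: "f -` {S} = (\<Inter>d\<in>D. if d \<in> S then ball d (r d) else - ball d (r d))" if "S \<in> range f" for S
    unfolding f_def by (rule ball_pattern_vimage) (use that in \<open>auto simp: f_def ball_pattern_def\<close>)
  have "simple_function borel f"
  proof (rule simple_functionI_UNIV)
    show "finite (range f)" unfolding f_def by (rule finite_range_ball_pattern[OF D(1)])
    fix S assume S: "S \<in> range f"
    have "(\<Inter>d\<in>D. if d \<in> S then ball d (r d) else - ball d (r d)) \<in> sets borel"
    proof (cases "D = {}")
      case False
      then show ?thesis using D(1) by (intro sets.finite_INT) auto
    qed simp
    then show "f -` {S} \<in> sets borel" unfolding vim[OF S] .
  qed simp
  moreover have "jordan_set M (f -` {S})" if "S \<in> range f" for S
    unfolding vim[OF that]
    using jordan_set_ball[OF M r(3)] jordan_set_Compl[OF jordan_set_ball[OF M r(3)]]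
    by (intro jordan_set_INT[OF M D(1)]) (simp split: if_split)
  moreover have "dist x y < \<delta>" if "f x = f y" for x y
    using ball_pattern_close[OF D(2) less_imp_le[OF r(2)]] that unfolding f_def by blast
  ultimately show ?thesis by blast
qed

text \<open>The half of the variational principle that constructs a measure. The separated sets are chosen at
times m k at which the covering numbers exceed exp (c m k). A weak limit \<mu> of the empirical
measures along these times is invariant, and for a partition of small mesh whose atoms have null
boundary with respect to \<mu> the estimate for separated sets passes to the limit, for every q.\<close>

theorem ex_invariant_measure_entropy_ge:
  fixes T :: "'a::metric_space \<Rightarrow> 'a"
  assumes comp: "compact (UNIV :: 'a set)" and T: "continuous_on UNIV T"
    and U: "U \<in> finite_open_covers" and c: "ereal c < top_seq_entropy_cover (\<lambda>n. n - 1) T U"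
  shows "\<exists>\<mu>\<in>invariant_prob_measures T. \<exists>f :: 'a \<Rightarrow> 'a set. simple_function \<mu> f \<and>
    (\<forall>q. c * real q \<le> ent \<mu> (itinerary T f {..<q}))"
proof -
  interpret cover_system T U using U by (rule finite_open_covers_system)
  have T_meas: "T \<in> measurable borel borel" by (rule borel_measurable_continuous_onI[OF T])
  obtain \<delta> where \<delta>: "0 < \<delta>" "\<And>x. \<exists>V\<in>U. ball x \<delta> \<subseteq> V"
  proof (rule Heine_Borel_lemma[OF comp])
    show "UNIV \<subseteq> \<Union>U" "\<And>V. V \<in> U \<Longrightarrow> open V" using U by (auto simp: finite_open_covers_def)
  qed (use that in auto)
  define S where "S = {n. 0 < n \<and> c * real n < lnN {..<n}}"
  \<comment> \<open>The growth rate of the covering numbers is a limit superior, so c is exceeded along a subsequence.\<close>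
  have "infinite S"
  proof
    assume "finite S"
    then obtain N where N: "\<And>n. n \<in> S \<Longrightarrow> n \<le> N" unfolding finite_nat_set_iff_bounded_le by blast
    have "\<forall>\<^sub>F n in sequentially. ereal (lnN {..<n} / real n) \<le> ereal c"
    proof (rule eventually_sequentiallyI[of "Suc N"])
      fix n assume n: "Suc N \<le> n"
      then have "n \<notin> S" using N[of n] by auto
      then show "ereal (lnN {..<n} / real n) \<le> ereal c" using n by (simp add: S_def divide_le_eq not_less)
    qed
    then have "top_seq_entropy_cover (\<lambda>n. n - 1) T U \<le> ereal c"
      unfolding entropy_cover_eq by (rule Limsup_bounded)
    then show False using c by simp
  qed
  from infinite_enumerate[OF this] obtain m :: "nat \<Rightarrow> nat" where m: "strict_mono m" "\<And>k. m k \<in> S"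
    by blast
  have mpos: "0 < m k" for k using m(2)[of k] by (simp add: S_def)
  have "\<exists>E. finite E \<and> E \<noteq> {} \<and> cov_num T U {..<m k} \<le> card E \<and>
    (\<forall>x\<in>E. \<forall>y\<in>E. x \<noteq> y \<longrightarrow> (\<exists>i<m k. \<delta> \<le> dist ((T ^^ i) x) ((T ^^ i) y)))" for k
    by (rule ex_separated_set[OF comp \<delta>])
  then obtain E where E: "\<And>k. finite (E k)" "\<And>k. E k \<noteq> {}" "\<And>k. cov_num T U {..<m k} \<le> card (E k)"
    "\<And>k. \<forall>x\<in>E k. \<forall>y\<in>E k. x \<noteq> y \<longrightarrow> (\<exists>i<m k. \<delta> \<le> dist ((T ^^ i) x) ((T ^^ i) y))"
    by metis
  define \<nu> where "\<nu> k = empirical T (E k) (m k)" for k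
  have \<nu>: "prob_space (\<nu> k)" "sets (\<nu> k) = sets borel" for k
    unfolding \<nu>_def by (rule prob_space_empirical, rule sets_empirical)
  from compact_prob_weakly_convergent_subsequence[where \<nu>=\<nu>, OF comp \<nu>]
  obtain r \<mu> where r: "strict_mono r" and \<mu>: "prob_space \<mu>" "sets \<mu> = sets borel"
    and conv: "\<And>f :: 'a \<Rightarrow> real. continuous_on UNIV f \<Longrightarrow> (\<lambda>n. \<integral>x. f x \<partial>\<nu> (r n)) \<longlonglongrightarrow> (\<integral>x. f x \<partial>\<mu>)"
    by blast
  have mr: "strict_mono (m \<circ> r)" using m(1) r by (rule strict_mono_o)
  have over_m: "(\<lambda>k. a / real (m (r k))) \<longlonglongrightarrow> 0" for a :: real
    using LIMSEQ_subseq_LIMSEQ[OF lim_const_over_n[of a] mr] by (simp add: o_def)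
  have T_meas_\<mu>: "T \<in> measurable \<mu> borel" unfolding measurable_cong_sets[OF \<mu>(2) refl] by (rule T_meas)
  have inv: "distr \<mu> borel T = \<mu>"
  proof (rule prob_eqI_continuous[OF prob_space.prob_space_distr[OF \<mu>(1) T_meas_\<mu>] _ \<mu>])
    fix f :: "'a \<Rightarrow> real" assume f: "continuous_on UNIV f" "\<And>x. \<bar>f x\<bar> \<le> 1"
    have fT: "continuous_on UNIV (\<lambda>x. f (T x))" by (rule continuous_on_compose2[OF f(1) T]) simp
    have "(\<lambda>k. (\<integral>x. f (T x) \<partial>\<nu> (r k)) - (\<integral>x. f x \<partial>\<nu> (r k))) \<longlonglongrightarrow> (\<integral>x. f (T x) \<partial>\<mu>) - (\<integral>x. f x \<partial>\<mu>)"
      by (intro tendsto_diff conv f(1) fT)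
    moreover have "(\<lambda>k. (\<integral>x. f (T x) \<partial>\<nu> (r k)) - (\<integral>x. f x \<partial>\<nu> (r k))) \<longlonglongrightarrow> 0"
    proof (rule Lim_null_comparison[OF _ over_m[of 2]])
      show "\<forall>\<^sub>F k in sequentially. norm ((\<integral>x. f (T x) \<partial>\<nu> (r k)) - (\<integral>x. f x \<partial>\<nu> (r k))) \<le> 2 / real (m (r k))"
        unfolding \<nu>_def real_norm_def
        by (intro always_eventually allI integral_empirical_comp E mpos f(2)
            borel_measurable_continuous_onI f(1) fT)
    qed
    ultimately have "(\<integral>x. f (T x) \<partial>\<mu>) - (\<integral>x. f x \<partial>\<mu>) = 0" by (rule LIMSEQ_unique)
    moreover have "(\<integral>x. f x \<partial>distr \<mu> borel T) = (\<integral>x. f (T x) \<partial>\<mu>)"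
      by (rule integral_distr[OF T_meas_\<mu> borel_measurable_continuous_onI[OF f(1)]])
    ultimately show "(\<integral>x. f x \<partial>distr \<mu> borel T) = (\<integral>x. f x \<partial>\<mu>)" by simp
  qed simp
  obtain f :: "'a \<Rightarrow> 'a set" where f: "simple_function borel f" "\<And>S. S \<in> range f \<Longrightarrow> jordan_set \<mu> (f -` {S})"
    "\<And>x y. f x = f y \<Longrightarrow> dist x y < \<delta>"
    using ex_jordan_partition[OF comp \<mu> \<delta>(1)] by blast
  have space: "space \<mu> = UNIV" "\<And>k. space (\<nu> k) = UNIV"
    using sets_eq_imp_space_eq[OF \<mu>(2)] sets_eq_imp_space_eq[OF \<nu>(2)] by simp_all
  have "c * real q \<le> ent \<mu> (itinerary T f {..<q})" for q
  proof (cases "q = 0")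
    case True
    then show ?thesis using prob_space.ent_nonneg[OF \<mu>(1)] by simp
  next
    case False
    let ?I = "itinerary T f {..<q}"
    let ?C = "ln (real (card (PiE {..<q} (\<lambda>_. range f))))"
    have sf_I: "simple_function borel ?I" by (rule simple_function_itinerary[OF T_meas f(1)]) simp_all
    have I_borel: "?I -` {v} \<in> sets borel" "finite (range ?I)" for v
      using simple_function_vimage_UNIV[OF _ sf_I] by simp_all
    have le: "c * real q \<le> real q * ?C / real (m k) + ent (\<nu> k) ?I" for k
    proof -
      have "inj_on (itinerary T f {..<m k}) (E k)"
      proof (rule inj_onI, rule ccontr)
        fix x y assume xy: "x \<in> E k" "y \<in> E k" "itinerary T f {..<m k} x = itinerary T f {..<m k} y" "x \<noteq> y"
        then obtain i where i: "i < m k" "\<delta> \<le> dist ((T ^^ i) x) ((T ^^ i) y)" using E(4)[of k] by blast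
        have "f ((T ^^ i) x) = f ((T ^^ i) y)" using xy(3) i(1) unfolding itinerary_eq_iff by blast
        from f(3)[OF this] i(2) show False by simp
      qed
      from ln_card_separated_le[OF E(1,2) mpos _ T_meas f(1) this, of q] False
      have 1: "real q * ln (real (card (E k))) \<le> real q * ?C + real (m k) * ent (\<nu> k) ?I"
        by (simp add: \<nu>_def)
      have "c * real (m k) \<le> lnN {..<m k}" using m(2)[of k] by (simp add: S_def)
      also have "\<dots> \<le> ln (real (card (E k)))"
        unfolding lnN_def using cov_num_pos[of "{..<m k}"] E(3)[of k] by (intro ln_mono) simp_all
      finally have "real q * (c * real (m k)) \<le> real q * ln (real (card (E k)))"
        by (intro mult_left_mono) simp_all
      with 1 have "c * real q * real (m k) \<le> real q * ?C + real (m k) * ent (\<nu> k) ?I"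
        by (simp add: algebra_simps)
      then have "c * real q \<le> (real q * ?C + real (m k) * ent (\<nu> k) ?I) / real (m k)"
        using mpos[of k] by (simp add: pos_le_divide_eq)
      also have "\<dots> = real q * ?C / real (m k) + ent (\<nu> k) ?I"
        using mpos[of k] by (simp add: add_divide_distrib)
      finally show ?thesis .
    qed
    have "(\<lambda>k. ent (\<nu> (r k)) ?I) \<longlonglongrightarrow> ent \<mu> ?I"
    proof (rule ent_tendsto[OF I_borel(2) space(2,1)])
      fix v assume "v \<in> range ?I"
      then obtain x where v: "v = ?I x" by blast
      have vim: "?I -` {v} = (\<Inter>i\<in>{..<q}. (T ^^ i) -` (f -` {f ((T ^^ i) x)}))"
        unfolding v by (auto simp: itinerary_eq_iff)
      have "jordan_set \<mu> (?I -` {v})"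
        unfolding vim
        by (intro jordan_set_INT[OF \<mu>] jordan_set_vimage_funpow[OF \<mu>(2) T inv] f(2)) simp_all
      then show "(\<lambda>k. measure (\<nu> (r k)) (?I -` {v})) \<longlonglongrightarrow> measure \<mu> (?I -` {v})"
        using I_borel(1) by (intro jordan_set_measure_tendsto[OF \<mu> \<nu> conv])
    qed
    then have "(\<lambda>k. real q * ?C / real (m (r k)) + ent (\<nu> (r k)) ?I) \<longlonglongrightarrow> 0 + ent \<mu> ?I"
      by (intro tendsto_add over_m)
    then have "c * real q \<le> 0 + ent \<mu> ?I" by (rule LIMSEQ_le_const) (use le in blast)
    then show ?thesis by simp
  qed
  moreover have "simple_function \<mu> f"
    using f(1) unfolding simple_function_def \<mu>(2) space(1) by simp
  moreover have "\<mu> \<in> invariant_prob_measures T"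
    using \<mu> inv by (simp add: invariant_prob_measures_def)
  ultimately show ?thesis by blast
qed

section \<open>Sequence entropy is at least K times topological entropy\<close>

context borel_system
begin

lemma level_sets_finite_borel_partition:
  assumes f: "simple_function M f"
  shows "level_sets f \<in> finite_borel_partitions"
  using partition_on_level_sets[of f] simple_function_vimage_UNIV[OF space_UNIV f] sets
  by (auto simp: finite_borel_partitions_def level_sets_def)

lemma meas_seq_entropy_ge:
  assumes f: "simple_function M f"
    and lower: "\<And>n. ereal (x n) \<le> ereal (H f (A ` {1..n}) / real n)"
  shows "limsup (\<lambda>n. ereal (x n)) \<le> meas_seq_entropy M A T"
proof -
  have "limsup (\<lambda>n. ereal (x n)) \<le> meas_seq_entropy_partition M A T (level_sets f)"
    unfolding meas_seq_entropy_partition_def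
    using lower by (intro Limsup_mono always_eventually allI) (simp add: partition_entropy_level_sets[OF f])
  also have "\<dots> \<le> meas_seq_entropy M A T"
    unfolding meas_seq_entropy_def by (rule SUP_upper[OF level_sets_finite_borel_partition[OF f]])
  finally show ?thesis .
qed

lemma meas_seq_entropy_nonneg: "0 \<le> meas_seq_entropy M A T"
proof -
  have "limsup (\<lambda>n. ereal 0) \<le> meas_seq_entropy M A T"
    by (rule meas_seq_entropy_ge[of "\<lambda>_. ()"]) (simp_all add: H_def ent_nonneg)
  then show ?thesis by (simp add: Limsup_const zero_ereal_def)
qed

text \<open>Refine f to its itinerary over the times 0, ..., m - 1. The join of this partition over t_1, ..., t_n
is the join of f over S_A(n, m), which carries entropy at least c per time.\<close>

lemma meas_seq_entropy_ge_K:
  assumes f: "simple_function M f" and "0 \<le> c"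
    and lower: "\<And>q. c * real q \<le> H f {..<q}"
  shows "ereal c * K_const A \<le> meas_seq_entropy M A T"
proof -
  have "ereal c * K_part A m \<le> meas_seq_entropy M A T" for m
  proof -
    let ?g = "itinerary T f {..<m}"
    have g: "simple_function M ?g" by (rule sf_itinerary[OF f]) simp
    have "c * real (card (sumset_SA A n m)) \<le> H ?g (A ` {1..n})" for n
    proof -
      have "c * real (card (sumset_SA A n m)) \<le> H f (sumset_SA A n m)"
        by (rule H_ge_card[OF f lower finite_sumset_SA])
      also have "\<dots> \<le> H ?g (A ` {1..n})"
        unfolding H_def
      proof (rule ent_mono[OF sf_itinerary[OF g]])
        fix x y assume eq: "itinerary T ?g (A ` {1..n}) x = itinerary T ?g (A ` {1..n}) y"
        show "itinerary T f (sumset_SA A n m) x = itinerary T f (sumset_SA A n m) y"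
          unfolding itinerary_eq_iff
        proof
          fix s assume "s \<in> sumset_SA A n m"
          then obtain i j where ij: "i \<in> {1..n}" "j < m" "s = A i + j"
            unfolding sumset_SA_def by auto
          have "?g ((T ^^ A i) x) = ?g ((T ^^ A i) y)"
            using eq ij(1) unfolding itinerary_eq_iff[where f="?g"] by blast
          then have "f ((T ^^ j) ((T ^^ A i) x)) = f ((T ^^ j) ((T ^^ A i) y))"
            using ij(2) unfolding itinerary_eq_iff by blast
          moreover have "T ^^ s = T ^^ j \<circ> T ^^ A i"
            unfolding ij(3) by (simp add: funpow_add[symmetric] add.commute)
          ultimately show "f ((T ^^ s) x) = f ((T ^^ s) y)" by simp
        qed
      qed simp
      finally show ?thesis .
    qed
    then have "limsup (\<lambda>n. ereal (c * real (card (sumset_SA A n m)) / real n)) \<le> meas_seq_entropy M A T"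
      by (intro meas_seq_entropy_ge[OF g]) (simp add: divide_right_mono)
    then show ?thesis
      unfolding K_part_def by (simp only: limsup_cmult_ereal[OF \<open>0 \<le> c\<close>])
  qed
  then have "(SUP m. ereal c * K_part A m) \<le> meas_seq_entropy M A T" by (rule SUP_least)
  also have "(SUP m. ereal c * K_part A m) = ereal c * K_const A"
    unfolding K_const_eq_SUP using \<open>0 \<le> c\<close> by (intro SUP_ereal_mult_left) (simp_all add: K_part_nonneg)
  finally show ?thesis .
qed

end

text \<open>The entropy u of a finite cover is finite, so u is approximated by c < u; the supremum over all covers
then gives the topological entropy, infinite or not.\<close>

theorem K_mult_top_entropy_le:
  fixes T :: "'a::metric_space \<Rightarrow> 'a"
  assumes comp: "compact (UNIV :: 'a set)" and T: "continuous_on UNIV T"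
  shows "K_const A * top_entropy T \<le> (SUP \<mu>\<in>invariant_prob_measures T. meas_seq_entropy \<mu> A T)"
    (is "_ \<le> ?Z")
proof -
  have c_le: "ereal c * K_const A \<le> ?Z"
    if U: "U \<in> finite_open_covers" and c: "0 \<le> c" "ereal c < top_seq_entropy_cover (\<lambda>n. n - 1) T U" for U c
  proof -
    obtain \<mu> and f :: "'a \<Rightarrow> 'a set" where \<mu>: "\<mu> \<in> invariant_prob_measures T" and f: "simple_function \<mu> f"
      "\<And>q. c * real q \<le> ent \<mu> (itinerary T f {..<q})"
      using ex_invariant_measure_entropy_ge[OF comp T U c(2)] by blast
    interpret borel_system \<mu> T using \<mu> T by (rule invariant_prob_measures_system)
    have "ereal c * K_const A \<le> meas_seq_entropy \<mu> A T"
      using f c(1) by (intro meas_seq_entropy_ge_K) (simp_all add: H_def)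
    also have "\<dots> \<le> ?Z" using \<mu> by (rule SUP_upper)
    finally show ?thesis .
  qed
  have Z: "0 \<le> ?Z"
  proof -
    interpret cover_system T "{UNIV}" using UNIV_cover by (rule finite_open_covers_system)
    \<comment> \<open>The supremum is over a nonempty set: even the trivial cover yields an invariant measure.\<close>
    have "ereal (-1) < top_seq_entropy_cover (\<lambda>n. n - 1) T {UNIV}"
      by (rule less_le_trans[OF _ top_seq_entropy_cover_nonneg]) simp
    then obtain \<mu> where \<mu>: "\<mu> \<in> invariant_prob_measures T"
      using ex_invariant_measure_entropy_ge[OF comp T UNIV_cover] by blast
    interpret M: borel_system \<mu> T using \<mu> T by (rule invariant_prob_measures_system)
    have "0 \<le> meas_seq_entropy \<mu> A T"
      by (rule M.meas_seq_entropy_nonneg)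
    also have "\<dots> \<le> ?Z" using \<mu> by (rule SUP_upper)
    finally show ?thesis .
  qed
  have U_le: "K_const A * top_seq_entropy_cover (\<lambda>n. n - 1) T U \<le> ?Z" if U: "U \<in> finite_open_covers" for U
  proof -
    interpret cover_system T U using U by (rule finite_open_covers_system)
    have "0 \<le> top_seq_entropy_cover (\<lambda>n. n - 1) T U"
      "top_seq_entropy_cover (\<lambda>n. n - 1) T U \<le> ereal (ln (real (card U)))"
      by (rule top_seq_entropy_cover_nonneg, rule entropy_cover_le_ln_card)
    then obtain u where u: "top_seq_entropy_cover (\<lambda>n. n - 1) T U = ereal u" "0 \<le> u"
      by (cases "top_seq_entropy_cover (\<lambda>n. n - 1) T U") auto
    have c_le': "ereal c * K_const A \<le> ?Z" if "0 \<le> c" "c < u" for c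
      using that by (intro c_le[OF U]) (simp_all only: u(1) ereal_less_eq less_ereal.simps)
    show ?thesis
    proof (cases "u = 0")
      case True
      then show ?thesis using Z unfolding u(1) by (simp add: zero_ereal_def[symmetric])
    next
      case False
      then have "0 < u" using u(2) by simp
      show ?thesis
      proof (cases "K_const A")
        case PInf
        have "\<infinity> = ereal (u / 2) * K_const A" using \<open>0 < u\<close> PInf by simp
        also have "\<dots> \<le> ?Z" using \<open>0 < u\<close> by (intro c_le') simp_all
        finally have "\<infinity> \<le> ?Z" .
        then show ?thesis by (rule order_trans[rotated]) simp
      next
        case MInf
        then show ?thesis using K_const_nonneg[of A] by simp
      next
        case (real k)
        then have "0 \<le> k" using K_const_nonneg[of A] by simp
        show ?thesis
        proof (rule ereal_le_epsilon2)
          fix e :: real assume "0 < e"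
          \<comment> \<open>The denominator k + 1 instead of k keeps the choice meaningful for k = 0.\<close>
          define c where "c = max 0 (u - e / (k + 1))"
          have "0 \<le> c" "c < u" using \<open>0 < u\<close> \<open>0 < e\<close> \<open>0 \<le> k\<close> by (auto simp: c_def)
          then have "ereal (c * k) \<le> ?Z" using c_le'[of c] unfolding real by simp
          moreover have "k * u \<le> c * k + e"
          proof -
            have "u - c \<le> e / (k + 1)" by (simp add: c_def)
            then have "k * (u - c) \<le> k * (e / (k + 1))" using \<open>0 \<le> k\<close> by (rule mult_left_mono)
            also have "\<dots> \<le> e" using \<open>0 \<le> k\<close> \<open>0 < e\<close> by (simp add: divide_le_eq algebra_simps)
            finally show ?thesis by (simp add: algebra_simps)
          qed
          then have "ereal (k * u) \<le> ereal (c * k) + ereal e" by simp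
          ultimately have "ereal (k * u) \<le> ?Z + ereal e" by (meson add_right_mono order_trans)
          then show "K_const A * top_seq_entropy_cover (\<lambda>n. n - 1) T U \<le> ?Z + ereal e"
            unfolding u(1) real by simp
        qed
      qed
    qed
  qed
  have "K_const A * top_entropy T = (SUP U\<in>finite_open_covers. K_const A * top_seq_entropy_cover (\<lambda>n. n - 1) T U)"
    unfolding top_entropy_def top_seq_entropy_def
  proof (rule SUP_ereal_mult_left[symmetric])
    show "(finite_open_covers :: 'a set set set) \<noteq> {}" using UNIV_cover by blast
    show "0 \<le> K_const A" by (rule K_const_nonneg)
    fix U :: "'a set set" assume "U \<in> finite_open_covers"
    then interpret cover_system T U by (rule finite_open_covers_system)
    show "0 \<le> top_seq_entropy_cover (\<lambda>n. n - 1) T U" by (rule top_seq_entropy_cover_nonneg)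
  qed
  also have "\<dots> \<le> ?Z" using U_le by (rule SUP_least)
  finally show ?thesis .
qed

theorem theorem1p6:
  fixes T :: "'a::metric_space \<Rightarrow> 'a" and A :: "nat \<Rightarrow> nat"
  assumes "compact (UNIV :: 'a set)"
    and "continuous_on UNIV T"
  shows "(SUP \<mu>\<in>invariant_prob_measures T. meas_seq_entropy \<mu> A T) \<le> top_seq_entropy A T \<and>
    (\<not> (K_const A = \<infinity> \<and> top_entropy T = 0) \<longrightarrow>
       (SUP \<mu>\<in>invariant_prob_measures T. meas_seq_entropy \<mu> A T) = top_seq_entropy A T) \<and>
    (\<not> (K_const A = \<infinity> \<and> top_entropy T = 0) \<longrightarrow>
       (K_const A < \<infinity> \<and> top_entropy T < \<infinity> \<longrightarrow>
          top_seq_entropy A T = K_const A * top_entropy T) \<and>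
       (K_const A = \<infinity> \<and> top_entropy T > 0 \<longrightarrow> top_seq_entropy A T = \<infinity>) \<and>
       (K_const A > 0 \<and> top_entropy T = \<infinity> \<longrightarrow> top_seq_entropy A T = \<infinity>) \<and>
       (K_const A = 0 \<and> top_entropy T = \<infinity> \<longrightarrow> top_seq_entropy A T = 0))"
proof -
  have le: "(SUP \<mu>\<in>invariant_prob_measures T. meas_seq_entropy \<mu> A T) \<le> top_seq_entropy A T"
    using meas_seq_entropy_le_top[OF _ assms(2)] by (rule SUP_least)
  \<comment> \<open>The chain of inequalities closes up, and the four cases only evaluate the product.\<close>
  have eq: "(SUP \<mu>\<in>invariant_prob_measures T. meas_seq_entropy \<mu> A T) = K_const A * top_entropy T"
    "top_seq_entropy A T = K_const A * top_entropy T"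
    if "\<not> (K_const A = \<infinity> \<and> top_entropy T = 0)"
    using le K_mult_top_entropy_le[OF assms, of A] top_seq_entropy_le_K_mult[OF that]
    by (meson antisym order_trans)+
  show ?thesis
  proof (intro conjI impI; (elim conjE)?)
    show "(SUP \<mu>\<in>invariant_prob_measures T. meas_seq_entropy \<mu> A T) \<le> top_seq_entropy A T" by (rule le)
  qed (simp_all add: eq)
qed

end
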